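(* Let $C$ be a smooth planar curve with at most cusp singularities, with arc length parameterization (except at singular points) $s\mapsto f_C(s)$, which is not locally a straight line. Let $\rho_C$ be its radius of curvature, let $'$ denote the derivative with respect to arc length, and let $$\gamma_{SES(C)}(s)=f_C(s)+\frac{-\rho_C(s)\rho_C'(s)\,t_C(s)+\rho_C(s)\,n_C(s)}{1+\rho_C'^2(s)}$$ be the parameterization of the singular evolutoids set $SES(C)$. Then: (i) The singular evolutoids set of $C$ can be given by a smooth parameterization. (ii) If $f_C(s)$ is not a cusp, then the singular evolutoids set of $C$ is singular at $\gamma_{SES(C)}(s)$ if and only if $\rho_C''(s)=0$, and the singular point is a cusp if and only if $\rho_C'''(s)\neq0$. (iii) If $f_C(s)$ is a cusp of $C$, then $SES(C)$ has a cusp at $f_C(s)$. (iv) The singular evolutoids set of $C$ has an inflexion point or an undulation point at $\gamma_{SES(C)}(s)$ if and only if $1+\rho_C'^2(s)+2\rho_C(s)\rho_C''(s)=0$, and the inflexion point is non-degenerate if and only if $\rho_C'(s)+\rho_C'^3(s)-\rho_C^2(s)\rho_C'''(s)\neq0$. (v) The subset of smooth closed curves $f$ with at most cusp singularities for which the singular evolutoids set has at most cusp singularities, no undulation points, and at most non-degenerate inflexion points is dense in $C^\infty(S^1,\mathbb R^2)$ with the Whitney $C^\infty$ topology.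
   Context: A smooth planar curve is the image of a $C^\infty$ map $f_C$ from an interval to $\mathbb R^2$; it is closed if it is given by a $C^\infty$ map $S^1\to\mathbb R^2$. A point with $f'=0$ is singular; a singular point is a cusp if the curve is locally diffeomorphic there (in source and target) to $t\mapsto(t^2,t^3)$ at $t=0$, equivalently if $f'',f'''$ are linearly independent there. A regular point is an inflexion point if the signed curvature changes sign there, and an undulation point if the curvature vanishes there without changing sign; an inflexion point is non-degenerate if $\det(f',f''')\ne0$ there. $\kappa_C,\rho_C=1/\kappa_C,t_C,n_C$ denote the signed curvature, radius of curvature, unit tangent and unit normal, $(t_C,n_C)$ being positively oriented. At a cusp the radius of curvature is $0$ (as a limiting value) and the tangent line is defined as a limiting line. For $\alpha\in[0,\pi]$ the $\alpha$-evolutoid $\mathcal E_\alpha(C)$ is the envelope of the lines obtained by rotating each tangent line of $C$ about its point of tangency by the angle $\alpha$ counterclockwise. For $\alpha\in(0,\pi)$ it is parameterized by $\gamma_\alpha(s)=f_C(s)+\rho_C(s)\sin\alpha\cos\alpha\; t_C(s)+\rho_C(s)\sin^2\alpha\; n_C(s)$, and its singular points are the singular points of this parameterization (or an equivalent one). The singular evolutoids set $SES(C)$ is the set of all singular points of all $\mathcal E_\alpha(C)$, $\alpha\in[0,\pi]$. It is parameterized by $\gamma_{SES(C)}$, and "singular point", "cusp", "inflexion point", "undulation point" of $SES(C)$ refer to this parameterization (or an equivalent one). The curve $C$ is allowed to have cusps, inflexion points and undulation points; the parameterization $\gamma_{SES(C)}$ is still used there, being understood through its extension by limits.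
   Formalization: "Not locally a straight line" is read as: no point of infinite-order contact with a line, since otherwise (i) fails (e.g. curvature exp(-1/s^2) sin(1/s)); and (iv) is stated only where the curvature of C is nonzero or C has a cusp, as it fails at inflexion points of C. *)

theory Defs
  imports "HOL-Analysis.Analysis"
begin

section \<open>Smooth curves on an interval\<close>

definition proper_interval :: "real set \<Rightarrow> bool" where
  "proper_interval I \<longleftrightarrow> is_interval I \<and> interior I \<noteq> {}"

text \<open>Derivatives are taken within \<open>I\<close>, hence one-sided at endpoints that belong to \<open>I\<close>.\<close>

primrec nderiv :: "real set \<Rightarrow> nat \<Rightarrow> (real \<Rightarrow> 'a::real_normed_vector) \<Rightarrow> real \<Rightarrow> 'a" where
  "nderiv I 0 f = f"
| "nderiv I (Suc k) f = (\<lambda>t. vector_derivative (nderiv I k f) (at t within I))"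

definition smooth_on :: "real set \<Rightarrow> (real \<Rightarrow> 'a::real_normed_vector) \<Rightarrow> bool" where
  "smooth_on I f \<longleftrightarrow> (\<forall>k. \<forall>t\<in>I. nderiv I k f differentiable (at t within I))"

definition det2 :: "real^2 \<Rightarrow> real^2 \<Rightarrow> real" where
  "det2 u v = det (vector [u, v] :: real^2^2)"

definition singular_pt :: "real set \<Rightarrow> (real \<Rightarrow> real^2) \<Rightarrow> real \<Rightarrow> bool" where
  "singular_pt I f s \<longleftrightarrow> nderiv I 1 f s = 0"

text \<open>The determinant condition says that \<open>f''\<close> and \<open>f'''\<close> are linearly independent.\<close>

definition cusp :: "real set \<Rightarrow> (real \<Rightarrow> real^2) \<Rightarrow> real \<Rightarrow> bool" where
  "cusp I f s \<longleftrightarrow> singular_pt I f s \<and> det2 (nderiv I 2 f s) (nderiv I 3 f s) \<noteq> 0"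

definition at_most_cusps :: "real set \<Rightarrow> (real \<Rightarrow> real^2) \<Rightarrow> bool" where
  "at_most_cusps I f \<longleftrightarrow> (\<forall>s\<in>I. singular_pt I f s \<longrightarrow> cusp I f s)"

text \<open>
  Being nowhere locally a straight line is understood on the level of Taylor expansions: at no
  point does the curve have contact of infinite order with a line (of direction \<open>v\<close>).  Without
  this, for instance for signed curvature \<open>exp (-1/s^2) * sin (1/s)\<close>, the parameterization of the
  singular evolutoids set has no continuous extension to \<open>s = 0\<close>.
\<close>

definition not_locally_line :: "real set \<Rightarrow> (real \<Rightarrow> real^2) \<Rightarrow> bool" where
  "not_locally_line I f \<longleftrightarrow>
     (\<forall>s\<in>I. \<forall>v. v \<noteq> 0 \<longrightarrow> (\<exists>k\<ge>1. det2 v (nderiv I k f s) \<noteq> 0))"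

section \<open>Curvature, inflexion points and undulation points\<close>

definition curvature :: "real set \<Rightarrow> (real \<Rightarrow> real^2) \<Rightarrow> real \<Rightarrow> real" where
  "curvature I f s = det2 (nderiv I 1 f s) (nderiv I 2 f s) / norm (nderiv I 1 f s) ^ 3"

definition flat_pt :: "real set \<Rightarrow> (real \<Rightarrow> real^2) \<Rightarrow> real \<Rightarrow> bool" where
  "flat_pt I f s \<longleftrightarrow> \<not> singular_pt I f s \<and> curvature I f s = 0"

definition changes_sign :: "real set \<Rightarrow> (real \<Rightarrow> real) \<Rightarrow> real \<Rightarrow> bool" where
  "changes_sign I g s \<longleftrightarrow>
     (\<exists>e>0. {s-e<..<s+e} \<subseteq> I \<and> (\<forall>x\<in>{s-e<..<s}. \<forall>y\<in>{s<..<s+e}. g x * g y < 0))"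

definition inflexion_pt :: "real set \<Rightarrow> (real \<Rightarrow> real^2) \<Rightarrow> real \<Rightarrow> bool" where
  "inflexion_pt I f s \<longleftrightarrow> \<not> singular_pt I f s \<and> changes_sign I (curvature I f) s"

definition undulation_pt :: "real set \<Rightarrow> (real \<Rightarrow> real^2) \<Rightarrow> real \<Rightarrow> bool" where
  "undulation_pt I f s \<longleftrightarrow>
     \<not> singular_pt I f s \<and> curvature I f s = 0 \<and> \<not> changes_sign I (curvature I f) s"

definition nondegenerate :: "real set \<Rightarrow> (real \<Rightarrow> real^2) \<Rightarrow> real \<Rightarrow> bool" where
  "nondegenerate I f s \<longleftrightarrow> det2 (nderiv I 1 f s) (nderiv I 3 f s) \<noteq> 0"

section \<open>Radius of curvature, Frenet frame and arc length derivatives\<close>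

text \<open>
  At a singular point the convention \<open>x / 0 = 0\<close> gives the radius its limiting value \<open>0\<close> at a
  cusp.  At a flat point the radius is infinite; its formal value \<open>0\<close> there is never used.
\<close>

definition radius :: "real set \<Rightarrow> (real \<Rightarrow> real^2) \<Rightarrow> real \<Rightarrow> real" where
  "radius I f s = 1 / curvature I f s"

definition tangent :: "real set \<Rightarrow> (real \<Rightarrow> real^2) \<Rightarrow> real \<Rightarrow> real^2" where
  "tangent I f s = sgn (nderiv I 1 f s)"

definition normal_vec :: "real set \<Rightarrow> (real \<Rightarrow> real^2) \<Rightarrow> real \<Rightarrow> real^2" where
  "normal_vec I f s = vector [- (tangent I f s $ 2), tangent I f s $ 1]"

text \<open>
  Curves with cusps have no smooth arc length parameterization, so curves are given by an
  arbitrary smooth parameter and the derivative with respect to arc length at regular points is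
  \<open>(1 / norm f') d/dt\<close>.
\<close>

definition arc_deriv ::
    "real set \<Rightarrow> (real \<Rightarrow> real^2) \<Rightarrow> (real \<Rightarrow> real) \<Rightarrow> real \<Rightarrow> real" where
  "arc_deriv I f g s = vector_derivative g (at s within I) / norm (nderiv I 1 f s)"

definition radius_deriv ::
    "real set \<Rightarrow> (real \<Rightarrow> real^2) \<Rightarrow> nat \<Rightarrow> real \<Rightarrow> real" where
  "radius_deriv I f k = (arc_deriv I f ^^ k) (radius I f)"

section \<open>Evolutoids and the singular evolutoids set\<close>

text \<open>For \<open>\<alpha> = 0\<close> and \<open>\<alpha> = \<pi>\<close> this is the curve itself.\<close>

definition evolutoid :: "real set \<Rightarrow> (real \<Rightarrow> real^2) \<Rightarrow> real \<Rightarrow> real \<Rightarrow> real^2" where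
  "evolutoid I f \<alpha> s = f s
     + (radius I f s * sin \<alpha> * cos \<alpha>) *\<^sub>R tangent I f s
     + (radius I f s * (sin \<alpha>)\<^sup>2) *\<^sub>R normal_vec I f s"

text \<open>
  At a flat point the evolutoids for \<open>0 < \<alpha> < \<pi>\<close> are at infinity, and the curve itself is regular.
\<close>

definition singular_evolutoids_set :: "real set \<Rightarrow> (real \<Rightarrow> real^2) \<Rightarrow> (real^2) set" where
  "singular_evolutoids_set I f =
     {evolutoid I f \<alpha> s | \<alpha> s. \<alpha> \<in> {0..pi} \<and> s \<in> I \<and> \<not> flat_pt I f s \<and>
        (evolutoid I f \<alpha> has_vector_derivative 0) (at s within I)}"

definition ses_formula :: "real set \<Rightarrow> (real \<Rightarrow> real^2) \<Rightarrow> real \<Rightarrow> real^2" where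
  "ses_formula I f s = f s +
     (1 / (1 + (radius_deriv I f 1 s)\<^sup>2)) *\<^sub>R
       ((- (radius I f s * radius_deriv I f 1 s)) *\<^sub>R tangent I f s
        + radius I f s *\<^sub>R normal_vec I f s)"

text \<open>The formula is extended by limits to the cusps and the flat points of the curve.\<close>

definition ses_param :: "real set \<Rightarrow> (real \<Rightarrow> real^2) \<Rightarrow> real \<Rightarrow> real^2" where
  "ses_param I f s =
     (if \<not> singular_pt I f s \<and> \<not> flat_pt I f s then ses_formula I f s
      else Lim (at s within I) (ses_formula I f))"

section \<open>Closed curves and the Whitney topology\<close>

text \<open>Smooth maps from the circle are represented by smooth \<open>2\<pi>\<close>-periodic maps.\<close>

definition closed_curves :: "(real \<Rightarrow> real^2) set" where
  "closed_curves = {f. smooth_on UNIV f \<and> (\<forall>t. f (t + 2 * pi) = f t)}"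

text \<open>
  The space of \<open>k\<close>-jets of maps from the circle to the plane is realised inside
  \<open>complex \<times> (nat \<Rightarrow> real^2)\<close> (with the product topology) as the circle times the sequences that
  vanish beyond index \<open>k\<close>.
\<close>

definition jet :: "nat \<Rightarrow> (real \<Rightarrow> real^2) \<Rightarrow> real \<Rightarrow> complex \<times> (nat \<Rightarrow> real^2)" where
  "jet k f t = (cis t, \<lambda>i. if i \<le> k then nderiv UNIV i f t else 0)"

definition whitney_topology :: "(real \<Rightarrow> real^2) topology" where
  "whitney_topology =
     topology_generated_by {{f \<in> closed_curves. \<forall>t. jet k f t \<in> U} | k U. open U}"

end

theory Submission
  imports Defs
begin

text \<open>
  Identify the plane with \<open>complex\<close> and put \<open>z = f'' / f'\<close>, \<open>a = Re z\<close> and \<open>b = Im z\<close>, so that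
  \<open>a\<close> and \<open>b\<close> are the logarithmic derivative of the speed and the derivative of the tangent angle.
  Then \<open>\<rho> = |f'| / b\<close> and, for an arbitrary parameter, \<open>\<gamma> = f + b f' / E\<close> with \<open>E = b' - b z\<close>.
  Differentiating gives \<open>\<gamma>' = N2 f' / E\<^sup>2\<close> with a real factor \<open>N2\<close> that vanishes with the second arc
  length derivative \<open>\<rho>''\<close>, and the curvature of \<open>\<gamma>\<close> has the sign of \<open>b M\<close>, where, with arc length
  derivatives on the right,
  \<open>M = b\<^sup>4 (1 + \<rho>'\<^sup>2 + 2 \<rho> \<rho>'')\<close>.  Singularities, cusps and flexes of \<open>\<gamma>\<close> are thus read off
  \<open>N2\<close>, \<open>M\<close> and their derivatives.  At cusps and flat points of \<open>f\<close> one factors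
  \<open>f' = (t - s)\<^sup>j h\<close> and \<open>b = (t - s)\<^sup>m \<beta>\<close>, which turns the formula for \<open>\<gamma>\<close> into a smooth one.

  For density, add to \<open>f'\<close> a trigonometric polynomial with frequencies \<open>1, \<dots>, 5\<close>.  Its five complex
  coefficients correspond bijectively to the values of the first five derivatives at any given
  parameter.  Each degeneracy imposes two real conditions on these derivatives, so together with
  the parameter it is described by nine real numbers, and the bad coefficients form a null set in
  ten dimensions.
\<close>

section \<open>Smooth functions on sets without isolated points\<close>

text \<open>The factorization of \<gamma>' decouples the criteria. Where E is nonzero, the vector f'
  / E^2 does not vanish, and its direction turns at the rate b M / |E|^2 with M = |E|^2 + 2 N2.
  Hence M is positive wherever N2 = 0, so a singular point is a cusp exactly at a simple zero of N2,
  and a flex is non-degenerate exactly at a simple zero of b M. The conditions on rho''' say that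
  such a zero is simple. Apart from f' = 0, the degeneracies in the density part are double zeros:
  b, N2 or M vanishing together with its derivative. The derivatives of N2 and M contain b''', hence
  the fifth derivative of f, which fixes the number of frequencies.

  In terms of the radius E = - b^2 (rho' + i), so E survives a simple zero of b although rho' does
  not. At zeros of b of higher order the quotient b / E is 0 / 0, and at cusps E is unbounded; there
  only the exact orders of vanishing show what the limit is. Contact of finite order with every line
  guarantees that these orders exist.\<close>

definition perfect_on :: "real set \<Rightarrow> bool" where
  "perfect_on S \<longleftrightarrow> (\<forall>t\<in>S. at t within S \<noteq> bot)"

lemma at_within_Int_open:
  fixes t :: real
  assumes "open U" "t \<in> U"
  shows "at t within (S \<inter> U) = at t within S"
  using assms by (intro at_within_nhd[of t U]) auto

text \<open>The parameters with f' nonzero, and those with nonzero curvature, form relatively open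
  subsets of I that need not be intervals. \<open>perfect_on\<close> is the property they inherit,
  and it gives uniqueness of derivatives within the set.\<close>

lemma perfect_on_Int_open:
  assumes "perfect_on S" "open U"
  shows "perfect_on (S \<inter> U)"
  using assms by (auto simp: perfect_on_def at_within_Int_open)

lemma proper_interval_perfect:
  assumes "proper_interval I"
  shows "perfect_on I"
  unfolding perfect_on_def
proof
  fix t assume t: "t \<in> I"
  have conv: "convex I"
    using assms by (simp add: proper_interval_def is_interval_convex_1)
  \<comment> \<open>A convex set with nonempty interior lies in the closure of that interior, so end
    points are limit points as well.\<close>
  have "t \<in> closure (interior I)"
    using convex_closure_interior[OF conv] assms t closure_subset[of I] by (auto simp: proper_interval_def)
  have "t islimpt I"
  proof (cases "t \<in> interior I")
    case True
    then show ?thesis by (simp add: interior_limit_point)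
  next
    case False
    with \<open>t \<in> closure (interior I)\<close> have "t islimpt interior I"
      by (auto simp: closure_def)
    then show ?thesis
      using interior_subset islimpt_subset by blast
  qed
  then show "at t within I \<noteq> bot"
    by (simp add: trivial_limit_within)
qed

lemma vector_derivative_unique_perfect:
  assumes "perfect_on S" "t \<in> S" "(g has_vector_derivative d) (at t within S)"
  shows "vector_derivative g (at t within S) = d"
  using assms vector_derivative_within unfolding perfect_on_def by blast

lemma has_vector_derivative_cong_near:
  assumes "(g has_vector_derivative d) (at t within S)" "open U" "t \<in> U" "t \<in> S"
    and "\<And>x. x \<in> S \<inter> U \<Longrightarrow> h x = g x"
  shows "(h has_vector_derivative d) (at t within S)"
proof -
  have "eventually (\<lambda>x. x \<in> U) (nhds t)"
    using assms(2,3) by (simp add: eventually_nhds_in_open)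
  then have ev: "\<forall>\<^sub>F x in nhds t. x \<in> S \<longrightarrow> g x = h x"
    by eventually_elim (use assms(5) in auto)
  then show ?thesis
    using has_vector_derivative_cong_ev[of S g h t d] assms by auto
qed

section \<open>Iterated derivatives and criteria for smoothness\<close>

lemma nderiv_nderiv: "nderiv S k (nderiv S j g) = nderiv S (k + j) g"
  by (induction k) auto

lemma nderiv_Suc': "nderiv S (Suc k) g = nderiv S k (nderiv S 1 g)"
  by (simp only: nderiv_nderiv Suc_eq_plus1)

lemma nderiv_cong:
  assumes "\<And>x. x \<in> S \<Longrightarrow> g x = h x" "t \<in> S"
  shows "nderiv S k g t = nderiv S k h t"
  using assms(2)
proof (induction k arbitrary: t)
  case 0
  then show ?case using assms by simp
next
  case (Suc k)
  have "vector_derivative (nderiv S k g) (at t within S) = vector_derivative (nderiv S k h) (at t within S)"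
    using Suc by (intro vector_derivative_cong_eq) (auto simp: eventually_at_topological)
  then show ?case by simp
qed

lemma smooth_on_has_vector_derivative:
  assumes "smooth_on S g" "t \<in> S"
  shows "(nderiv S k g has_vector_derivative nderiv S (Suc k) g t) (at t within S)"
  using assms by (auto simp: smooth_on_def vector_derivative_works[symmetric])

lemma smooth_on_has_vector_derivative_0:
  assumes "smooth_on S g" "t \<in> S"
  shows "(g has_vector_derivative nderiv S 1 g t) (at t within S)"
  using smooth_on_has_vector_derivative[OF assms, of 0] by simp

lemma smooth_on_nderiv: "smooth_on S g \<Longrightarrow> smooth_on S (nderiv S k g)"
  by (simp add: smooth_on_def nderiv_nderiv)

lemma nderiv_tower:
  assumes "perfect_on S"
    and "\<And>k t. t \<in> S \<Longrightarrow> (G k has_vector_derivative G (Suc k) t) (at t within S)"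
    and "t \<in> S"
  shows "nderiv S k (G 0) t = G k t"
  using assms(3)
proof (induction k arbitrary: t)
  case 0
  then show ?case by simp
next
  case (Suc k)
  have "(nderiv S k (G 0) has_vector_derivative G (Suc k) t) (at t within S)"
    by (rule has_vector_derivative_cong_near[OF assms(2) open_UNIV]) (use Suc in blast)+
  then show ?case
    using vector_derivative_unique_perfect[OF assms(1)] Suc.prems by simp
qed

lemma smooth_on_tower:
  assumes "perfect_on S"
    and "\<And>k t. t \<in> S \<Longrightarrow> (G k has_vector_derivative G (Suc k) t) (at t within S)"
  shows "smooth_on S (G 0)"
  unfolding smooth_on_def
proof (intro allI ballI)
  fix k t assume t: "t \<in> S"
  have "(nderiv S k (G 0) has_vector_derivative G (Suc k) t) (at t within S)"
    by (rule has_vector_derivative_cong_near[OF assms(2) open_UNIV])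
      (use t nderiv_tower[of S G, OF assms] in blast)+
  then show "nderiv S k (G 0) differentiable at t within S"
    by (rule differentiableI_vector)
qed

lemma nderiv_step:
  assumes "perfect_on S" "\<And>t. t \<in> S \<Longrightarrow> (g has_vector_derivative g' t) (at t within S)" "t \<in> S"
  shows "nderiv S (Suc k) g t = nderiv S k g' t"
proof -
  have "nderiv S (Suc k) g t = nderiv S k (nderiv S 1 g) t"
    by (simp only: nderiv_Suc')
  also have "\<dots> = nderiv S k g' t"
    using assms vector_derivative_unique_perfect[OF assms(1)] by (intro nderiv_cong) auto
  finally show ?thesis .
qed

text \<open>Smoothness follows from a class of functions in which every member has a derivative from
  the same class. In the induction on the order the member g is generalized, and
  \<open>nderiv_step\<close> moves one derivative inwards.\<close>

lemma smooth_on_coinduct: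
  assumes perf: "perfect_on S" and "P g"
    and step: "\<And>g. P g \<Longrightarrow> \<exists>g'. P g' \<and> (\<forall>t\<in>S. (g has_vector_derivative g' t) (at t within S))"
  shows "smooth_on S g"
  unfolding smooth_on_def
proof
  fix k
  show "\<forall>t\<in>S. nderiv S k g differentiable (at t within S)"
    using \<open>P g\<close>
  proof (induction k arbitrary: g)
    case 0
    then show ?case using step differentiableI_vector by fastforce
  next
    case (Suc k)
    obtain g' where g': "P g'" "\<forall>t\<in>S. (g has_vector_derivative g' t) (at t within S)"
      using step Suc.prems by blast
    show ?case
    proof
      fix t assume t: "t \<in> S"
      have "(nderiv S k g' has_vector_derivative vector_derivative (nderiv S k g') (at t within S)) (at t within S)"
        using Suc.IH[OF g'(1)] t by (auto simp: vector_derivative_works[symmetric])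
      then have "(nderiv S (Suc k) g has_vector_derivative vector_derivative (nderiv S k g') (at t within S)) (at t within S)"
        by (rule has_vector_derivative_cong_near[of _ _ _ _ UNIV])
          (use t g' nderiv_step[OF perf, of g g' _ k] in \<open>auto simp del: nderiv.simps\<close>)
      then show "nderiv S (Suc k) g differentiable at t within S"
        by (rule differentiableI_vector)
    qed
  qed
qed

lemma smooth_onI:
  assumes "perfect_on S" "\<And>t. t \<in> S \<Longrightarrow> (g has_vector_derivative g' t) (at t within S)"
    and "smooth_on S g'"
  shows "smooth_on S g"
proof (rule smooth_on_coinduct[where P = "\<lambda>h. h = g \<or> smooth_on S h", OF assms(1)])
  fix h assume "h = g \<or> smooth_on S h"
  then show "\<exists>h'. (h' = g \<or> smooth_on S h') \<and> (\<forall>t\<in>S. (h has_vector_derivative h' t) (at t within S))"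
  proof
    assume "h = g"
    then show ?thesis using assms(2,3) by blast
  next
    assume h: "smooth_on S h"
    then show ?thesis
      using smooth_on_has_vector_derivative_0[OF h] smooth_on_nderiv[OF h, of 1] by blast
  qed
qed simp

lemma smooth_on_cong:
  assumes "perfect_on S" "smooth_on S g" "\<And>t. t \<in> S \<Longrightarrow> h t = g t"
  shows "smooth_on S h"
proof (rule smooth_onI[OF assms(1)])
  show "smooth_on S (nderiv S 1 g)" using smooth_on_nderiv assms by blast
  fix t assume "t \<in> S"
  then show "(h has_vector_derivative nderiv S 1 g t) (at t within S)"
    using has_vector_derivative_cong_near[OF smooth_on_has_vector_derivative_0[OF assms(2)] open_UNIV]
      assms(3) by blast
qed

lemma nderiv_Int_open:
  assumes "open U" "t \<in> S \<inter> U"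
  shows "nderiv (S \<inter> U) k g t = nderiv S k g t"
  using assms(2)
proof (induction k arbitrary: t)
  case 0
  then show ?case by simp
next
  case (Suc k)
  have "at t within (S \<inter> U) = at t within S"
    using Suc.prems assms at_within_Int_open by auto
  moreover have "vector_derivative (nderiv (S \<inter> U) k g) (at t within S) = vector_derivative (nderiv S k g) (at t within S)"
    using Suc assms(1) eventually_nhds_in_open[of U t]
    by (intro vector_derivative_cong_eq) (auto elim: eventually_mono)
  ultimately show ?case by simp
qed

lemma smooth_on_Int_open:
  assumes "smooth_on S g" "open U"
  shows "smooth_on (S \<inter> U) g"
  unfolding smooth_on_def
proof (intro allI ballI)
  fix k t assume t: "t \<in> S \<inter> U"
  have "(nderiv S k g has_vector_derivative nderiv S (Suc k) g t) (at t within (S \<inter> U))"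
    using smooth_on_has_vector_derivative[OF assms(1), of t k] at_within_Int_open[OF assms(2), of t S] t by simp
  then have "(nderiv (S \<inter> U) k g has_vector_derivative nderiv S (Suc k) g t) (at t within (S \<inter> U))"
    by (rule has_vector_derivative_cong_near[OF _ open_UNIV])
      (use t nderiv_Int_open[OF assms(2), where S = S and k = k and g = g] in auto)
  then show "nderiv (S \<inter> U) k g differentiable at t within (S \<inter> U)"
    by (rule differentiableI_vector)
qed

lemma smooth_on_locally:
  assumes "perfect_on S" "\<And>s. s \<in> S \<Longrightarrow> \<exists>U. open U \<and> s \<in> U \<and> smooth_on (S \<inter> U) g"
  shows "smooth_on S g"
  unfolding smooth_on_def
proof (intro allI ballI)
  fix k t assume t: "t \<in> S"
  then obtain U where U: "open U" "t \<in> U" "smooth_on (S \<inter> U) g"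
    using assms by blast
  have "(nderiv (S \<inter> U) k g has_vector_derivative nderiv (S \<inter> U) (Suc k) g t) (at t within S)"
    using smooth_on_has_vector_derivative[OF U(3), of t k] at_within_Int_open[OF U(1,2)] t U by simp
  then have "(nderiv S k g has_vector_derivative nderiv (S \<inter> U) (Suc k) g t) (at t within S)"
    by (rule has_vector_derivative_cong_near[of _ _ _ _ U])
      (use t U nderiv_Int_open[OF U(1), where S = S and k = k and g = g] in auto)
  then show "nderiv S k g differentiable at t within S"
    by (rule differentiableI_vector)
qed

lemma smooth_on_continuous_on:
  assumes "smooth_on S g"
  shows "continuous_on S (nderiv S k g)"
  using assms differentiable_imp_continuous_within 
  unfolding continuous_on_eq_continuous_within smooth_on_def by blast

lemma has_vector_derivative_linear:
  assumes "bounded_linear T" "smooth_on S g" "t \<in> S"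
  shows "((\<lambda>t. T (nderiv S k g t)) has_vector_derivative T (nderiv S (Suc k) g t)) (at t within S)"
  using bounded_linear.has_vector_derivative[of T "nderiv S k g"] assms smooth_on_has_vector_derivative
  by blast

lemma nderiv_linear:
  assumes "perfect_on S" "bounded_linear T" "smooth_on S g" "t \<in> S"
  shows "nderiv S k (\<lambda>t. T (g t)) t = T (nderiv S k g t)"
proof -
  have "nderiv S k (\<lambda>t. T (nderiv S 0 g t)) t = T (nderiv S k g t)"
    by (rule nderiv_tower[where G = "\<lambda>k t. T (nderiv S k g t)"])
      (use assms has_vector_derivative_linear in auto)
  then show ?thesis by simp
qed

lemma smooth_on_linear:
  assumes "perfect_on S" "bounded_linear T" "smooth_on S g"
  shows "smooth_on S (\<lambda>t. T (g t))"
proof -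
  have "smooth_on S (\<lambda>t. T (nderiv S 0 g t))"
    by (rule smooth_on_tower[where G = "\<lambda>k t. T (nderiv S k g t)"])
      (use assms has_vector_derivative_linear in auto)
  then show ?thesis by simp
qed

section \<open>Algebra of smooth functions\<close>

lemma has_vector_derivative_inverse:
  fixes g :: "real \<Rightarrow> 'a::real_normed_field"
  assumes "(g has_vector_derivative d) (at t within S)" "g t \<noteq> 0"
  shows "((\<lambda>t. inverse (g t)) has_vector_derivative - (d * (inverse (g t) * inverse (g t)))) (at t within S)"
proof -
  have "(inverse has_field_derivative - (inverse (g t) ^ Suc (Suc 0))) (at (g t) within g ` S)"
    using assms by (intro DERIV_inverse)
  from field_vector_diff_chain_within[OF assms(1) this]
  show ?thesis by (simp add: o_def)
qed

lemma has_vector_derivative_divide':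
  fixes g :: "real \<Rightarrow> 'a::real_normed_field"
  assumes "(g has_vector_derivative g') (at t within S)" "(h has_vector_derivative h') (at t within S)" "h t \<noteq> 0"
  shows "((\<lambda>t. g t / h t) has_vector_derivative (g' * h t - g t * h') / (h t)\<^sup>2) (at t within S)"
  unfolding divide_inverse
  by (rule has_vector_derivative_eq_rhs, rule has_vector_derivative_mult[OF assms(1) has_vector_derivative_inverse[OF assms(2,3)]])
    (use assms(3) in \<open>simp add: field_simps power2_eq_square\<close>)

text \<open>
  The class is closed under differentiation, so by coinduction it contains only smooth functions.
  This spares us a Leibniz rule.
\<close>

inductive smooth_alg :: "real set \<Rightarrow> (real \<Rightarrow> 'a::real_normed_field) \<Rightarrow> bool" for S where
  base: "smooth_on S g \<Longrightarrow> smooth_alg S g"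
| add: "smooth_alg S g \<Longrightarrow> smooth_alg S h \<Longrightarrow> smooth_alg S (\<lambda>t. g t + h t)"
| mult: "smooth_alg S g \<Longrightarrow> smooth_alg S h \<Longrightarrow> smooth_alg S (\<lambda>t. g t * h t)"
| inverse: "smooth_alg S g \<Longrightarrow> (\<forall>t\<in>S. g t \<noteq> 0) \<Longrightarrow> smooth_alg S (\<lambda>t. inverse (g t))"

lemma smooth_on_const:
  assumes "perfect_on S"
  shows "smooth_on S (\<lambda>t. c)"
  using smooth_on_tower[OF assms, of "\<lambda>k t. if k = 0 then c else 0"] by simp

lemma smooth_alg_imp_smooth:
  assumes perf: "perfect_on S" and "smooth_alg S g"
  shows "smooth_on S g"
proof (rule smooth_on_coinduct[where P = "smooth_alg S", OF perf \<open>smooth_alg S g\<close>])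
  fix g :: "real \<Rightarrow> 'a" assume "smooth_alg S g"
  then show "\<exists>g'. smooth_alg S g' \<and> (\<forall>t\<in>S. (g has_vector_derivative g' t) (at t within S))"
  proof induction
    case (base g)
    then show ?case
      using smooth_on_has_vector_derivative_0[OF base] smooth_alg.base[OF smooth_on_nderiv[OF base, of 1]] by blast
  next
    case (add g h)
    then obtain g' h' where "smooth_alg S g'" "smooth_alg S h'"
      "\<forall>t\<in>S. (g has_vector_derivative g' t) (at t within S)" "\<forall>t\<in>S. (h has_vector_derivative h' t) (at t within S)"
      by blast
    then show ?case
      by (intro exI[of _ "\<lambda>t. g' t + h' t"]) (auto intro: smooth_alg.add has_vector_derivative_add)
  next
    case (mult g h)
    then obtain g' h' where *: "smooth_alg S g'" "smooth_alg S h'"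
      "\<forall>t\<in>S. (g has_vector_derivative g' t) (at t within S)" "\<forall>t\<in>S. (h has_vector_derivative h' t) (at t within S)"
      by blast
    have "smooth_alg S (\<lambda>t. g t * h' t + g' t * h t)"
      using * mult by (intro smooth_alg.add smooth_alg.mult)
    moreover have "\<forall>t\<in>S. ((\<lambda>t. g t * h t) has_vector_derivative (g t * h' t + g' t * h t)) (at t within S)"
      using * by (auto intro: has_vector_derivative_mult)
    ultimately show ?case by (intro exI[of _ "\<lambda>t. g t * h' t + g' t * h t"]) simp
  next
    case (inverse g)
    then obtain g' where *: "smooth_alg S g'"
      "\<forall>t\<in>S. (g has_vector_derivative g' t) (at t within S)"
      by blast
    have "smooth_alg S (\<lambda>t. (- 1) * (g' t * (inverse (g t) * inverse (g t))))"
      using * inverse smooth_alg.base[OF smooth_on_const[OF perf]]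
      by (intro smooth_alg.mult smooth_alg.inverse) auto
    moreover have "\<forall>t\<in>S. ((\<lambda>t. Fields.inverse (g t)) has_vector_derivative (- 1) * (g' t * (Fields.inverse (g t) * Fields.inverse (g t)))) (at t within S)"
      using * inverse(2) has_vector_derivative_inverse by fastforce
    ultimately show ?case by blast
  qed
qed

lemma smooth_on_add:
  fixes g h :: "real \<Rightarrow> 'a::real_normed_field"
  assumes "perfect_on S" "smooth_on S g" "smooth_on S h"
  shows "smooth_on S (\<lambda>t. g t + h t)"
  by (rule smooth_alg_imp_smooth) (use assms in \<open>auto intro: smooth_alg.intros\<close>)

lemma smooth_on_mult:
  fixes g h :: "real \<Rightarrow> 'a::real_normed_field"
  assumes "perfect_on S" "smooth_on S g" "smooth_on S h"
  shows "smooth_on S (\<lambda>t. g t * h t)"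
  by (rule smooth_alg_imp_smooth) (use assms in \<open>auto intro: smooth_alg.intros\<close>)

lemma smooth_on_divide:
  fixes g h :: "real \<Rightarrow> 'a::real_normed_field"
  assumes "perfect_on S" "smooth_on S g" "smooth_on S h" "\<And>t. t \<in> S \<Longrightarrow> h t \<noteq> 0"
  shows "smooth_on S (\<lambda>t. g t / h t)"
  unfolding divide_inverse
  by (rule smooth_alg_imp_smooth[OF assms(1)], rule smooth_alg.mult, rule smooth_alg.base[OF assms(2)],
      rule smooth_alg.inverse, rule smooth_alg.base[OF assms(3)], use assms(4) in blast)

lemma smooth_on_diff:
  fixes g h :: "real \<Rightarrow> 'a::real_normed_field"
  assumes "perfect_on S" "smooth_on S g" "smooth_on S h"
  shows "smooth_on S (\<lambda>t. g t - h t)"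
proof -
  have "smooth_on S (\<lambda>t. g t + (- 1) * h t)"
    using assms by (intro smooth_on_add smooth_on_mult smooth_on_const)
  then show ?thesis by simp
qed

lemma smooth_on_power:
  fixes g :: "real \<Rightarrow> 'a::real_normed_field"
  assumes "perfect_on S" "smooth_on S g"
  shows "smooth_on S (\<lambda>t. g t ^ n)"
  by (induction n) (simp_all add: assms smooth_on_const smooth_on_mult)

lemma smooth_on_ident:
  assumes "perfect_on S"
  shows "smooth_on S (\<lambda>t. of_real (t - s) :: 'a::real_normed_field)"
  by (rule smooth_onI[OF assms, of _ "\<lambda>t. 1"]) (auto intro!: derivative_eq_intros smooth_on_const assms)

lemma smooth_on_Re: "perfect_on S \<Longrightarrow> smooth_on S g \<Longrightarrow> smooth_on S (\<lambda>t. Re (g t))"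
  by (rule smooth_on_linear[OF _ bounded_linear_Re])

lemma smooth_on_Im: "perfect_on S \<Longrightarrow> smooth_on S g \<Longrightarrow> smooth_on S (\<lambda>t. Im (g t))"
  by (rule smooth_on_linear[OF _ bounded_linear_Im])

lemma smooth_on_cnj: "perfect_on S \<Longrightarrow> smooth_on S g \<Longrightarrow> smooth_on S (\<lambda>t. cnj (g t))"
  by (rule smooth_on_linear[OF _ bounded_linear_cnj])

lemma smooth_on_of_real: "perfect_on S \<Longrightarrow> smooth_on S g \<Longrightarrow> smooth_on S (\<lambda>t. of_real (g t) :: 'a::real_normed_field)"
  by (rule smooth_on_linear[OF _ bounded_linear_of_real])

text \<open>Hadamard's lemma: h(t) is the integral of g'(s + u (t - s)) over u in [0, 1]. Each
  differentiation under the integral sign contributes a factor u and raises the order of the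
  derivative of g; at t = s the integral of u^k leaves 1 / (k + 1). Convexity of I keeps s + u (t -
  s) inside, also when s is an end point.\<close>

lemma smooth_on_factor:
  fixes g :: "real \<Rightarrow> 'a::{real_normed_field, banach}"
  assumes I: "proper_interval I" and g: "smooth_on I g" and s: "s \<in> I" and "g s = 0"
  shows "\<exists>h. smooth_on I h \<and> (\<forall>t\<in>I. g t = of_real (t - s) * h t) \<and>
    (\<forall>k. nderiv I k h s = nderiv I (Suc k) g s / of_nat (Suc k))"
proof -
  have perf: "perfect_on I" using I by (rule proper_interval_perfect)
  have conv: "convex I" using I by (simp add: proper_interval_def is_interval_convex_1)
  have inI: "s + u * (t - s) \<in> I" if "t \<in> I" "u \<in> {0..1}" for t u
  proof -
    have "(1 - u) *\<^sub>R s + u *\<^sub>R t \<in> I"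
      using convexD_alt[OF conv s \<open>t \<in> I\<close>, of u] that by simp
    then show ?thesis by (simp add: algebra_simps)
  qed
  have cont: "continuous_on (I \<times> cbox 0 1) (\<lambda>(t,u). (u ^ k) *\<^sub>R nderiv I k g (s + u * (t - s)))" for k
    unfolding split_beta
    by (intro continuous_intros continuous_on_compose2[OF smooth_on_continuous_on[OF g]])
      (use inI in auto)
  \<comment> \<open>The tower of all t-derivatives of the integral, in the form that
    \<open>smooth_on_tower\<close> expects.\<close>
  define G where "G k t = integral (cbox 0 1) (\<lambda>u. (u ^ k) *\<^sub>R nderiv I (Suc k) g (s + u * (t - s)))" for k t
  have G: "(G k has_vector_derivative G (Suc k) t) (at t within I)" if t: "t \<in> I" for k t
    unfolding G_def
  proof (rule leibniz_rule_vector_derivative[OF _ _ _ t conv])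
    fix x u :: real assume x: "x \<in> I" and u: "u \<in> cbox 0 1"
    have "((\<lambda>x. s + u * (x - s)) has_vector_derivative u) (at x within I)"
      by (auto intro!: derivative_eq_intros)
    moreover have "(nderiv I (Suc k) g has_vector_derivative nderiv I (Suc (Suc k)) g (s + u * (x - s)))
        (at (s + u * (x - s)) within (\<lambda>x. s + u * (x - s)) ` I)"
    proof (rule has_vector_derivative_within_subset[OF smooth_on_has_vector_derivative[OF g]])
      show "s + u * (x - s) \<in> I" using inI[OF x] u by simp
      show "(\<lambda>x. s + u * (x - s)) ` I \<subseteq> I" using inI u by auto
    qed
    ultimately have "((\<lambda>x. nderiv I (Suc k) g (s + u * (x - s))) has_vector_derivative
        u *\<^sub>R nderiv I (Suc (Suc k)) g (s + u * (x - s))) (at x within I)"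
      using vector_diff_chain_within by (fastforce simp: o_def)
    from has_vector_derivative_scaleR[OF DERIV_const[of "u^k"] this]
    show "((\<lambda>x. u ^ k *\<^sub>R nderiv I (Suc k) g (s + u * (x - s))) has_vector_derivative
            u ^ Suc k *\<^sub>R nderiv I (Suc (Suc k)) g (s + u * (x - s))) (at x within I)"
      by (simp add: mult.commute)
  next
    fix x assume x: "x \<in> I"
    have "continuous_on (cbox 0 1) (\<lambda>u. u ^ k *\<^sub>R nderiv I (Suc k) g (s + u * (x - s)))"
      by (intro continuous_intros continuous_on_compose2[OF smooth_on_continuous_on[OF g]])
        (use inI x in auto)
    then show "(\<lambda>u. u ^ k *\<^sub>R nderiv I (Suc k) g (s + u * (x - s))) integrable_on cbox 0 1"
      by (rule integrable_continuous)
  next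
    show "continuous_on (I \<times> cbox 0 1) (\<lambda>(x, u). u ^ Suc k *\<^sub>R nderiv I (Suc (Suc k)) g (s + u * (x - s)))"
      unfolding split_beta
      by (intro continuous_intros continuous_on_compose2[OF smooth_on_continuous_on[OF g]])
        (use inI in auto)
  qed
  have "smooth_on I (G 0)"
    by (rule smooth_on_tower[of I G, OF perf G])
  moreover have "g t = of_real (t - s) * G 0 t" if t: "t \<in> I" for t
  proof -
    have "((\<lambda>u. g (s + u * (t - s))) has_vector_derivative (t - s) *\<^sub>R nderiv I 1 g (s + u * (t - s))) (at u within {0..1})"
      if "u \<in> {0..1}" for u
    proof -
      have "((\<lambda>u. s + u * (t - s)) has_vector_derivative (t - s)) (at u within {0..1})"
        by (auto intro!: derivative_eq_intros)
      moreover have "(g has_vector_derivative nderiv I 1 g (s + u * (t - s)))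
        (at (s + u * (t - s)) within (\<lambda>u. s + u * (t - s)) ` {0..1})"
      proof (rule has_vector_derivative_within_subset[OF smooth_on_has_vector_derivative_0[OF g]])
        show "s + u * (t - s) \<in> I" using inI[OF t] that by simp
        show "(\<lambda>u. s + u * (t - s)) ` {0..1} \<subseteq> I" using inI[OF t] by auto
      qed
      ultimately show ?thesis
        using vector_diff_chain_within by (fastforce simp: o_def)
    qed
    then have *: "((\<lambda>u. (t - s) *\<^sub>R nderiv I 1 g (s + u * (t - s))) has_integral (g t - g s)) {0..1}"
      using fundamental_theorem_of_calculus[of 0 1 "\<lambda>u. g (s + u * (t - s))"] by fastforce
    have "g t = integral {0..1} (\<lambda>u. (t - s) *\<^sub>R nderiv I 1 g (s + u * (t - s)))"
      using integral_unique[OF *] \<open>g s = 0\<close> by simp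
    then show ?thesis
      by (simp add: G_def scaleR_conv_of_real)
  qed
  moreover have "nderiv I k (G 0) s = nderiv I (Suc k) g s / of_nat (Suc k)" for k
  proof -
    have "((\<lambda>u. u ^ Suc k / real (Suc k)) has_real_derivative u ^ k) (at u within {0..1})" for u :: real
      by (rule DERIV_cong[OF DERIV_cdivide[OF DERIV_pow]]) (simp del: of_nat_Suc)
    then have "((\<lambda>u. u ^ k) has_integral (1 ^ Suc k / real (Suc k) - 0 ^ Suc k / real (Suc k))) {0..1}"
      by (intro fundamental_theorem_of_calculus) (simp_all flip: has_real_derivative_iff_has_vector_derivative del: of_nat_Suc)
    then have "((\<lambda>u. u ^ k) has_integral (1 / real (Suc k))) {0..1}" by simp
    from has_integral_scaleR_left[OF this, of "nderiv I (Suc k) g s"]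
    have "G k s = (1 / real (Suc k)) *\<^sub>R nderiv I (Suc k) g s"
      by (simp add: G_def integral_unique)
    then show ?thesis
      using nderiv_tower[of I G, OF perf G s, of k] by (simp add: scaleR_conv_of_real)
  qed
  ultimately show ?thesis by blast
qed

text \<open>Each factor t - s split off by \<open>smooth_on_factor\<close> moves the nonvanishing
  derivative one order down, so the division stops after at most k steps.\<close>

lemma smooth_on_factor_power:
  fixes g :: "real \<Rightarrow> 'a::{real_normed_field, banach}"
  assumes I: "proper_interval I" and "smooth_on I g" and s: "s \<in> I" and "nderiv I k g s \<noteq> 0"
  shows "\<exists>n h. smooth_on I h \<and> h s \<noteq> 0 \<and> (\<forall>t\<in>I. g t = of_real (t - s) ^ n * h t)"
  using assms(2,4)
proof (induction k arbitrary: g)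
  case 0
  then show ?case by (intro exI[of _ 0] exI[of _ g]) simp
next
  case (Suc k)
  show ?case
  proof (cases "g s = 0")
    case False
    then show ?thesis using Suc by (intro exI[of _ 0] exI[of _ g]) simp
  next
    case True
    then obtain h where h: "smooth_on I h" "\<forall>t\<in>I. g t = of_real (t - s) * h t"
      "\<forall>k. nderiv I k h s = nderiv I (Suc k) g s / of_nat (Suc k)"
      using smooth_on_factor[OF I Suc.prems(1) s] by blast
    have "nderiv I k h s \<noteq> 0" using h(3) Suc.prems(2) by (simp del: nderiv.simps of_nat_Suc)
    then obtain n h' where "smooth_on I h'" "h' s \<noteq> 0" "\<forall>t\<in>I. h t = of_real (t - s) ^ n * h' t"
      using Suc.IH[OF h(1)] by blast
    then show ?thesis using h(2) by (intro exI[of _ "Suc n"] exI[of _ h']) simp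
  qed
qed

section \<open>Curves in complex notation\<close>

definition to_complex :: "real^2 \<Rightarrow> complex" where
  "to_complex v = Complex (v $ 1) (v $ 2)"

lemma linear_to_complex: "linear to_complex"
  by (intro linearI) (simp_all add: to_complex_def complex_eq_iff)

lemmas to_complex_add = linear_add[OF linear_to_complex]
lemmas to_complex_scaleR = linear_cmul[OF linear_to_complex]
lemmas to_complex_zero = linear_0[OF linear_to_complex]

lemma bounded_linear_to_complex: "bounded_linear to_complex"
  using linear_to_complex by (simp add: linear_conv_bounded_linear)

lemma to_complex_eq_iff: "to_complex u = to_complex v \<longleftrightarrow> u = v"
  by (auto simp: to_complex_def vec_eq_iff forall_2)

lemma to_complex_eq_0_iff: "to_complex u = 0 \<longleftrightarrow> u = 0"
  using to_complex_eq_iff[of u 0] by (simp add: to_complex_zero)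

lemma norm_to_complex: "norm (to_complex v) = norm v"
  by (simp add: to_complex_def norm_vec_def L2_set_def sum_2 complex_norm)

definition of_complex :: "complex \<Rightarrow> real^2" where
  "of_complex w = vector [Re w, Im w]"

lemma to_of_complex: "to_complex (of_complex w) = w"
  by (simp add: to_complex_def of_complex_def complex_eq_iff)

lemma of_to_complex: "of_complex (to_complex v) = v"
  by (metis to_complex_eq_iff to_of_complex)

lemma bounded_linear_of_complex: "bounded_linear of_complex"
proof -
  have "linear of_complex"
    by (intro linearI; subst to_complex_eq_iff[symmetric])
      (simp_all add: to_of_complex to_complex_add to_complex_scaleR)
  then show ?thesis by (simp add: linear_conv_bounded_linear)
qed

lemma det2_to_complex: "det2 u v = Im (cnj (to_complex u) * to_complex v)"
  by (simp add: det2_def det_2 to_complex_def)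

text \<open>Bridge between determinants and logarithmic derivatives: for w = f' and u = f'' the left
  side is the determinant in the curvature, and the quotient on the right is z.\<close>

lemma cnj_mult_divide:
  assumes "w \<noteq> 0"
  shows "Im (cnj w * u) = (norm w)\<^sup>2 * Im (u / w)"
proof -
  have "cnj w * u = of_real ((norm w)\<^sup>2) * (u / w)"
    using assms complex_norm_square[of w] by (simp add: mult.commute)
  then show ?thesis by (simp only: Im_complex_of_real Re_complex_of_real times_complex.sel)
qed

locale plane_curve =
  fixes I :: "real set" and f :: "real \<Rightarrow> real^2"
  assumes perfect: "perfect_on I" and smooth: "smooth_on I f"
begin

definition F :: "nat \<Rightarrow> real \<Rightarrow> complex" where
  "F k t = to_complex (nderiv I k f t)"

lemma F_deriv: "t \<in> I \<Longrightarrow> (F k has_vector_derivative F (Suc k) t) (at t within I)"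
  unfolding F_def
  by (rule has_vector_derivative_linear[OF bounded_linear_to_complex smooth])

lemma F_continuous: "continuous_on I (F k)"
  using F_deriv has_vector_derivative_continuous by (fastforce simp: continuous_on_eq_continuous_within)

lemma smooth_F: "smooth_on I (F k)"
  unfolding F_def
  by (intro smooth_on_linear[OF perfect bounded_linear_to_complex] smooth_on_nderiv smooth)

lemma nderiv_F: 
  assumes "t \<in> I"
  shows "nderiv I k (F j) t = F (k + j) t"
proof -
  have "nderiv I k (F (0 + j)) t = F (k + j) t"
    by (rule nderiv_tower[where G = "\<lambda>k. F (k + j)"]) (use perfect assms F_deriv in auto)
  then show ?thesis by simp
qed

lemma singular_pt_F: "singular_pt I f t \<longleftrightarrow> F 1 t = 0"
  unfolding singular_pt_def F_def by (simp only: to_complex_eq_0_iff)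

lemma cusp_F: "cusp I f t \<longleftrightarrow> F 1 t = 0 \<and> Im (cnj (F 2 t) * F 3 t) \<noteq> 0"
  unfolding cusp_def singular_pt_F by (simp only: det2_to_complex F_def)

definition reg :: "real set" where
  "reg = {t \<in> I. F 1 t \<noteq> 0}"

lemma regD: "t \<in> reg \<Longrightarrow> t \<in> I" "t \<in> reg \<Longrightarrow> F 1 t \<noteq> 0"
  by (auto simp: reg_def)

lemma reg_open: "\<exists>U. open U \<and> reg = I \<inter> U"
proof -
  have "openin (top_of_set I) (I \<inter> F 1 -` (- {0}))"
    using F_continuous[of 1] by (intro continuous_openin_preimage_gen) auto
  moreover have "I \<inter> F 1 -` (- {0}) = reg" by (auto simp: reg_def)
  ultimately show ?thesis by (auto simp: openin_open)
qed

lemma at_within_reg: "t \<in> reg \<Longrightarrow> at t within reg = at t within I"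
  using reg_open at_within_Int_open by auto

lemma perfect_reg: "perfect_on reg"
  using reg_open perfect_on_Int_open[OF perfect] by auto

text \<open>At a zero of f' the quotient has the default value 0, and near a cusp it has a pole.
  Therefore its derivatives are taken within \<open>reg\<close> and not within I.\<close>

definition Z :: "nat \<Rightarrow> real \<Rightarrow> complex" where
  "Z k = nderiv reg k (\<lambda>t. F 2 t / F 1 t)"

lemma F_2: "t \<in> reg \<Longrightarrow> F 2 t = Z 0 t * F 1 t"
  using regD by (simp add: Z_def)

lemma smooth_Z: "smooth_on reg (Z k)"
proof -
  obtain U where U: "open U" "reg = I \<inter> U" using reg_open by blast
  have "smooth_on reg (F k)" for k unfolding U(2) by (intro smooth_on_Int_open smooth_F U)
  then show ?thesis unfolding Z_def
    by (intro smooth_on_nderiv smooth_on_divide perfect_reg) (auto simp: reg_def)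
qed

lemma Z_deriv: "t \<in> reg \<Longrightarrow> (Z k has_vector_derivative Z (Suc k) t) (at t within I)"
  using smooth_on_has_vector_derivative[OF smooth_Z[of 0], of t k] at_within_reg by (simp add: Z_def)

section \<open>Speed, turning rate and radius of curvature\<close>

definition a :: "nat \<Rightarrow> real \<Rightarrow> real" where "a k t = Re (Z k t)"
definition b :: "nat \<Rightarrow> real \<Rightarrow> real" where "b k t = Im (Z k t)"

lemma a_deriv: "t \<in> reg \<Longrightarrow> (a k has_real_derivative a (Suc k) t) (at t within I)"
  unfolding a_def has_real_derivative_iff_has_vector_derivative
  by (rule bounded_linear.has_vector_derivative[OF bounded_linear_Re Z_deriv])

lemma b_deriv: "t \<in> reg \<Longrightarrow> (b k has_real_derivative b (Suc k) t) (at t within I)"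
  unfolding b_def has_real_derivative_iff_has_vector_derivative
  by (rule bounded_linear.has_vector_derivative[OF bounded_linear_Im Z_deriv])

lemma Z_ab: "Z k t = Complex (a k t) (b k t)"
  by (simp add: a_def b_def)

definition v :: "real \<Rightarrow> real" where "v t = norm (F 1 t)"

lemma v_pos: "t \<in> reg \<Longrightarrow> v t > 0"
  by (simp add: v_def reg_def)

lemma v_nderiv: "norm (nderiv I 1 f t) = v t"
  unfolding v_def F_def by (simp only: norm_to_complex)

lemma v_deriv:
  assumes t: "t \<in> reg"
  shows "(v has_real_derivative a 0 t * v t) (at t within I)"
proof -
  have d: "((\<lambda>t. Re (F 1 t)) has_real_derivative Re (F 2 t)) (at t within I)"
      "((\<lambda>t. Im (F 1 t)) has_real_derivative Im (F 2 t)) (at t within I)"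
    unfolding has_real_derivative_iff_has_vector_derivative
    using bounded_linear.has_vector_derivative[OF bounded_linear_Re F_deriv[of t 1]]
      bounded_linear.has_vector_derivative[OF bounded_linear_Im F_deriv[of t 1]] t regD
    by (auto simp: numeral_2_eq_2)
  have deriv: "((\<lambda>t. (Re (F 1 t))\<^sup>2 + (Im (F 1 t))\<^sup>2) has_real_derivative
     2 * (Re (F 1 t) * Re (F 2 t) + Im (F 1 t) * Im (F 2 t))) (at t within I)"
    by (rule derivative_eq_intros d refl)+ (simp add: algebra_simps)
  have pos: "(Re (F 1 t))\<^sup>2 + (Im (F 1 t))\<^sup>2 > 0"
    using regD(2)[OF t] by (auto simp: complex_eq_iff sum_power2_gt_zero_iff)
  have v: "v = (\<lambda>t. sqrt ((Re (F 1 t))\<^sup>2 + (Im (F 1 t))\<^sup>2))"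
    by (simp add: v_def[abs_def] cmod_def)
  have "Re (F 1 t) * Re (F 2 t) + Im (F 1 t) * Im (F 2 t) = a 0 t * (v t)\<^sup>2"
    unfolding v_def cmod_power2 F_2[OF t] by (simp add: a_def algebra_simps power2_eq_square)
  moreover have "(v has_real_derivative
     inverse (v t) / 2 * (2 * (Re (F 1 t) * Re (F 2 t) + Im (F 1 t) * Im (F 2 t)))) (at t within I)"
    unfolding v by (rule DERIV_chain2[OF DERIV_real_sqrt[OF pos] deriv])
  ultimately have "(v has_real_derivative inverse (v t) / 2 * (2 * (a 0 t * (v t)\<^sup>2))) (at t within I)"
    by (simp only:)
  moreover have "inverse (v t) / 2 * (2 * (a 0 t * (v t)\<^sup>2)) = a 0 t * v t"
    using v_pos[OF t] by (simp add: field_simps power2_eq_square)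
  ultimately show ?thesis by (simp only:)
qed

lemma curvature_eq: 
  assumes "t \<in> reg"
  shows "curvature I f t = b 0 t / v t"
proof -
  have "det2 (nderiv I 1 f t) (nderiv I 2 f t) = Im (cnj (F 1 t) * F 2 t)"
    unfolding det2_to_complex F_def ..
  also have "\<dots> = (v t)\<^sup>2 * b 0 t"
    using cnj_mult_divide[OF regD(2)[OF assms], of "F 2 t"] by (simp add: v_def b_def Z_def)
  finally show ?thesis
    using v_pos[OF assms] unfolding curvature_def v_nderiv by (simp add: power2_eq_square power3_eq_cube)
qed

lemma flat_pt_iff: "t \<in> I \<Longrightarrow> flat_pt I f t \<longleftrightarrow> t \<in> reg \<and> b 0 t = 0"
  using curvature_eq[of t] v_pos[of t] by (auto simp: flat_pt_def singular_pt_F reg_def)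

lemma radius_eq: "t \<in> reg \<Longrightarrow> radius I f t = v t / b 0 t"
  by (simp add: radius_def curvature_eq)

definition curved :: "real set" where
  "curved = {t \<in> reg. b 0 t \<noteq> 0}"

lemma curvedD: "t \<in> curved \<Longrightarrow> t \<in> reg" "t \<in> curved \<Longrightarrow> b 0 t \<noteq> 0" "t \<in> curved \<Longrightarrow> t \<in> I"
  by (auto simp: curved_def reg_def)

lemma curved_open: "\<exists>U. open U \<and> curved = I \<inter> U"
proof -
  have "continuous_on reg (b 0)"
    unfolding b_def using smooth_on_continuous_on[OF smooth_Z[of 0], of 0]
    by (intro continuous_intros) simp
  then have "openin (top_of_set reg) (reg \<inter> b 0 -` (- {0}))"
    by (intro continuous_openin_preimage_gen) auto
  moreover have "reg \<inter> b 0 -` (- {0}) = curved" by (auto simp: curved_def)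
  moreover have "openin (top_of_set I) reg"
    using reg_open by (auto simp: openin_open)
  ultimately show ?thesis using openin_trans by (metis openin_open)
qed

text \<open>
  \<open>P\<close> is the arc length derivative of the radius of curvature; \<open>N2\<close> and \<open>M\<close> are the numerators of
  the parameter derivative of \<open>P\<close> and of \<open>1 + \<rho>'\<^sup>2 + 2 \<rho> \<rho>''\<close>; \<open>N3\<close> and \<open>M1\<close> are their derivatives.
\<close>

definition P :: "real \<Rightarrow> real" where
  "P t = (a 0 t * b 0 t - b 1 t) / (b 0 t)\<^sup>2"

definition N2 :: "real \<Rightarrow> real" where
  "N2 t = 2 * (b 1 t)\<^sup>2 - b 0 t * b 2 t - a 0 t * b 0 t * b 1 t + a 1 t * (b 0 t)\<^sup>2"

definition N3 :: "real \<Rightarrow> real" where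
  "N3 t = 3 * b 1 t * b 2 t - b 0 t * b 3 t + a 1 t * b 0 t * b 1 t - a 0 t * (b 1 t)\<^sup>2
      - a 0 t * b 0 t * b 2 t + a 2 t * (b 0 t)\<^sup>2"

definition M :: "real \<Rightarrow> real" where
  "M t = (b 0 t)^4 + (a 0 t * b 0 t - b 1 t)\<^sup>2 + 2 * N2 t"

definition M1 :: "real \<Rightarrow> real" where
  "M1 t = 4 * (b 0 t)^3 * b 1 t
      + 2 * (a 0 t * b 0 t - b 1 t) * (a 1 t * b 0 t + a 0 t * b 1 t - b 2 t) + 2 * N3 t"

lemma ab_derivs:
  assumes "t \<in> reg"
  shows "(a 0 has_real_derivative a 1 t) (at t within I)" "(a 1 has_real_derivative a 2 t) (at t within I)"
    "(b 0 has_real_derivative b 1 t) (at t within I)" "(b 1 has_real_derivative b 2 t) (at t within I)"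
    "(b 2 has_real_derivative b 3 t) (at t within I)"
  using a_deriv[OF assms, of 0] a_deriv[OF assms, of 1] b_deriv[OF assms, of 0] b_deriv[OF assms, of 1]
    b_deriv[OF assms, of 2]
  by (simp_all add: numeral_2_eq_2 numeral_3_eq_3)

lemma N2_deriv: "t \<in> reg \<Longrightarrow> (N2 has_real_derivative N3 t) (at t within I)"
  unfolding N2_def[abs_def]
  by (rule derivative_eq_intros ab_derivs | assumption | rule refl)+
    (simp add: N3_def algebra_simps power2_eq_square)

lemma M_deriv: "t \<in> reg \<Longrightarrow> (M has_real_derivative M1 t) (at t within I)"
  unfolding M_def[abs_def]
  by (rule derivative_eq_intros ab_derivs N2_deriv | assumption | rule refl)+
    (simp add: M1_def algebra_simps power2_eq_square)

lemma P_deriv: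
  assumes "t \<in> curved"
  shows "(P has_real_derivative N2 t / (b 0 t)^3) (at t within I)"
  unfolding P_def[abs_def]
  apply (insert curvedD(1,2)[OF assms])
  apply (rule derivative_eq_intros ab_derivs | assumption | rule refl)+
   apply (simp; fail)
  apply (simp add: N2_def field_simps power2_eq_square power3_eq_cube)
  done

text \<open>The formula for one arc length derivative is known on \<open>curved\<close> only. Since
  that set is relatively open, agreement there is enough to differentiate once more, so
  \<open>radius_deriv\<close> can be climbed one order at a time.\<close>

lemma arc_deriv_eq:
  assumes "t \<in> curved" "(g has_real_derivative d) (at t within I)"
    and "\<And>x. x \<in> curved \<Longrightarrow> h x = g x"
  shows "arc_deriv I f h t = d / v t"
proof -
  obtain U where U: "open U" "curved = I \<inter> U" using curved_open by blast
  have "(h has_vector_derivative d) (at t within I)"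
    by (rule has_vector_derivative_cong_near[where U = U and g = g])
      (use assms U in \<open>auto simp: has_real_derivative_iff_has_vector_derivative\<close>)
  then show ?thesis
    unfolding arc_deriv_def v_nderiv
    using vector_derivative_unique_perfect[OF perfect curvedD(3)[OF assms(1)]] by metis
qed

lemma radius_deriv_1:
  assumes "t \<in> curved"
  shows "radius_deriv I f 1 t = P t"
proof -
  have "((\<lambda>t. v t / b 0 t) has_real_derivative v t * P t) (at t within I)"
    apply (insert curvedD(1,2)[OF assms])
    apply (rule derivative_eq_intros ab_derivs v_deriv | assumption | rule refl)+
    apply (simp add: P_def field_simps power2_eq_square)
    done
  from arc_deriv_eq[OF assms this, of "radius I f"] show ?thesis
    using radius_eq curvedD(1) v_pos[OF curvedD(1)[OF assms]] by (simp add: radius_deriv_def)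
qed

lemma radius_deriv_2:
  assumes "t \<in> curved"
  shows "radius_deriv I f 2 t = N2 t / ((b 0 t)^3 * v t)"
  using arc_deriv_eq[OF assms P_deriv[OF assms] radius_deriv_1]
  by (simp add: radius_deriv_def numeral_2_eq_2)

lemma radius_deriv_3:
  assumes "t \<in> curved"
  shows "radius_deriv I f 3 t = (N3 t * b 0 t - N2 t * (3 * b 1 t + a 0 t * b 0 t)) / ((b 0 t)^4 * (v t)\<^sup>2)"
proof -
  have "((\<lambda>t. N2 t / ((b 0 t)^3 * v t)) has_real_derivative
     (N3 t * b 0 t - N2 t * (3 * b 1 t + a 0 t * b 0 t)) / ((b 0 t)^4 * v t)) (at t within I)"
    apply (insert curvedD(1,2)[OF assms] v_pos[OF curvedD(1)[OF assms]])
    apply (rule derivative_eq_intros ab_derivs v_deriv N2_deriv | assumption | rule refl)+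
     apply (simp; fail)
    apply (simp add: field_simps power2_eq_square power3_eq_cube power4_eq_xxxx)
    done
  from arc_deriv_eq[OF assms this radius_deriv_2] show ?thesis
    by (simp add: radius_deriv_def numeral_3_eq_3 numeral_2_eq_2 power2_eq_square)
qed

text \<open>Equal to - b^2 (rho' + i) where b is nonzero. Unlike rho' it makes sense at flat points,
  and at a regular point it vanishes only if b and b' both do.\<close>

definition E :: "real \<Rightarrow> complex" where
  "E t = of_real (b 1 t) - of_real (b 0 t) * Z 0 t"

lemma E_ab: "E t = Complex (b 1 t - a 0 t * b 0 t) (- (b 0 t)\<^sup>2)"
  by (simp add: E_def complex_eq_iff a_def b_def power2_eq_square)

lemma E_nonzero: "b 0 t \<noteq> 0 \<or> b 1 t \<noteq> 0 \<Longrightarrow> E t \<noteq> 0"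
  by (auto simp: E_ab complex_eq_iff)

lemma to_complex_tangent: "t \<in> reg \<Longrightarrow> to_complex (tangent I f t) = F 1 t / of_real (v t)"
  unfolding tangent_def sgn_div_norm v_nderiv to_complex_scaleR F_def
  by (simp add: scaleR_conv_of_real divide_inverse mult.commute)

lemma to_complex_normal: "to_complex (normal_vec I f t) = \<i> * to_complex (tangent I f t)"
  by (simp add: normal_vec_def to_complex_def complex_eq_iff)

text \<open>In complex notation (- rho' + i) / (1 + rho'^2) is - 1 / (rho' + i), and rho times the
  unit tangent is f' / b. The two denominators combine to E / b.\<close>

lemma ses_formula_complex:
  assumes t: "t \<in> curved"
  shows "to_complex (ses_formula I f t) = F 0 t + F 1 t * of_real (b 0 t) / E t"
proof -
  note nz = curvedD(2)[OF t] v_pos[OF curvedD(1)[OF t]]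
  define c where "c = a 0 t * b 0 t - b 1 t"
  have P: "P t = c / (b 0 t)\<^sup>2" by (simp add: P_def c_def)
  have E: "E t = - (of_real c + \<i> * of_real ((b 0 t)\<^sup>2))"
    by (simp add: E_ab c_def complex_eq_iff)
  have Enz: "of_real c + \<i> * of_real ((b 0 t)\<^sup>2) \<noteq> 0"
    using nz by (simp add: complex_eq_iff)
  have nn: "complex_of_real (1 + (P t)\<^sup>2) \<noteq> 0"
    using sum_power2_gt_zero_iff[of 1 "P t"] by (simp only: of_real_eq_0_iff) (smt (verit) zero_le_power2)
  have eq: "of_real (1 + (P t)\<^sup>2) * (of_real (b 0 t))^4 =
      (of_real c + \<i> * of_real ((b 0 t)\<^sup>2)) * (of_real c - \<i> * of_real ((b 0 t)\<^sup>2))"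
    using nz by (simp add: P complex_eq_iff field_simps power2_eq_square power4_eq_xxxx)
  have "to_complex (ses_formula I f t) = F 0 t +
     of_real (1 / (1 + (P t)\<^sup>2)) * (- of_real (v t / b 0 t * P t) + \<i> * of_real (v t / b 0 t)) * (F 1 t / of_real (v t))"
    unfolding ses_formula_def to_complex_add to_complex_scaleR to_complex_normal
      to_complex_tangent[OF curvedD(1)[OF t]] radius_deriv_1[OF t] radius_eq[OF curvedD(1)[OF t]]
    by (simp add: F_def scaleR_conv_of_real algebra_simps)
  also have "of_real (1 / (1 + (P t)\<^sup>2)) * (- of_real (v t / b 0 t * P t) + \<i> * of_real (v t / b 0 t)) * (F 1 t / of_real (v t))
      = F 1 t * of_real (b 0 t) * (- of_real c + \<i> * of_real ((b 0 t)\<^sup>2)) / (of_real (1 + (P t)\<^sup>2) * (of_real (b 0 t))^4)"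
  proof -
    define D where "D = complex_of_real (1 + (P t)\<^sup>2)"
    have "D \<noteq> 0" using nn by (simp add: D_def)
    have D: "complex_of_real (1 / (1 + (P t)\<^sup>2)) = 1 / D" by (simp add: D_def)
    show ?thesis
      unfolding D unfolding D_def[symmetric] unfolding P
      using nz \<open>D \<noteq> 0\<close> by (simp add: field_simps power2_eq_square power4_eq_xxxx)
  qed
  also have "\<dots> = F 1 t * of_real (b 0 t) / E t"
    using Enz nz nn eq unfolding eq E by (auto simp: divide_simps) (simp add: algebra_simps)
  finally show ?thesis by simp
qed

end

section \<open>Smoothness at cusps and flat points\<close>

lemma has_vector_derivative_shift_power:
  "((\<lambda>t. of_real (t - s) ^ n :: 'a::real_normed_field) has_vector_derivative
     of_nat n * of_real (t - s) ^ (n - 1)) (at t within S)"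
proof -
  have "((\<lambda>t. (t - s) ^ n) has_real_derivative (real n * (t - s) ^ (n - 1))) (at t within S)"
    by (auto intro!: derivative_eq_intros)
  then have "((\<lambda>t. of_real ((t - s) ^ n) :: 'a) has_vector_derivative of_real (real n * (t - s) ^ (n - 1))) (at t within S)"
    by (intro has_vector_derivative_of_real) (simp add: has_real_derivative_iff_has_vector_derivative)
  then show ?thesis by simp
qed

text \<open>
  The function \<open>Im (cnj h * h')\<close> is \<open>|h|\<^sup>2\<close> times the derivative of the argument of \<open>h\<close>.
\<close>

lemma argument_rate_factor:
  fixes h :: "real \<Rightarrow> complex"
  assumes I: "proper_interval I" and h: "smooth_on I h" and s: "s \<in> I" and hs: "h s \<noteq> 0"
    and k: "Im (cnj (h s) * nderiv I k h s) \<noteq> 0"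
  shows "\<exists>m \<beta>. smooth_on I \<beta> \<and> \<beta> s \<noteq> 0 \<and>
    (\<forall>t\<in>I. Im (cnj (h t) * nderiv I 1 h t) = (t - s) ^ m * \<beta> t)"
proof -
  have perf: "perfect_on I" using I by (rule proper_interval_perfect)
  \<comment> \<open>\<open>X\<close> and \<open>Y\<close> are the coordinates of h after a rotation
    and scaling that makes its value at s real and positive. Up to the constant |h s|^2 the rate is
    X Y' - X' Y, and of the two only \<open>Y\<close> vanishes at s.\<close>
  define X where "X t = Re (cnj (h s) * h t)" for t
  define Y where "Y t = Im (cnj (h s) * h t)" for t
  have blX: "bounded_linear (\<lambda>w. Re (cnj (h s) * w))" and blY: "bounded_linear (\<lambda>w. Im (cnj (h s) * w))"
    by (intro bounded_linear_compose[OF bounded_linear_Re] bounded_linear_compose[OF bounded_linear_Im]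
        bounded_linear_mult_right)+
  have smX: "smooth_on I X" and smY: "smooth_on I Y"
    unfolding X_def Y_def using smooth_on_linear[OF perf blX h] smooth_on_linear[OF perf blY h] by auto
  have dX: "nderiv I j X t = Re (cnj (h s) * nderiv I j h t)"
    and dY: "nderiv I j Y t = Im (cnj (h s) * nderiv I j h t)" if "t \<in> I" for t j
    unfolding X_def Y_def using nderiv_linear[OF perf blX h that] nderiv_linear[OF perf blY h that] by auto
  have "nderiv I k Y s \<noteq> 0" using k dY[OF s] by simp
  then obtain n \<eta> where \<eta>: "smooth_on I \<eta>" "\<eta> s \<noteq> 0" "\<forall>t\<in>I. Y t = of_real (t - s) ^ n * \<eta> t"
    using smooth_on_factor_power[OF I smY s] by blast
  \<comment> \<open>Since \<open>Y\<close> vanishes at s, its order n is positive; differentiation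
    lowers it by one, so the rate vanishes to order m = n - 1.\<close>
  have "Y s = 0" by (simp add: Y_def)
  with \<eta> s have "n \<noteq> 0" by (cases n) auto
  then obtain m where n: "n = Suc m" by (cases n) auto
  define \<eta>' where "\<eta>' = nderiv I 1 \<eta>"
  define \<beta> where "\<beta> t = (X t * (real n * \<eta> t + (t - s) * \<eta>' t) - nderiv I 1 X t * ((t - s) * \<eta> t)) / (cmod (h s))\<^sup>2" for t
  have sm: "smooth_on I (\<lambda>t. t - s)" using smooth_on_ident[OF perf, of s, where 'a = real] by simp
  have "smooth_on I \<beta>"
    unfolding \<beta>_def \<eta>'_def
    by (rule smooth_on_divide[OF perf], rule smooth_on_diff[OF perf])
      (use hs in \<open>auto intro!: smooth_on_mult smooth_on_add smooth_on_const perf smX \<eta> smooth_on_nderiv sm simp del: nderiv.simps\<close>)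
  moreover have "\<beta> s \<noteq> 0"
  proof -
    have "X s = (cmod (h s))\<^sup>2" unfolding X_def cmod_power2 by (simp add: power2_eq_square)
    then show ?thesis using \<eta>(2) n hs by (simp add: \<beta>_def del: of_nat_Suc)
  qed
  moreover have "Im (cnj (h t) * nderiv I 1 h t) = (t - s) ^ m * \<beta> t" if t: "t \<in> I" for t
  proof -
    have "((\<lambda>t. of_real (t - s) ^ n * \<eta> t) has_vector_derivative
        of_real (t - s) ^ n * \<eta>' t + of_nat n * of_real (t - s) ^ (n - 1) * \<eta> t) (at t within I)"
      unfolding \<eta>'_def
      by (intro has_vector_derivative_mult has_vector_derivative_shift_power
          smooth_on_has_vector_derivative_0 \<eta> t)
    then have "(Y has_vector_derivative
        of_real (t - s) ^ n * \<eta>' t + of_nat n * of_real (t - s) ^ (n - 1) * \<eta> t) (at t within I)"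
      by (rule has_vector_derivative_cong_near[OF _ open_UNIV]) (use \<eta>(3) t in auto)
    from vector_derivative_unique_perfect[OF perf t this]
    have Y1: "nderiv I 1 Y t = (t - s) ^ m * (real n * \<eta> t + (t - s) * \<eta>' t)"
      using n by (simp add: algebra_simps)
    have "X t * nderiv I 1 Y t - nderiv I 1 X t * Y t = (cmod (h s))\<^sup>2 * Im (cnj (h t) * nderiv I 1 h t)"
      unfolding dX[OF t] dY[OF t] unfolding X_def Y_def cmod_power2 
      by (simp add: algebra_simps power2_eq_square del: nderiv.simps)
    moreover have "X t * nderiv I 1 Y t - nderiv I 1 X t * Y t = (t - s) ^ m * (\<beta> t * (cmod (h s))\<^sup>2)"
    proof -
      have "\<beta> t * (cmod (h s))\<^sup>2 = X t * (real n * \<eta> t + (t - s) * \<eta>' t) - nderiv I 1 X t * ((t - s) * \<eta> t)"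
        using hs by (simp add: \<beta>_def)
      moreover have "Y t = (t - s) * (t - s) ^ m * \<eta> t" using \<eta>(3) t n by simp
      ultimately show ?thesis unfolding Y1 by (simp only:) (simp add: algebra_simps del: nderiv.simps)
    qed
    ultimately have "(cmod (h s))\<^sup>2 * Im (cnj (h t) * nderiv I 1 h t) = (cmod (h s))\<^sup>2 * ((t - s) ^ m * \<beta> t)"
      by (simp only: mult_ac)
    then show ?thesis using hs by (simp only: mult_cancel_left) simp
  qed
  ultimately show ?thesis by blast
qed

locale cusp_curve = plane_curve +
  assumes interval: "proper_interval I" and cusps: "at_most_cusps I f" and finite_order: "not_locally_line I f"
begin

text \<open>Regular points and cusps are treated alike by the order j of the zero of f' and the
  order m of the zero of the turning rate of the remaining factor h. At a regular point j = 0, and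
  finite contact with the tangent line supplies a derivative independent of f'. At a cusp j = 1, and
  independence of f'' and f''' gives m = 0.\<close>

lemma local_form:
  assumes s: "s \<in> I"
  shows "\<exists>h j m \<beta>. smooth_on I h \<and> h s \<noteq> 0 \<and> (\<forall>t\<in>I. F 1 t = of_real (t - s) ^ j * h t) \<and>
     smooth_on I \<beta> \<and> \<beta> s \<noteq> 0 \<and> (\<forall>t\<in>I. Im (cnj (h t) * nderiv I 1 h t) = (t - s) ^ m * \<beta> t) \<and>
     ((j = 0 \<and> s \<in> reg \<and> h = F 1 \<and> (m = 0 \<longleftrightarrow> s \<in> curved)) \<or>
      (j = 1 \<and> m = 0 \<and> F 1 s = 0 \<and> h s = F 2 s \<and> nderiv I 1 h s = F 3 s / 2))"
proof (cases "F 1 s = 0")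
  case False
  then have reg: "s \<in> reg" using s by (simp add: reg_def)
  obtain k where k: "k \<ge> 1" "det2 (nderiv I 1 f s) (nderiv I k f s) \<noteq> 0"
    using finite_order s False unfolding not_locally_line_def F_def to_complex_eq_0_iff by blast
  have "Im (cnj (F 1 s) * nderiv I (k - 1) (F 1) s) \<noteq> 0"
    using k nderiv_F[OF s, of "k - 1" 1] unfolding det2_to_complex by (simp add: F_def)
  then obtain m \<beta> where *: "smooth_on I \<beta>" "\<beta> s \<noteq> 0"
    "\<forall>t\<in>I. Im (cnj (F 1 t) * nderiv I 1 (F 1) t) = (t - s) ^ m * \<beta> t"
    using argument_rate_factor[OF interval smooth_F s False] by blast
  have "Im (cnj (F 1 s) * nderiv I 1 (F 1) s) = (v s)\<^sup>2 * b 0 s"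
    using cnj_mult_divide[OF False, of "F 2 s"] nderiv_F[OF s, of 1 1] reg
    by (simp add: v_def b_def Z_def del: nderiv.simps) (simp add: numeral_2_eq_2)
  then have "m = 0 \<longleftrightarrow> s \<in> curved"
    using *(2) *(3)[rule_format, OF s] v_pos[OF reg] reg
    by (cases m) (auto simp: curved_def simp del: nderiv.simps)
  then show ?thesis using * smooth_F reg False
    by (intro exI[of _ "F 1"] exI[of _ 0] exI[of _ m] exI[of _ \<beta>]) simp
next
  case True
  then have cusp: "Im (cnj (F 2 s) * F 3 s) \<noteq> 0"
    using cusps s unfolding at_most_cusps_def cusp_F singular_pt_F by blast
  obtain h where h: "smooth_on I h" "\<forall>t\<in>I. F 1 t = of_real (t - s) * h t"
    "\<forall>k. nderiv I k h s = nderiv I (Suc k) (F 1) s / of_nat (Suc k)"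
    using smooth_on_factor[OF interval smooth_F s True] by blast
  have h0: "h s = F 2 s" using h(3)[rule_format, of 0] nderiv_F[OF s, of 1 1]
    by (simp add: numeral_2_eq_2)
  have h1: "nderiv I 1 h s = F 3 s / 2" using h(3)[rule_format, of 1] nderiv_F[OF s, of 2 1]
    by (simp add: numeral_2_eq_2 numeral_3_eq_3)
  have hs: "h s \<noteq> 0" using cusp h0 by auto
  have i1: "Im (cnj (h s) * nderiv I 1 h s) \<noteq> 0" unfolding h0 h1 using cusp by simp
  then obtain m \<beta> where *: "smooth_on I \<beta>" "\<beta> s \<noteq> 0"
    "\<forall>t\<in>I. Im (cnj (h t) * nderiv I 1 h t) = (t - s) ^ m * \<beta> t"
    using argument_rate_factor[OF interval h(1) s hs] by blast
  have "m = 0" using i1 * s by (cases m) auto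
  then show ?thesis using * h h0 h1 hs True
    by (intro exI[of _ h] exI[of _ "1::nat"] exI[of _ "0::nat"] exI[of _ \<beta>]) auto
qed

lemma curved_iff: "t \<in> I \<Longrightarrow> t \<in> curved \<longleftrightarrow> \<not> singular_pt I f t \<and> \<not> flat_pt I f t"
  by (auto simp: flat_pt_iff singular_pt_F curved_def reg_def)

lemma ses_param_curved: "t \<in> curved \<Longrightarrow> to_complex (ses_param I f t) = F 0 t + F 1 t * of_real (b 0 t) / E t"
  using ses_formula_complex[of t] curved_iff[of t] curvedD(3)[of t] by (simp add: ses_param_def)

text \<open>At s the parameterization is defined by \<open>Lim\<close>, so a continuous G that
  agrees with it at the nearby points has the right value at s by uniqueness of limits.\<close>

lemma ses_param_limit:
  assumes s: "s \<in> I" "s \<notin> curved" and U: "open U" "s \<in> U" and G: "continuous_on (I \<inter> U) G"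
    and eq: "\<And>t. t \<in> I \<inter> U \<Longrightarrow> t \<noteq> s \<Longrightarrow> t \<in> curved \<and> to_complex (ses_param I f t) = G t"
    and t: "t \<in> I \<inter> U"
  shows "to_complex (ses_param I f t) = G t"
proof (cases "t = s")
  case False
  then show ?thesis using eq t by blast
next
  case True
  have sf: "ses_formula I f t = of_complex (G t)" if "t \<in> I \<inter> U" "t \<noteq> s" for t
  proof -
    have "to_complex (ses_formula I f t) = G t"
      using eq[OF that] ses_formula_complex ses_param_curved by metis
    then show ?thesis by (metis of_to_complex)
  qed
  have "(G \<longlongrightarrow> G s) (at s within (I \<inter> U))"
    using G s U by (auto simp: continuous_on_def)
  then have "((\<lambda>t. of_complex (G t)) \<longlongrightarrow> of_complex (G s)) (at s within I)"
    using bounded_linear.tendsto[OF bounded_linear_of_complex] at_within_Int_open[OF U] by metis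
  moreover have "\<forall>\<^sub>F t in at s within I. of_complex (G t) = ses_formula I f t"
    unfolding eventually_at_topological using U sf by (intro exI[of _ U]) auto
  ultimately have "(ses_formula I f \<longlongrightarrow> of_complex (G s)) (at s within I)"
    by (rule Lim_transform_eventually)
  moreover have "at s within I \<noteq> bot" using perfect s by (simp add: perfect_on_def)
  ultimately have "Lim (at s within I) (ses_formula I f) = of_complex (G s)"
    by (intro tendsto_Lim) auto
  then show ?thesis using True curved_iff[OF s(1)] s(2) unfolding ses_param_def
    by (simp only: to_of_complex if_False)
qed

text \<open>Off s one has z = j / (t - s) + h' / h and b = (t - s)^m B, so (t - s) E equals (t -
  s)^m K with K = (m - j) B + (t - s) (B' - B h' / h). If m differs from j, then K is nonzero near
  s, and of all powers only (t - s)^(j + 1) is left. The clauses on K and its derivative at s, the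
  latter multiplied by h(s) to clear the denominator, serve the computation at cusps.\<close>

lemma local_param:
  assumes s: "s \<in> I" and "smooth_on I h" "h s \<noteq> 0" and Fh: "\<forall>t\<in>I. F 1 t = of_real (t - s) ^ j * h t"
     and "smooth_on I \<beta>" "\<beta> s \<noteq> 0" and rate: "\<forall>t\<in>I. Im (cnj (h t) * nderiv I 1 h t) = (t - s) ^ m * \<beta> t"
     and c: "c = real m - real j" "c \<noteq> 0"
   shows "\<exists>U B K. open U \<and> s \<in> U \<and> smooth_on (I \<inter> U) B \<and> smooth_on (I \<inter> U) K \<and> B s \<noteq> 0 \<and>
      (\<forall>t\<in>I \<inter> U. K t \<noteq> 0) \<and>
      K s = of_real (c * B s) \<and>
      nderiv (I \<inter> U) 1 K s * h s = of_real ((1 + c) * nderiv (I \<inter> U) 1 B s) * h s - of_real (B s) * nderiv I 1 h s \<and>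
      (\<forall>t\<in>I \<inter> U. t \<noteq> s \<longrightarrow> t \<in> curved \<and>
        to_complex (ses_param I f t) = F 0 t + of_real (t - s) ^ Suc j * (h t * of_real (B t) / K t))"
proof -
  note h = \<open>smooth_on I h\<close> and \<beta> = \<open>smooth_on I \<beta>\<close>
  have cont: "continuous_on I h" "continuous_on I \<beta>"
    using smooth_on_continuous_on[OF h, of 0] smooth_on_continuous_on[OF \<beta>, of 0] by auto
  have "\<exists>V. open V \<and> s \<in> V \<and> (\<forall>t\<in>I \<inter> V. h t \<noteq> 0 \<and> \<beta> t \<noteq> 0)"
  proof -
    have "openin (top_of_set I) ((I \<inter> h -` (- {0})) \<inter> (I \<inter> \<beta> -` (- {0})))"
      using cont by (intro openin_Int continuous_openin_preimage_gen) auto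
    then obtain V where V: "open V" "(I \<inter> h -` (- {0})) \<inter> (I \<inter> \<beta> -` (- {0})) = I \<inter> V"
      by (auto simp: openin_open)
    have "s \<in> V" using V(2) s \<open>h s \<noteq> 0\<close> \<open>\<beta> s \<noteq> 0\<close> by blast
    moreover have "\<forall>t\<in>I \<inter> V. h t \<noteq> 0 \<and> \<beta> t \<noteq> 0"
      unfolding V(2)[symmetric] by auto
    ultimately show ?thesis using V(1) by blast
  qed
  then obtain V where V: "open V" "s \<in> V" and nz: "\<And>t. t \<in> I \<inter> V \<Longrightarrow> h t \<noteq> 0" "\<And>t. t \<in> I \<inter> V \<Longrightarrow> \<beta> t \<noteq> 0"
    by blast
  define J where "J = I \<inter> V"
  have perfJ: "perfect_on J" unfolding J_def by (rule perfect_on_Int_open[OF perfect V(1)])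
  have sJ: "s \<in> J" using s V by (simp add: J_def)
  have atJ: "at t within J = at t within I" if "t \<in> J" for t
    using that at_within_Int_open[OF V(1)] by (auto simp: J_def)
  have hJ: "smooth_on J h" and \<beta>J: "smooth_on J \<beta>"
    unfolding J_def by (intro smooth_on_Int_open h \<beta> V)+
  have h1J: "nderiv I 1 h t = nderiv J 1 h t" if "t \<in> J" for t
    unfolding J_def using nderiv_Int_open[OF V(1), of t I 1 h] that by (auto simp: J_def)
  define \<zeta> where "\<zeta> t = nderiv J 1 h t / h t" for t
  have sm\<zeta>: "smooth_on J \<zeta>" unfolding \<zeta>_def
    by (intro smooth_on_divide perfJ smooth_on_nderiv hJ) (use nz in \<open>auto simp: J_def\<close>)
  define B where "B t = \<beta> t / Re (cnj (h t) * h t)" for t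
  have hh: "Re (cnj (h t) * h t) = (cmod (h t))\<^sup>2" for t unfolding cmod_power2 by (simp add: power2_eq_square)
  have smB: "smooth_on J B" unfolding B_def
    by (intro smooth_on_divide smooth_on_Re smooth_on_mult smooth_on_cnj perfJ hJ \<beta>J)
      (use nz in \<open>auto simp only: hh J_def; simp\<close>)
  have Bnz: "B t \<noteq> 0" if "t \<in> J" for t
    using nz that unfolding B_def hh J_def by auto
  define K where "K t = of_real (c * B t) + of_real (t - s) * (of_real (nderiv J 1 B t) - of_real (B t) * \<zeta> t)" for t
  have smcB: "smooth_on J (\<lambda>t. of_real (c * B t) :: complex)"
    by (intro smooth_on_of_real smooth_on_mult smooth_on_const perfJ smB)
  define L where "L t = of_real (nderiv J 1 B t) - of_real (B t) * \<zeta> t" for t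
  have smL: "smooth_on J L" unfolding L_def
    by (intro smooth_on_diff smooth_on_mult smooth_on_of_real perfJ smooth_on_nderiv smB sm\<zeta>)
  have smK: "smooth_on J K"
    unfolding K_def L_def[symmetric] by (intro smooth_on_add smcB smooth_on_mult smooth_on_ident perfJ smL)
  have K1: "nderiv J 1 K s = of_real (c * nderiv J 1 B s) + L s"
  proof -
    have "(K has_vector_derivative of_real (c * nderiv J 1 B s) + (of_real (s - s) * nderiv J 1 L s + 1 * L s)) (at s within J)"
      unfolding K_def L_def[symmetric]
      by (intro has_vector_derivative_add has_vector_derivative_mult has_vector_derivative_of_real
          has_vector_derivative_mult_right smooth_on_has_vector_derivative_0 smL sJ DERIV_cmult
          smooth_on_has_vector_derivative_0[OF smB, folded has_real_derivative_iff_has_vector_derivative])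
        (auto intro!: derivative_eq_intros)
    then show ?thesis
      using vector_derivative_unique_perfect[OF perfJ sJ] by simp
  qed
  have Ks: "K s = of_real (c * B s)" by (simp add: K_def)
  have key: "t \<in> curved \<and> to_complex (ses_param I f t) = F 0 t + of_real (t - s) ^ Suc j * (h t * of_real (B t) / K t)"
    if t: "t \<in> J" "t \<noteq> s" for t
  proof -
    have tI: "t \<in> I" using t by (simp add: J_def)
    \<comment> \<open>Stated for the whole punctured neighbourhood, because the formula for b is
      differentiated at t below.\<close>
    have basic: "u \<in> reg \<and> Z 0 u = of_real (real j / (u - s)) + \<zeta> u \<and> b 0 u = (u - s) ^ m * B u" if u: "u \<in> J" "u \<noteq> s" for u
    proof -
      have uI: "u \<in> I" using u by (simp add: J_def)
      have hu: "h u \<noteq> 0" using nz u by (simp add: J_def)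
      have F1: "F 1 u = of_real (u - s) ^ j * h u" using Fh uI by blast
      have reg: "u \<in> reg" using F1 hu u uI by (simp add: reg_def)
      have "((\<lambda>t. of_real (t - s) ^ j * h t) has_vector_derivative
          of_real (u - s) ^ j * nderiv I 1 h u + of_nat j * of_real (u - s) ^ (j - 1) * h u) (at u within I)"
        by (intro has_vector_derivative_mult has_vector_derivative_shift_power
            smooth_on_has_vector_derivative_0 h uI)
      then have "(F 1 has_vector_derivative
          of_real (u - s) ^ j * nderiv I 1 h u + of_nat j * of_real (u - s) ^ (j - 1) * h u) (at u within I)"
        by (rule has_vector_derivative_cong_near[OF _ open_UNIV]) (use Fh uI in auto)
      then have F2: "F 2 u = of_real (u - s) ^ j * nderiv I 1 h u + of_nat j * of_real (u - s) ^ (j - 1) * h u"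
        using vector_derivative_unique_perfect[OF perfect uI] F_deriv[OF uI, of 1]
        by (metis Suc_1)
      have Z: "Z 0 u = of_real (real j / (u - s)) + \<zeta> u"
      proof (cases j)
        case 0
        then show ?thesis using F1 F2 hu h1J[OF u(1)] by (simp add: Z_def \<zeta>_def)
      next
        case (Suc i)
        have "of_real (u - s) \<noteq> (0::complex)" using u by simp
        then have "(of_real (u - s) ^ Suc i * nderiv J 1 h u + of_nat (Suc i) * of_real (u - s) ^ i * h u) / (of_real (u - s) ^ Suc i * h u)
            = of_nat (Suc i) / of_real (u - s) + nderiv J 1 h u / h u"
          using hu by (simp add: field_simps del: nderiv.simps of_nat_Suc of_real_diff)
        then show ?thesis using F1 F2 Suc h1J[OF u(1)]
          by (simp add: Z_def \<zeta>_def)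
      qed
      have "b 0 u = Im (nderiv J 1 h u / h u)"
        unfolding b_def Z \<zeta>_def by simp
      also have "\<dots> = Im (cnj (h u) * nderiv I 1 h u) / (cmod (h u))\<^sup>2"
        unfolding cnj_mult_divide[OF hu] h1J[OF u(1)] using hu by simp
      also have "\<dots> = (u - s) ^ m * B u"
        using rate uI unfolding B_def hh by simp
      finally show ?thesis using Z reg by blast
    qed
    note reg = basic[OF t, THEN conjunct1] and Z = basic[OF t, THEN conjunct2, THEN conjunct1]
      and b0 = basic[OF t, THEN conjunct2, THEN conjunct2]
    have \<tau>: "t - s \<noteq> 0" using t by simp
    have curved: "t \<in> curved" using reg b0 \<tau> Bnz t by (simp add: curved_def)
    have "((\<lambda>t. of_real (t - s) ^ m * B t) has_vector_derivative
        of_real (t - s) ^ m * nderiv J 1 B t + of_nat m * of_real (t - s) ^ (m - 1) * B t) (at t within J)"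
      by (intro has_vector_derivative_mult has_vector_derivative_shift_power
          smooth_on_has_vector_derivative_0 smB t)
    then have "(b 0 has_vector_derivative
        of_real (t - s) ^ m * nderiv J 1 B t + of_nat m * of_real (t - s) ^ (m - 1) * B t) (at t within J)"
      by (rule has_vector_derivative_cong_near[where U = "- {s}"]) (use t basic in auto)
    then have d: "(b 0 has_vector_derivative
        (t - s) ^ m * nderiv J 1 B t + real m * (t - s) ^ (m - 1) * B t) (at t within I)"
      using atJ[OF t(1)] by simp
    have b1: "b 1 t = (t - s) ^ m * nderiv J 1 B t + real m * (t - s) ^ (m - 1) * B t"
      using vector_derivative_unique_perfect[OF perfect tI d]
        vector_derivative_unique_perfect[OF perfect tI ab_derivs(3)[OF reg, unfolded has_real_derivative_iff_has_vector_derivative]]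
      by (simp only:)
    \<comment> \<open>Multiplying by t - s absorbs the exponent m - 1, which truncates to 0 when m =
      0.\<close>
    have \<tau>b1: "(t - s) * b 1 t = (t - s) ^ m * (real m * B t + (t - s) * nderiv J 1 B t)"
      unfolding b1 by (cases m) (simp_all add: algebra_simps del: nderiv.simps)
    have \<tau>E: "of_real (t - s) * E t = of_real (t - s) ^ m * K t"
    proof -
      have "of_real (t - s) * E t = of_real ((t - s) * b 1 t) - of_real (b 0 t) * (of_real (t - s) * Z 0 t)"
        by (simp add: E_def algebra_simps)
      also have "of_real (t - s) * Z 0 t = of_real (real j) + of_real (t - s) * \<zeta> t"
        unfolding Z using \<tau> by (simp add: field_simps)
      finally show ?thesis
        unfolding \<tau>b1 b0 by (simp add: K_def c algebra_simps del: nderiv.simps)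
    qed
    have Enz: "E t \<noteq> 0" using curved E_nonzero curvedD by blast
    define \<tau>' where "\<tau>' = complex_of_real (t - s)"
    have \<tau>': "\<tau>' \<noteq> 0" using \<tau> by (simp add: \<tau>'_def)
    have Knz: "K t \<noteq> 0" using \<tau>E Enz \<tau> by auto
    have E: "E t = \<tau>' ^ m * K t / \<tau>'"
      using \<tau>E \<tau>' unfolding \<tau>'_def[symmetric] by (simp add: field_simps)
    have "F 1 t * of_real (b 0 t) / E t = \<tau>' ^ j * h t * (\<tau>' ^ m * of_real (B t)) / (\<tau>' ^ m * K t / \<tau>')"
      using Fh tI b0 E by (simp add: \<tau>'_def)
    also have "\<dots> = \<tau>' ^ Suc j * (h t * of_real (B t) / K t)"
      using \<tau>' Knz by (simp add: field_simps)
    finally show ?thesis using ses_param_curved[OF curved] curved unfolding \<tau>'_def by simp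
  qed
  have "\<exists>W. open W \<and> s \<in> W \<and> (\<forall>t\<in>J \<inter> W. K t \<noteq> 0)"
  proof -
    have "continuous_on J K" using smooth_on_continuous_on[OF smK, of 0] by simp
    then have "openin (top_of_set J) (J \<inter> K -` (- {0}))"
      by (intro continuous_openin_preimage_gen) auto
    then obtain W where W: "open W" "J \<inter> K -` (- {0}) = J \<inter> W"
      by (auto simp: openin_open)
    moreover have "K s \<noteq> 0" unfolding Ks using c Bnz[OF sJ] by simp
    ultimately show ?thesis using sJ by blast
  qed
  then obtain W where W: "open W" "s \<in> W" "\<forall>t\<in>J \<inter> W. K t \<noteq> 0" by blast
  have JW: "I \<inter> (V \<inter> W) = J \<inter> W" by (auto simp: J_def)
  have K1': "nderiv J 1 K s * h s = of_real ((1 + c) * nderiv J 1 B s) * h s - of_real (B s) * nderiv I 1 h s"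
    unfolding K1 L_def \<zeta>_def h1J[OF sJ] using \<open>h s \<noteq> 0\<close> by (simp add: field_simps del: nderiv.simps)
  have res: "nderiv (J \<inter> W) 1 g s = nderiv J 1 g s" for g :: "real \<Rightarrow> 'z::real_normed_vector"
    using nderiv_Int_open[OF W(1), of s J 1 g] sJ W by blast
  show ?thesis
    apply (rule exI[of _ "V \<inter> W"], rule exI[of _ B], rule exI[of _ K])
    unfolding JW res
    using V W smooth_on_Int_open[OF smB W(1)] smooth_on_Int_open[OF smK W(1)] Bnz[OF sJ] Ks K1' key
    by auto
qed

text \<open>Here \<gamma> = f + (t - s)^(j + 1) q with q = h B / K. At a flat point j = 0 and q(s) =
  f'(s) / m, so \<gamma>' = (1 + 1 / m) f' is nonzero. At a cusp j = 1, m = 0 and q(s) = - f''(s),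
  so \<gamma>'' = f'' + 2 q = - f'', while \<gamma>''' = f''' + 6 q' differs from f''' by a real
  multiple of f''. The determinant of the cusp condition thus only changes its sign.\<close>

lemma ses_param_near_special:
  assumes s: "s \<in> I" "s \<notin> curved"
  shows "\<exists>U G. open U \<and> s \<in> U \<and> smooth_on (I \<inter> U) G \<and> (\<forall>t\<in>I \<inter> U. to_complex (ses_param I f t) = G t) \<and>
     (\<forall>t\<in>I \<inter> U. t \<noteq> s \<longrightarrow> t \<in> curved) \<and>
     (F 1 s \<noteq> 0 \<longrightarrow> nderiv (I \<inter> U) 1 G s \<noteq> 0) \<and>
     (F 1 s = 0 \<longrightarrow> G s = F 0 s \<and> nderiv (I \<inter> U) 1 G s = 0 \<and>
        Im (cnj (nderiv (I \<inter> U) 2 G s) * nderiv (I \<inter> U) 3 G s) \<noteq> 0)"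
proof -
  obtain h j m \<beta> where h: "smooth_on I h" "h s \<noteq> 0" "\<forall>t\<in>I. F 1 t = of_real (t - s) ^ j * h t"
    and \<beta>: "smooth_on I \<beta>" "\<beta> s \<noteq> 0" "\<forall>t\<in>I. Im (cnj (h t) * nderiv I 1 h t) = (t - s) ^ m * \<beta> t"
    and alt: "(j = 0 \<and> s \<in> reg \<and> h = F 1 \<and> (m = 0 \<longleftrightarrow> s \<in> curved)) \<or>
      (j = 1 \<and> m = 0 \<and> F 1 s = 0 \<and> h s = F 2 s \<and> nderiv I 1 h s = F 3 s / 2)"
    using local_form[OF s(1)] by blast
  define c where "c = real m - real j"
  \<comment> \<open>At a flat point c = m > 0 and at a cusp c = -1; the value 0 would mean j = m =
    0, that is, s in \<open>curved\<close>.\<close>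
  have "c \<noteq> 0" using alt s by (auto simp: c_def)
  obtain U B K where U: "open U" "s \<in> U" and smB: "smooth_on (I \<inter> U) B" and smK: "smooth_on (I \<inter> U) K"
    and Bs: "B s \<noteq> 0" and Knz: "\<forall>t\<in>I \<inter> U. K t \<noteq> 0" and Ks: "K s = of_real (c * B s)"
    and K1: "nderiv (I \<inter> U) 1 K s * h s = of_real ((1 + c) * nderiv (I \<inter> U) 1 B s) * h s - of_real (B s) * nderiv I 1 h s"
    and form: "\<forall>t\<in>I \<inter> U. t \<noteq> s \<longrightarrow> t \<in> curved \<and>
        to_complex (ses_param I f t) = F 0 t + of_real (t - s) ^ Suc j * (h t * of_real (B t) / K t)"
    using local_param[OF s(1) h \<beta> c_def \<open>c \<noteq> 0\<close>] by blast
  define J where "J = I \<inter> U"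
  have perfJ: "perfect_on J" unfolding J_def by (rule perfect_on_Int_open[OF perfect U(1)])
  have sJ: "s \<in> J" using s U by (simp add: J_def)
  have atJ: "at t within J = at t within I" if "t \<in> J" for t
    using that at_within_Int_open[OF U(1)] by (auto simp: J_def)
  have FJ: "(F k has_vector_derivative F (Suc k) t) (at t within J)" if "t \<in> J" for k t
    using F_deriv[of t k] that atJ by (auto simp: J_def)
  have smJ: "smooth_on J B" "smooth_on J K" "smooth_on J h" "smooth_on J (F k)" for k
    using smB smK smooth_on_Int_open[OF h(1) U(1)] smooth_on_Int_open[OF smooth_F U(1)] by (auto simp: J_def)
  define q where "q t = h t * of_real (B t) / K t" for t
  have smq: "smooth_on J q" unfolding q_def
    by (intro smooth_on_divide smooth_on_mult smooth_on_of_real perfJ smJ) (use Knz in \<open>auto simp: J_def\<close>)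
  define G where "G t = F 0 t + of_real (t - s) ^ Suc j * q t" for t
  have smG: "smooth_on J G" unfolding G_def
    by (intro smooth_on_add smooth_on_mult smooth_on_power smooth_on_ident perfJ smJ smq)
  have eq: "\<forall>t\<in>I \<inter> U. to_complex (ses_param I f t) = G t"
    using ses_param_limit[OF s U, of G] form smooth_on_continuous_on[OF smG, of 0]
    by (auto simp: J_def G_def q_def)
  have q1: "(q has_vector_derivative nderiv J 1 q t) (at t within J)" if "t \<in> J" for t
    by (rule smooth_on_has_vector_derivative_0[OF smq that])
  have Gs: "nderiv J 1 G s \<noteq> 0" if "F 1 s \<noteq> 0"
  proof -
    from that alt have j: "j = 0" and hF: "h s = F 1 s" and "m \<noteq> 0" using s by auto
    have "(G has_vector_derivative F (Suc 0) s + (of_real (s - s) ^ Suc j * nderiv J 1 q s + of_nat (Suc j) * of_real (s - s) ^ (Suc j - 1) * q s)) (at s within J)"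
      unfolding G_def
      by (intro has_vector_derivative_add has_vector_derivative_mult FJ q1 has_vector_derivative_shift_power sJ)
    then have "nderiv J 1 G s = F 1 s + q s"
      using vector_derivative_unique_perfect[OF perfJ sJ] j by simp
    also have "q s = F 1 s / of_nat m"
      unfolding q_def Ks hF using Bs \<open>m \<noteq> 0\<close> j by (simp add: c_def)
    also have "F 1 s + F 1 s / of_nat m = F 1 s * of_nat (Suc m) / of_nat m"
      using \<open>m \<noteq> 0\<close> by (simp add: field_simps)
    finally show ?thesis using that \<open>m \<noteq> 0\<close> by (simp del: of_nat_Suc nderiv.simps)
  qed
  have Gc: "G s = F 0 s \<and> nderiv J 1 G s = 0 \<and> Im (cnj (nderiv J 2 G s) * nderiv J 3 G s) \<noteq> 0" if F1: "F 1 s = 0"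
  proof -
    from that alt have j: "j = 1" and m: "m = 0" and hF: "h s = F 2 s" and h1: "nderiv I 1 h s = F 3 s / 2"
      by (auto simp: reg_def)
    have c: "c = - 1" by (simp add: c_def j m)
    define \<tau> where "\<tau> t = complex_of_real (t - s)" for t
    have d\<tau>: "(\<tau> has_vector_derivative 1) (at t within J)" for t
      unfolding \<tau>_def by (auto intro!: derivative_eq_intros)
    have \<tau>s: "\<tau> s = 0" by (simp add: \<tau>_def)
    have G: "G = (\<lambda>t. F 0 t + \<tau> t * (\<tau> t * q t))" by (simp add: G_def[abs_def] \<tau>_def j mult.assoc)
    define G1 where "G1 t = F 1 t + (2 * \<tau> t * q t + \<tau> t * (\<tau> t * nderiv J 1 q t))" for t
    define G2 where "G2 t = F 2 t + (2 * q t + 4 * \<tau> t * nderiv J 1 q t + \<tau> t * (\<tau> t * nderiv J 2 q t))" for t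
    have q2: "(nderiv J 1 q has_vector_derivative nderiv J 2 q t) (at t within J)"
      "(nderiv J 2 q has_vector_derivative nderiv J 3 q t) (at t within J)" if "t \<in> J" for t
      using smooth_on_has_vector_derivative[OF smq that, of 1] smooth_on_has_vector_derivative[OF smq that, of 2]
      by (simp_all add: numeral_2_eq_2 numeral_3_eq_3)
    have FJ': "(F 0 has_vector_derivative F 1 t) (at t within J)" "(F 1 has_vector_derivative F 2 t) (at t within J)"
      "(F 2 has_vector_derivative F 3 t) (at t within J)" if "t \<in> J" for t
      using FJ[OF that, of 0] FJ[OF that, of 1] FJ[OF that, of 2] by (simp_all add: numeral_2_eq_2 numeral_3_eq_3)
    have G1: "(G has_vector_derivative G1 t) (at t within J)" if "t \<in> J" for t
      unfolding G
      by (rule has_vector_derivative_eq_rhs, (rule derivative_intros d\<tau> q1[OF that] FJ'[OF that])+)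
        (simp add: G1_def algebra_simps)
    have G2: "(G1 has_vector_derivative G2 t) (at t within J)" if "t \<in> J" for t
      unfolding G1_def[abs_def] 
      by (rule has_vector_derivative_eq_rhs, (rule derivative_intros d\<tau> q1[OF that] q2[OF that] FJ'[OF that])+)
        (simp add: G2_def algebra_simps)
    have G3: "(G2 has_vector_derivative F 3 s + 6 * nderiv J 1 q s) (at s within J)"
      unfolding G2_def[abs_def] 
      by (rule has_vector_derivative_eq_rhs, (rule derivative_intros d\<tau> q1[OF sJ] q2[OF sJ] FJ'[OF sJ])+)
        (simp add: \<tau>s)
    have n1: "nderiv J 1 G t = G1 t" if "t \<in> J" for t
      using nderiv_step[OF perfJ G1 that, of 0] by simp
    have n2: "nderiv J 2 G t = G2 t" if "t \<in> J" for t
      using nderiv_step[OF perfJ G1 that, of 1] nderiv_step[OF perfJ G2 that, of 0]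
      by (simp add: numeral_2_eq_2)
    have n3: "nderiv J 3 G s = F 3 s + 6 * nderiv J 1 q s"
    proof -
      have "nderiv J 3 G s = nderiv J 2 G1 s"
        using nderiv_step[OF perfJ G1 sJ, of 2] by (simp only: numeral_2_eq_2 numeral_3_eq_3)
      also have "\<dots> = nderiv J 1 G2 s"
        using nderiv_step[OF perfJ G2 sJ, of 1] by (simp only: numeral_2_eq_2 One_nat_def)
      also have "\<dots> = F 3 s + 6 * nderiv J 1 q s"
        using vector_derivative_unique_perfect[OF perfJ sJ G3] by simp
      finally show ?thesis .
    qed
    have qs: "q s = - h s" unfolding q_def Ks c using Bs by simp
    \<comment> \<open>Obtained by differentiating q K = h B. As 1 + c = 0, the term q K' equals B h'
      and cancels the same term on the right, so q' is a real multiple of h.\<close>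
    have "nderiv J 1 q s = - (h s * of_real (nderiv J 1 B s / B s))"
    proof -
      have "((\<lambda>t. q t * K t) has_vector_derivative (q s * nderiv J 1 K s + nderiv J 1 q s * K s)) (at s within J)"
        by (intro has_vector_derivative_mult q1 sJ smooth_on_has_vector_derivative_0 smJ)
      moreover have "((\<lambda>t. q t * K t) has_vector_derivative (h s * of_real (nderiv J 1 B s) + nderiv J 1 h s * of_real (B s))) (at s within J)"
      proof (rule has_vector_derivative_cong_near[OF _ open_UNIV])
        show "((\<lambda>t. h t * of_real (B t)) has_vector_derivative (h s * of_real (nderiv J 1 B s) + nderiv J 1 h s * of_real (B s))) (at s within J)"
          by (intro has_vector_derivative_mult has_vector_derivative_of_real sJ smooth_on_has_vector_derivative_0 smJ
              smooth_on_has_vector_derivative_0[OF smJ(1), folded has_real_derivative_iff_has_vector_derivative])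
      qed (use sJ Knz in \<open>auto simp: q_def J_def\<close>)
      ultimately have "q s * nderiv J 1 K s + nderiv J 1 q s * K s = h s * of_real (nderiv J 1 B s) + nderiv J 1 h s * of_real (B s)"
        using vector_derivative_unique_perfect[OF perfJ sJ] by metis
      moreover have "nderiv J 1 h s = nderiv I 1 h s"
        unfolding J_def using nderiv_Int_open[OF U(1), of s I 1 h] sJ by (simp only: J_def)
      moreover have "q s * nderiv J 1 K s = of_real (B s) * nderiv I 1 h s"
        using K1 unfolding J_def[symmetric] c qs by (simp add: algebra_simps del: nderiv.simps)
      ultimately have "nderiv J 1 q s * of_real (B s) = - (h s * of_real (nderiv J 1 B s))"
        unfolding Ks c by (simp add: algebra_simps eq_neg_iff_add_eq_0 del: nderiv.simps)
      then have "nderiv J 1 q s = - (h s * of_real (nderiv J 1 B s)) / of_real (B s)"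
        using Bs by (metis nonzero_mult_div_cancel_right of_real_eq_0_iff)
      then show ?thesis by simp
    qed
    then have e3: "nderiv J 3 G s = F 3 s - of_real (6 * (nderiv J 1 B s / B s)) * h s"
      unfolding n3 by (simp add: algebra_simps del: nderiv.simps)
    have e2: "nderiv J 2 G s = - h s"
      unfolding n2[OF sJ] by (simp add: G2_def \<tau>s qs hF)
    have "Im (cnj (- h s) * (F 3 s - of_real (6 * (nderiv J 1 B s / B s)) * h s)) = - Im (cnj (h s) * F 3 s)"
      by (simp add: algebra_simps del: nderiv.simps)
    moreover have "Im (cnj (h s) * F 3 s) \<noteq> 0"
      using cusps s F1 unfolding at_most_cusps_def cusp_F singular_pt_F hF by blast
    ultimately have "Im (cnj (nderiv J 2 G s) * nderiv J 3 G s) \<noteq> 0"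
      unfolding e2 e3 by (metis neg_equal_0_iff_equal)
    moreover have "nderiv J 1 G s = 0" unfolding n1[OF sJ] by (simp add: G1_def \<tau>s F1[simplified])
    moreover have "G s = F 0 s" by (simp add: G \<tau>s)
    ultimately show ?thesis by blast
  qed
  show ?thesis
    using U smG eq form Gs Gc unfolding J_def by blast
qed

lemma smooth_ses_param: "smooth_on I (ses_param I f)"
proof (rule smooth_on_locally[OF perfect])
  fix s assume s: "s \<in> I"
  have of_c: "smooth_on (I \<inter> U) (ses_param I f)"
    if "open U" "smooth_on (I \<inter> U) G" "\<forall>t\<in>I \<inter> U. to_complex (ses_param I f t) = G t" for U G
  proof (rule smooth_on_cong)
    show "perfect_on (I \<inter> U)" using perfect_on_Int_open[OF perfect] that by blast
    then show "smooth_on (I \<inter> U) (\<lambda>t. of_complex (G t))"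
      using smooth_on_linear[OF _ bounded_linear_of_complex] that by blast
    show "ses_param I f t = of_complex (G t)" if "t \<in> I \<inter> U" for t
      using that \<open>\<forall>t\<in>I \<inter> U. _ t\<close> by (metis of_to_complex)
  qed
  show "\<exists>U. open U \<and> s \<in> U \<and> smooth_on (I \<inter> U) (ses_param I f)"
  proof (cases "s \<in> curved")
    case False
    then show ?thesis using ses_param_near_special[OF s] of_c by blast
  next
    case True
    obtain U where U: "open U" "curved = I \<inter> U" using curved_open by blast
    obtain V where V: "open V" "reg = I \<inter> V" using reg_open by blast
    have cr: "curved = reg \<inter> U" using U V by (auto simp: curved_def)
    have pc: "perfect_on curved" unfolding U(2) by (rule perfect_on_Int_open[OF perfect U(1)])
    have smZ: "smooth_on curved (Z k)" for k unfolding cr by (rule smooth_on_Int_open[OF smooth_Z U(1)])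
    have smF: "smooth_on curved (F k)" for k unfolding U(2) by (rule smooth_on_Int_open[OF smooth_F U(1)])
    have "smooth_on curved (\<lambda>t. F 0 t + F 1 t * of_real (b 0 t) / E t)"
      unfolding E_def b_def
      by (intro smooth_on_add smooth_on_divide smooth_on_mult smooth_on_diff smooth_on_of_real smooth_on_Im smZ smF pc)
        (use E_nonzero curvedD(2) in \<open>auto simp: E_def b_def\<close>)
    then show ?thesis using of_c[OF U(1)] ses_param_curved True U by auto
  qed
qed

end

section \<open>Singularities and flexes of the singular evolutoids set\<close>

text \<open>\<open>inflexion_pt\<close> only asks for a change of sign. Continuity turns it into a
  zero, since a nonzero value would fix the sign on both sides.\<close>

lemma changes_sign_imp_zero:
  assumes "continuous (at s within I) g" "changes_sign I g s"
  shows "g s = 0"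
proof (rule ccontr)
  assume "g s \<noteq> 0"
  obtain e where e: "e > 0" "{s - e<..<s + e} \<subseteq> I" "\<And>x y. x \<in> {s - e<..<s} \<Longrightarrow> y \<in> {s<..<s + e} \<Longrightarrow> g x * g y < 0"
    using assms(2) unfolding changes_sign_def by blast
  obtain d where d: "d > 0" "\<And>x. x \<in> I \<Longrightarrow> dist x s < d \<Longrightarrow> dist (g x) (g s) < \<bar>g s\<bar>"
    using assms(1) \<open>g s \<noteq> 0\<close> unfolding continuous_within_eps_delta by (meson zero_less_abs_iff)
  define r where "r = min d e / 2"
  have r: "0 < r" "r < d" "r < e" using d e by (auto simp: r_def min_def)
  have "g (s - r) * g (s + r) < 0" using r by (intro e(3)) auto
  moreover have "dist (g (s - r)) (g s) < \<bar>g s\<bar>"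
    by (rule d(2)) (use r e(2) in \<open>auto simp: dist_real_def\<close>)
  moreover have "dist (g (s + r)) (g s) < \<bar>g s\<bar>"
    by (rule d(2)) (use r e(2) in \<open>auto simp: dist_real_def\<close>)
  ultimately show False
    unfolding dist_real_def by (cases "g s > 0") (auto simp: mult_less_0_iff)
qed

context plane_curve
begin

section \<open>Determinant criteria for flexes\<close>

lemma det_F: 
  assumes "t \<in> reg"
  shows "Im (cnj (F 1 t) * F 2 t) = (v t)\<^sup>2 * b 0 t"
  using cnj_mult_divide[OF regD(2)[OF assms], of "F 2 t"] by (simp add: v_def b_def Z_def)

lemma curvature_zero_iff:
  assumes "t \<in> reg"
  shows "curvature I f t = 0 \<longleftrightarrow> Im (cnj (F 1 t) * F 2 t) = 0"
  using v_pos[OF assms] by (simp only: curvature_eq[OF assms] det_F[OF assms]) auto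

lemma curvature_continuous:
  assumes t: "t \<in> reg"
  shows "continuous (at t within I) (curvature I f)"
proof -
  obtain U where U: "open U" "reg = I \<inter> U" using reg_open by blast
  have "continuous (at t within I) (\<lambda>t. b 0 t / v t)"
    using v_pos[OF t] DERIV_continuous[OF ab_derivs(3)[OF t]] DERIV_continuous[OF v_deriv[OF t]]
    by (intro continuous_intros) auto
  then have "((\<lambda>t. b 0 t / v t) \<longlongrightarrow> curvature I f t) (at t within I)"
    by (simp add: continuous_within curvature_eq[OF t])
  moreover have "\<forall>\<^sub>F x in at t within I. b 0 x / v x = curvature I f x"
    unfolding eventually_at_topological using U t curvature_eq by (intro exI[of _ U]) auto
  ultimately show ?thesis unfolding continuous_within by (rule Lim_transform_eventually)
qed

lemma flex_iff:
  assumes t: "t \<in> I"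
  shows "inflexion_pt I f t \<or> undulation_pt I f t \<longleftrightarrow> F 1 t \<noteq> 0 \<and> Im (cnj (F 1 t) * F 2 t) = 0"
proof (cases "t \<in> reg")
  case True
  then show ?thesis
    using changes_sign_imp_zero[OF curvature_continuous[OF True]] curvature_zero_iff[OF True] regD[OF True]
    unfolding inflexion_pt_def undulation_pt_def singular_pt_F by blast
next
  case False
  then show ?thesis using t by (auto simp: reg_def inflexion_pt_def undulation_pt_def singular_pt_F)
qed

lemma nondegenerate_F: "nondegenerate I f t \<longleftrightarrow> Im (cnj (F 1 t) * F 3 t) \<noteq> 0"
  unfolding nondegenerate_def det2_to_complex F_def ..

text \<open>The term det(f'', f'') of the product rule vanishes. Hence a non-degenerate flex is a
  simple zero of det(f', f'').\<close>

lemma det_F_deriv: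
  assumes t: "t \<in> I"
  shows "((\<lambda>t. Im (cnj (F 1 t) * F 2 t)) has_real_derivative Im (cnj (F 1 t) * F 3 t)) (at t within I)"
proof -
  have F: "(F 1 has_vector_derivative F 2 t) (at t within I)" "(F 2 has_vector_derivative F 3 t) (at t within I)"
    using F_deriv[OF t, of 1] F_deriv[OF t, of 2] by (simp_all add: numeral_2_eq_2 numeral_3_eq_3)
  have "((\<lambda>t. cnj (F 1 t) * F 2 t) has_vector_derivative (cnj (F 1 t) * F 3 t + cnj (F 2 t) * F 2 t)) (at t within I)"
    by (intro has_vector_derivative_mult bounded_linear.has_vector_derivative[OF bounded_linear_cnj] F)
  from bounded_linear.has_vector_derivative[OF bounded_linear_Im this]
  show ?thesis by (simp add: has_real_derivative_iff_has_vector_derivative algebra_simps)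
qed

text \<open>Regular points at which b has at most a simple zero, equivalently E is nonzero. The
  closed formula for \<gamma> is meaningful here without a limit, and all points of a generic curve
  are of this kind.\<close>

definition simple :: "real set" where
  "simple = {t \<in> reg. b 0 t \<noteq> 0 \<or> b 1 t \<noteq> 0}"

definition E1 :: "real \<Rightarrow> complex" where
  "E1 t = of_real (b 2 t) - (of_real (b 0 t) * Z 1 t + of_real (b 1 t) * Z 0 t)"

lemma E_deriv:
  assumes "t \<in> reg"
  shows "(E has_vector_derivative E1 t) (at t within I)"
  using ab_derivs[OF assms] Z_deriv[OF assms, of 0]
  unfolding E_def[abs_def] E1_def One_nat_def[symmetric]
  by (intro has_vector_derivative_diff has_vector_derivative_mult has_vector_derivative_of_real)
    (auto simp: has_real_derivative_iff_has_vector_derivative)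

lemma simpleD: "t \<in> simple \<Longrightarrow> t \<in> reg" "t \<in> simple \<Longrightarrow> E t \<noteq> 0" "t \<in> simple \<Longrightarrow> t \<in> I"
  using E_nonzero by (auto simp: simple_def reg_def)

lemma curved_simple: "curved \<subseteq> simple"
  by (auto simp: simple_def curved_def)

lemma simple_open: "\<exists>U. open U \<and> simple = I \<inter> U"
proof -
  have "continuous_on reg E"
    using E_deriv has_vector_derivative_continuous regD(1)
    unfolding continuous_on_eq_continuous_within by (metis at_within_reg)
  then have "openin (top_of_set reg) (reg \<inter> E -` (- {0}))"
    by (intro continuous_openin_preimage_gen) auto
  moreover have "reg \<inter> E -` (- {0}) = simple"
    using E_nonzero by (auto simp: simple_def E_ab complex_eq_iff)
  moreover have "openin (top_of_set I) reg"
    using reg_open by (auto simp: openin_open)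
  ultimately show ?thesis using openin_trans by (metis openin_open)
qed

text \<open>The right-hand side is the numerator over E^2 of the derivative of f + f' b / E, divided
  by f'. It is real because Im E = - b^2 has the derivative Im E1 = - 2 b b'.\<close>

lemma N2_eq: "of_real (N2 t) = 2 * of_real (b 1 t) * E t - of_real (b 0 t) * E1 t"
  by (simp add: N2_def E_def E1_def Z_ab complex_eq_iff algebra_simps power2_eq_square)

text \<open>\<open>g\<close> is the vector factor of \<gamma>' and stays nonzero at singular points
  of \<gamma>; \<open>g1\<close> is its derivative, and \<open>wt\<close> is |g|^2 / |E|^2.\<close>

definition g :: "real \<Rightarrow> complex" where "g t = F 1 t / (E t)\<^sup>2"
definition g1 :: "real \<Rightarrow> complex" where "g1 t = F 1 t * (Z 0 t * E t - 2 * E1 t) / (E t)^3"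
definition wt :: "real \<Rightarrow> real" where "wt t = (v t)\<^sup>2 / ((b 1 t - a 0 t * b 0 t)\<^sup>2 + (b 0 t)^4)^3"

lemma norm_E: "(cmod (E t))\<^sup>2 = (b 1 t - a 0 t * b 0 t)\<^sup>2 + (b 0 t)^4"
  unfolding cmod_power2 E_ab by (simp add: power2_eq_square power4_eq_xxxx)

lemma wt_pos: "t \<in> simple \<Longrightarrow> wt t > 0"
  unfolding wt_def norm_E[symmetric] using v_pos[of t] simpleD[of t] by simp

lemma g_deriv:
  assumes t: "t \<in> simple"
  shows "(g has_vector_derivative g1 t) (at t within I)"
proof -
  note t' = simpleD[OF t]
  have F: "(F 1 has_vector_derivative Z 0 t * F 1 t) (at t within I)"
    using F_deriv[OF t'(3), of 1] F_2[OF t'(1)] by (simp add: numeral_2_eq_2)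
  have "((\<lambda>t. E t * E t) has_vector_derivative (E t * E1 t + E1 t * E t)) (at t within I)"
    by (intro has_vector_derivative_mult E_deriv t')
  from has_vector_derivative_divide'[OF F this]
  have "(g has_vector_derivative (Z 0 t * F 1 t * (E t * E t) - F 1 t * (E t * E1 t + E1 t * E t)) / (E t * E t)\<^sup>2) (at t within I)"
    using t' by (simp add: g_def[abs_def] power2_eq_square)
  moreover have "(Z 0 t * F 1 t * (E t * E t) - F 1 t * (E t * E1 t + E1 t * E t)) / (E t * E t)\<^sup>2 = g1 t"
    using t' by (simp add: g1_def field_simps power2_eq_square power3_eq_cube)
  ultimately show ?thesis by simp
qed

text \<open>The turning rate of g = f' / E^2 is Im (z - 2 E1 / E). Since Im (E1 / E) = - b N2 /
  |E|^2, it equals b (|E|^2 + 2 N2) / |E|^2, and the bracket is M.\<close>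

lemma det_g:
  assumes t: "t \<in> simple"
  shows "Im (cnj (g t) * g1 t) = wt t * (b 0 t * M t)"
proof -
  note t' = simpleD[OF t]
  have gnz: "g t \<noteq> 0" using t' regD by (simp add: g_def)
  have "g1 t / g t = Z 0 t - 2 * (E1 t / E t)"
    using t' regD(2)[OF t'(1)] by (simp add: g_def g1_def field_simps power2_eq_square power3_eq_cube)
  moreover have "Im (E1 t / E t) * (cmod (E t))\<^sup>2 = - (N2 t * b 0 t)"
  proof -
    have "Im (E1 t / E t) * (cmod (E t))\<^sup>2 = Im (cnj (E t) * E1 t)"
      unfolding cnj_mult_divide[OF t'(2)] by simp
    also have "\<dots> = - (N2 t * b 0 t)"
      unfolding E_ab E1_def Z_ab by (simp add: N2_def algebra_simps power2_eq_square)
    finally show ?thesis .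
  qed
  moreover have "Im (Z 0 t - 2 * (E1 t / E t)) = b 0 t - 2 * Im (E1 t / E t)"
  proof -
    have "Im (u - 2 * w) = Im u - 2 * Im w" for u w by simp
    then show ?thesis unfolding b_def .
  qed
  moreover have "x * e = c + 2 * n" if "x = c' - 2 * y" "y * e = - n" "c' * e = c" for x y e c c' n :: real
  proof -
    have "x * e = c' * e - 2 * (y * e)" unfolding that(1) by (simp add: left_diff_distrib)
    then show ?thesis unfolding that(2,3) by simp
  qed
  ultimately have "Im (g1 t / g t) * (cmod (E t))\<^sup>2 = b 0 t * (cmod (E t))\<^sup>2 + 2 * (N2 t * b 0 t)"
    by metis
  also have "\<dots> = b 0 t * M t"
    unfolding norm_E M_def by (simp add: algebra_simps power2_eq_square)
  finally have *: "Im (g1 t / g t) = b 0 t * M t / (cmod (E t))\<^sup>2"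
    using t' by (simp add: field_simps)
  have ng: "(cmod (g t))\<^sup>2 = (v t)\<^sup>2 / ((cmod (E t))\<^sup>2)\<^sup>2"
    by (simp add: g_def v_def norm_divide norm_power power_divide)
  have "wt t = (v t)\<^sup>2 / ((cmod (E t))\<^sup>2)^3" unfolding wt_def norm_E ..
  then show ?thesis
    unfolding cnj_mult_divide[OF gnz] * ng using t'
    by (simp add: field_simps power2_eq_square power3_eq_cube)
qed

end

section \<open>Derivatives of the extended parameterization\<close>

context cusp_curve
begin

sublocale ses: plane_curve I "ses_param I f"
  by unfold_locales (rule perfect smooth_ses_param)+

lemma ses_F_near:
  assumes "open U" "\<forall>t\<in>I \<inter> U. to_complex (ses_param I f t) = G t" "t \<in> I \<inter> U"
  shows "ses.F j t = nderiv (I \<inter> U) j G t"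
proof -
  have "ses.F j t = nderiv I j (\<lambda>t. to_complex (ses_param I f t)) t"
    unfolding ses.F_def using nderiv_linear[OF perfect bounded_linear_to_complex smooth_ses_param] assms by simp
  also have "\<dots> = nderiv (I \<inter> U) j (\<lambda>t. to_complex (ses_param I f t)) t"
    by (rule nderiv_Int_open[OF assms(1,3), symmetric])
  also have "\<dots> = nderiv (I \<inter> U) j G t"
    using assms by (intro nderiv_cong) auto
  finally show ?thesis .
qed

text \<open>At a simple flat point \<gamma> is defined by a limit, but the closed formula is
  continuous there because E is nonzero, so the two agree.\<close>

lemma ses_F_0:
  assumes t: "t \<in> simple"
  shows "ses.F 0 t = F 0 t + F 1 t * of_real (b 0 t) / E t"
proof (cases "t \<in> curved")
  case True
  then show ?thesis using ses_param_curved by (simp add: ses.F_def)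
next
  case False
  note t' = simpleD[OF t]
  obtain U where U: "open U" "t \<in> U" "\<forall>x\<in>I \<inter> U. x \<noteq> t \<longrightarrow> x \<in> curved"
    using ses_param_near_special[OF t'(3) False] by blast
  have "continuous (at t within I) (F j)" for j
    using has_vector_derivative_continuous[OF F_deriv[OF t'(3)]] .
  moreover have "continuous (at t within I) (b 0)" using DERIV_continuous[OF ab_derivs(3)[OF t'(1)]] .
  moreover have "continuous (at t within I) E" using has_vector_derivative_continuous[OF E_deriv[OF t'(1)]] .
  ultimately have "continuous (at t within I) (\<lambda>t. F 0 t + F 1 t * of_real (b 0 t) / E t)"
    using t' by (intro continuous_intros) auto
  then have "((\<lambda>t. F 0 t + F 1 t * of_real (b 0 t) / E t) \<longlongrightarrow> F 0 t + F 1 t * of_real (b 0 t) / E t) (at t within I)"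
    by (simp add: continuous_within)
  moreover have "\<forall>\<^sub>F x in at t within I. F 0 x + F 1 x * of_real (b 0 x) / E x = ses.F 0 x"
    unfolding eventually_at_topological using U ses_param_curved
    by (intro exI[of _ U]) (auto simp: ses.F_def)
  ultimately have "(ses.F 0 \<longlongrightarrow> F 0 t + F 1 t * of_real (b 0 t) / E t) (at t within I)"
    by (rule Lim_transform_eventually)
  moreover have "(ses.F 0 \<longlongrightarrow> ses.F 0 t) (at t within I)"
    using has_vector_derivative_continuous[OF ses.F_deriv[OF t'(3)]] by (simp add: continuous_within)
  moreover have "at t within I \<noteq> bot" using perfect t' by (simp add: perfect_on_def)
  ultimately show ?thesis using tendsto_unique by blast
qed

lemma ses_F_Suc:
  assumes t: "t \<in> simple" and "\<And>x. x \<in> simple \<Longrightarrow> ses.F j x = p x"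
    and "(p has_vector_derivative d) (at t within I)"
  shows "ses.F (Suc j) t = d"
proof -
  obtain U where U: "open U" "simple = I \<inter> U" using simple_open by blast
  have "(ses.F j has_vector_derivative d) (at t within I)"
    by (rule has_vector_derivative_cong_near[OF assms(3) U(1)]) (use assms(1,2) U in auto)
  then show ?thesis
    using vector_derivative_unique_perfect[OF perfect] ses.F_deriv simpleD(3)[OF t] by metis
qed

text \<open>Over the denominator E^2 the relation E + b z = b' turns the numerator into f' (2 b' E -
  b E1), and \<open>N2_eq\<close> identifies the bracket as a real number.\<close>

lemma ses_F_1:
  assumes t: "t \<in> simple"
  shows "ses.F 1 t = of_real (N2 t) * g t"
proof -
  note t' = simpleD[OF t]
  have F: "(F 0 has_vector_derivative F 1 t) (at t within I)" "(F 1 has_vector_derivative Z 0 t * F 1 t) (at t within I)"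
    using F_deriv[OF t'(3), of 0] F_deriv[OF t'(3), of 1] F_2[OF t'(1)] by (simp_all add: numeral_2_eq_2)
  have B: "(b 0 has_real_derivative b 1 t) (at t within I)" by (rule ab_derivs[OF t'(1)])
  have "((\<lambda>t. F 0 t + (F 1 t * of_real (b 0 t)) / E t) has_vector_derivative
    F 1 t + ((F 1 t * of_real (b 1 t) + Z 0 t * F 1 t * of_real (b 0 t)) * E t - F 1 t * of_real (b 0 t) * E1 t) / (E t)\<^sup>2) (at t within I)"
    by (intro has_vector_derivative_add has_vector_derivative_divide' has_vector_derivative_mult
        has_vector_derivative_of_real F E_deriv t' B)
  from ses_F_Suc[OF t ses_F_0 this]
  have "ses.F 1 t = F 1 t + ((F 1 t * of_real (b 1 t) + Z 0 t * F 1 t * of_real (b 0 t)) * E t - F 1 t * of_real (b 0 t) * E1 t) / (E t)\<^sup>2"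
    by simp
  also have "\<dots> = F 1 t * (E t * (E t + of_real (b 1 t) + Z 0 t * of_real (b 0 t)) - of_real (b 0 t) * E1 t) / (E t)\<^sup>2"
    using t' by (simp add: field_simps power2_eq_square)
  also have "E t + of_real (b 1 t) + Z 0 t * of_real (b 0 t) = 2 * of_real (b 1 t)"
    by (simp add: E_def)
  finally show ?thesis unfolding N2_eq g_def by (simp add: field_simps)
qed

lemma ses_F_2:
  assumes t: "t \<in> simple"
  shows "ses.F 2 t = of_real (N2 t) * g1 t + of_real (N3 t) * g t"
proof -
  have "((\<lambda>t. of_real (N2 t) * g t) has_vector_derivative (of_real (N2 t) * g1 t + of_real (N3 t) * g t)) (at t within I)"
    by (intro has_vector_derivative_mult has_vector_derivative_of_real g_deriv N2_deriv t simpleD[OF t])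
  from ses_F_Suc[OF t ses_F_1 this] show ?thesis by (simp add: numeral_2_eq_2)
qed

text \<open>As N2 and N3 are real, the part N3 g of \<gamma>'' is parallel to \<gamma>' = N2 g and
  drops out of the determinant.\<close>

lemma ses_det:
  assumes t: "t \<in> simple"
  shows "Im (cnj (ses.F 1 t) * ses.F 2 t) = (N2 t)\<^sup>2 * wt t * (b 0 t * M t)"
proof -
  have "Im (cnj (ses.F 1 t) * ses.F 2 t) = (N2 t)\<^sup>2 * Im (cnj (g t) * g1 t)"
    unfolding ses_F_1[OF t] ses_F_2[OF t] by (simp add: algebra_simps power2_eq_square)
  then show ?thesis unfolding det_g[OF t] by simp
qed

lemma ses_singular:
  assumes t: "t \<in> simple"
  shows "singular_pt I (ses_param I f) t \<longleftrightarrow> N2 t = 0"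
  unfolding ses.singular_pt_F ses_F_1[OF t] using simpleD[OF t] regD by (simp add: g_def)

text \<open>At a zero of N2 one has \<gamma>'' = N3 g, and \<gamma>''' = 2 N3 g1 up to a real
  multiple of g, so the determinant is 2 N3^2 det(g, g1). The last factor is nonzero: b = 0 would
  give N2 = 2 b'^2 and so b' = 0, and M = |E|^2 is positive.\<close>

lemma ses_cusp:
  assumes t: "t \<in> simple" and "N2 t = 0"
  shows "cusp I (ses_param I f) t \<longleftrightarrow> N3 t \<noteq> 0"
proof -
  note t' = simpleD[OF t]
  \<comment> \<open>Existence of the derivatives of N3 and g1 is enough: the former only adds a
    multiple of g, the latter is multiplied by N2 = 0.\<close>
  have "\<exists>N4. (N3 has_real_derivative N4) (at t within I)"
    unfolding N3_def[abs_def]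
    by (rule exI) (rule derivative_eq_intros a_deriv[OF t'(1)] b_deriv[OF t'(1)] refl)+
  then obtain N4 where N4: "(N3 has_real_derivative N4) (at t within I)" by blast
  have "\<exists>g2. (g1 has_vector_derivative g2) (at t within I)"
  proof -
    have "(E1 has_vector_derivative of_real (b 3 t) - ((of_real (b 0 t) * Z 2 t + of_real (b 1 t) * Z 1 t) + (of_real (b 1 t) * Z 1 t + of_real (b 2 t) * Z 0 t))) (at t within I)"
      using Z_deriv[OF t'(1), of 0] Z_deriv[OF t'(1), of 1]
      unfolding E1_def[abs_def]
      by (intro has_vector_derivative_diff has_vector_derivative_add has_vector_derivative_mult has_vector_derivative_of_real ab_derivs t')
        (auto simp: numeral_2_eq_2)
    then show ?thesis
      unfolding g1_def[abs_def] power3_eq_cube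
      using has_vector_derivative_divide'[OF
          has_vector_derivative_mult[OF F_deriv[OF t'(3)] has_vector_derivative_diff[OF has_vector_derivative_mult[OF Z_deriv[OF t'(1)] E_deriv[OF t'(1)]] has_vector_derivative_mult[OF has_vector_derivative_const]]]
          has_vector_derivative_mult[OF has_vector_derivative_mult[OF E_deriv[OF t'(1)] E_deriv[OF t'(1)]] E_deriv[OF t'(1)]]]
        t'(2) by fastforce
  qed
  then obtain g2 where g2: "(g1 has_vector_derivative g2) (at t within I)" by blast
  have "((\<lambda>t. of_real (N2 t) * g1 t + of_real (N3 t) * g t) has_vector_derivative
      ((of_real (N2 t) * g2 + of_real (N3 t) * g1 t) + (of_real (N3 t) * g1 t + of_real N4 * g t))) (at t within I)"
    by (intro has_vector_derivative_add has_vector_derivative_mult has_vector_derivative_of_real g_deriv g2 N4 N2_deriv t t')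
  from ses_F_Suc[OF t ses_F_2 this] assms(2)
  have F3: "ses.F 3 t = 2 * of_real (N3 t) * g1 t + of_real N4 * g t"
    by (simp add: numeral_3_eq_3 numeral_2_eq_2)
  have "Im (cnj (ses.F 2 t) * ses.F 3 t) = 2 * (N3 t)\<^sup>2 * Im (cnj (g t) * g1 t)"
    unfolding ses_F_2[OF t] F3 assms(2) by (simp add: algebra_simps power2_eq_square)
  then have *: "Im (cnj (ses.F 2 t) * ses.F 3 t) = 2 * (N3 t)\<^sup>2 * (wt t * (b 0 t * M t))"
    unfolding det_g[OF t] .
  have b0: "b 0 t \<noteq> 0"
  proof
    assume "b 0 t = 0"
    then have "b 1 t = 0" using assms(2) by (simp add: N2_def)
    with \<open>b 0 t = 0\<close> t show False by (simp add: simple_def)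
  qed
  then have "M t > 0"
    unfolding M_def assms(2) by (simp add: add_pos_nonneg)
  then show ?thesis
    using ses_singular[OF t] assms(2) wt_pos[OF t] b0 unfolding ses.cusp_F ses.singular_pt_F * by simp
qed

text \<open>By \<open>det_F_deriv\<close> the left side is the derivative of det(\<gamma>',
  \<gamma>'') = N2^2 wt (b M). At a zero of b M only the term that differentiates b M
  survives.\<close>

lemma ses_nondegenerate:
  assumes t: "t \<in> simple" and "b 0 t * M t = 0"
  shows "Im (cnj (ses.F 1 t) * ses.F 3 t) = (N2 t)\<^sup>2 * wt t * (b 1 t * M t + b 0 t * M1 t)"
proof -
  note t' = simpleD[OF t]
  obtain U where U: "open U" "simple = I \<inter> U" using simple_open by blast
  have e: "((b 1 t - a 0 t * b 0 t)\<^sup>2 + (b 0 t)^4)^3 \<noteq> 0"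
    unfolding norm_E[symmetric] using t' by simp
  have "\<exists>d. ((\<lambda>t. (N2 t)\<^sup>2 * wt t) has_real_derivative d) (at t within I)"
    unfolding wt_def[abs_def]
    by (rule exI) (rule derivative_eq_intros a_deriv[OF t'(1)] b_deriv[OF t'(1)] N2_deriv[OF t'(1)] v_deriv[OF t'(1)] e refl)+
  then obtain d where d: "((\<lambda>t. (N2 t)\<^sup>2 * wt t) has_real_derivative d) (at t within I)" by blast
  have "((\<lambda>t. b 0 t * M t) has_real_derivative (b 1 t * M t + b 0 t * M1 t)) (at t within I)"
    by (rule DERIV_cong[OF DERIV_mult[OF ab_derivs(3) M_deriv]]) (use t' in auto)
  from DERIV_mult[OF d this]
  have "((\<lambda>t. (N2 t)\<^sup>2 * wt t * (b 0 t * M t)) has_vector_derivative (N2 t)\<^sup>2 * wt t * (b 1 t * M t + b 0 t * M1 t)) (at t within I)"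
    unfolding assms(2) by (simp add: has_real_derivative_iff_has_vector_derivative algebra_simps)
  then have "((\<lambda>t. Im (cnj (ses.F 1 t) * ses.F 2 t)) has_vector_derivative (N2 t)\<^sup>2 * wt t * (b 1 t * M t + b 0 t * M1 t)) (at t within I)"
    by (rule has_vector_derivative_cong_near[OF _ U(1)]) (use t U ses_det in auto)
  then show ?thesis
    using vector_derivative_unique_perfect[OF perfect t'(3)]
      ses.det_F_deriv[OF t'(3), unfolded has_real_derivative_iff_has_vector_derivative] by metis
qed

lemma not_cusp_reg: "t \<in> I \<Longrightarrow> \<not> cusp I f t \<Longrightarrow> t \<in> reg"
  using cusps unfolding at_most_cusps_def reg_def singular_pt_F by blast

lemma ses_at_cusp:
  assumes s: "s \<in> I" "cusp I f s"
  shows "ses_param I f s = f s \<and> cusp I (ses_param I f) s"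
proof -
  have F1: "F 1 s = 0" using s by (simp add: cusp_F)
  then have "s \<notin> curved" by (auto simp: curved_def reg_def)
  from ses_param_near_special[OF s(1) this] obtain U G where U: "open U" "s \<in> U"
    "\<forall>t\<in>I \<inter> U. to_complex (ses_param I f t) = G t"
    "G s = F 0 s" "nderiv (I \<inter> U) 1 G s = 0" "Im (cnj (nderiv (I \<inter> U) 2 G s) * nderiv (I \<inter> U) 3 G s) \<noteq> 0"
    using F1 by blast
  have near: "ses.F j s = nderiv (I \<inter> U) j G s" for j using ses_F_near[OF U(1,3)] s U by blast
  have "to_complex (ses_param I f s) = to_complex (f s)"
    using U s by (simp add: F_def)
  then show ?thesis unfolding ses.cusp_F near using U by (simp only: to_complex_eq_iff) simp
qed

lemma ses_at_flat:
  assumes s: "s \<in> I" "flat_pt I f s"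
  shows "\<not> singular_pt I (ses_param I f) s"
proof -
  have F1: "F 1 s \<noteq> 0" "s \<notin> curved" using s by (auto simp: flat_pt_iff curved_def reg_def)
  from ses_param_near_special[OF s(1) F1(2)] obtain U G where U: "open U" "s \<in> U"
    "\<forall>t\<in>I \<inter> U. to_complex (ses_param I f t) = G t" "nderiv (I \<inter> U) 1 G s \<noteq> 0"
    using F1 by blast
  have "ses.F 1 s = nderiv (I \<inter> U) 1 G s" using ses_F_near[OF U(1,3)] s U by blast
  then show ?thesis unfolding ses.singular_pt_F using U by (simp only:) simp
qed

text \<open>Away from flat points rho'' = N2 / (b^3 |f'|), and at its zeros rho''' = N3 / (b^3
  |f'|^2). Flat points are excluded explicitly, since the radius has only a formal value there while
  \<gamma> is regular.\<close>

lemma ses_singular_iff: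
  assumes s: "s \<in> I" "\<not> cusp I f s"
  shows "singular_pt I (ses_param I f) s \<longleftrightarrow> \<not> flat_pt I f s \<and> radius_deriv I f 2 s = 0"
    and "singular_pt I (ses_param I f) s \<Longrightarrow> cusp I (ses_param I f) s \<longleftrightarrow> radius_deriv I f 3 s \<noteq> 0"
proof -
  have reg: "s \<in> reg" by (rule not_cusp_reg[OF s])
  have curved: "s \<in> curved" if "\<not> flat_pt I f s"
    using that reg by (simp add: flat_pt_iff[OF s(1)] curved_def)
  show *: "singular_pt I (ses_param I f) s \<longleftrightarrow> \<not> flat_pt I f s \<and> radius_deriv I f 2 s = 0"
  proof (cases "flat_pt I f s")
    case True
    then show ?thesis using ses_at_flat[OF s(1)] by simp
  next
    case False
    note c = curved[OF this]
    show ?thesis using False radius_deriv_2[OF c] ses_singular[of s] c curved_simple curvedD(2)[OF c] v_pos[OF reg] by auto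
  qed
  assume "singular_pt I (ses_param I f) s"
  then have c: "s \<in> curved" using * curved by blast
  then have simple: "s \<in> simple" using curved_simple by blast
  have N2: "N2 s = 0" using ses_singular[OF simple] \<open>singular_pt _ _ _\<close> by blast
  show "cusp I (ses_param I f) s \<longleftrightarrow> radius_deriv I f 3 s \<noteq> 0"
    unfolding ses_cusp[OF simple N2] radius_deriv_3[OF c] N2 using curvedD(2)[OF c] v_pos[OF reg] by simp
qed

text \<open>The flex expression is M / b^4. The non-degeneracy expression is - rho / 2 times its arc
  length derivative, simplified at a zero by 2 rho rho'' = - (1 + rho'^2). At a cusp of f there is
  no flex because \<gamma> is singular there.\<close>

lemma ses_flex_iff:
  assumes s: "s \<in> I" "\<not> flat_pt I f s"
  shows "inflexion_pt I (ses_param I f) s \<or> undulation_pt I (ses_param I f) s \<longleftrightarrow>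
            \<not> cusp I f s \<and> 1 + (radius_deriv I f 1 s)\<^sup>2 + 2 * radius I f s * radius_deriv I f 2 s = 0"
    and "inflexion_pt I (ses_param I f) s \<Longrightarrow>
            nondegenerate I (ses_param I f) s \<longleftrightarrow>
            radius_deriv I f 1 s + (radius_deriv I f 1 s)^3 - (radius I f s)\<^sup>2 * radius_deriv I f 3 s \<noteq> 0"
proof -
  have curved: "s \<in> curved" if "\<not> cusp I f s"
    using not_cusp_reg[OF s(1) that] s by (simp add: flat_pt_iff curved_def)
  have cusp: "\<not> inflexion_pt I (ses_param I f) s" "\<not> undulation_pt I (ses_param I f) s" if "cusp I f s"
    using ses_at_cusp[OF s(1) that] by (auto simp: inflexion_pt_def undulation_pt_def cusp_def)
  have *: "1 + (radius_deriv I f 1 s)\<^sup>2 + 2 * radius I f s * radius_deriv I f 2 s = M s / (b 0 s)^4"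
    if c: "s \<in> curved"
    using curvedD(2)[OF c] v_pos[OF curvedD(1)[OF c]]
    unfolding radius_deriv_1[OF c] radius_deriv_2[OF c] radius_eq[OF curvedD(1)[OF c]] P_def M_def
    by (simp add: field_simps power2_eq_square power3_eq_cube power4_eq_xxxx)
  have N2nz: "N2 s \<noteq> 0" if c: "s \<in> curved" "M s = 0"
  proof
    assume "N2 s = 0"
    then have "M s > 0" unfolding M_def using curvedD(2)[OF c(1)] by (simp add: add_pos_nonneg)
    with c show False by simp
  qed
  have key: "inflexion_pt I (ses_param I f) s \<or> undulation_pt I (ses_param I f) s \<longleftrightarrow> M s = 0" if c: "s \<in> curved"
  proof -
    have simple: "s \<in> simple" using c curved_simple by blast
    show ?thesis
      unfolding ses.flex_iff[OF s(1)] ses_det[OF simple] ses.singular_pt_F[symmetric] ses_singular[OF simple]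
      using N2nz[OF c] wt_pos[OF simple] curvedD(2)[OF c] by auto
  qed
  show "inflexion_pt I (ses_param I f) s \<or> undulation_pt I (ses_param I f) s \<longleftrightarrow>
            \<not> cusp I f s \<and> 1 + (radius_deriv I f 1 s)\<^sup>2 + 2 * radius I f s * radius_deriv I f 2 s = 0"
  proof (cases "cusp I f s")
    case False
    note c = curved[OF this]
    show ?thesis unfolding key[OF c] *[OF c] using False curvedD(2)[OF c] by simp
  qed (use cusp in blast)
  assume infl: "inflexion_pt I (ses_param I f) s"
  then have c: "s \<in> curved" using curved cusp by blast
  then have simple: "s \<in> simple" using curved_simple by blast
  have M: "M s = 0" using key[OF c] infl by blast
  have b0: "b 0 s \<noteq> 0" by (rule curvedD(2)[OF c])
  have v: "v s > 0" by (rule v_pos[OF curvedD(1)[OF c]])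
  have nd: "nondegenerate I (ses_param I f) s \<longleftrightarrow> M1 s \<noteq> 0"
    unfolding ses.nondegenerate_F using ses_nondegenerate[OF simple] M N2nz[OF c M] wt_pos[OF simple] b0 by simp
  \<comment> \<open>\<open>c'\<close> is b^2 rho'. With M = 0 solved for N2, the comparison is
    between polynomials in b, b', \<open>c'\<close> and N3; the expression becomes - M1 / (2
    b^5).\<close>
  define c' where "c' = a 0 s * b 0 s - b 1 s"
  have N2': "N2 s = - ((b 0 s)^4 + c'\<^sup>2) / 2" using M by (simp add: M_def c'_def)
  have dc: "b 0 s * (a 1 s * b 0 s + a 0 s * b 1 s - b 2 s) = N2 s + 2 * b 1 s * c'"
    by (simp add: N2_def c'_def algebra_simps power2_eq_square)
  have "b 0 s * M1 s = 4 * (b 0 s)^4 * b 1 s + 2 * c' * (b 0 s * (a 1 s * b 0 s + a 0 s * b 1 s - b 2 s)) + 2 * b 0 s * N3 s"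
    by (simp add: M1_def c'_def algebra_simps power3_eq_cube power4_eq_xxxx)
  also have "\<dots> = 4 * (b 0 s)^4 * b 1 s + c' * (2 * N2 s) + 4 * b 1 s * c'\<^sup>2 + 2 * b 0 s * N3 s"
    unfolding dc by (simp add: algebra_simps power2_eq_square)
  finally have bM1: "b 0 s * M1 s = 4 * (b 0 s)^4 * b 1 s + c' * (2 * N2 s) + 4 * b 1 s * c'\<^sup>2 + 2 * b 0 s * N3 s" .
  have a0: "a 0 s * b 0 s = c' + b 1 s" by (simp add: c'_def)
  have "radius_deriv I f 1 s + (radius_deriv I f 1 s)^3 - (radius I f s)\<^sup>2 * radius_deriv I f 3 s
      = (c' * (b 0 s)^4 + c'^3 - (N3 s * b 0 s - N2 s * (3 * b 1 s + a 0 s * b 0 s))) / (b 0 s)^6"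
    unfolding radius_deriv_1[OF c] radius_deriv_3[OF c] radius_eq[OF curvedD(1)[OF c]] P_def c'_def[symmetric]
    using b0 v by (simp add: field_simps)
  also have "c' * (b 0 s)^4 + c'^3 - (N3 s * b 0 s - N2 s * (3 * b 1 s + a 0 s * b 0 s)) = - (b 0 s * M1 s) / 2"
    unfolding bM1 a0 N2' by (simp add: field_simps power2_eq_square power3_eq_cube)
  finally show "nondegenerate I (ses_param I f) s \<longleftrightarrow>
            radius_deriv I f 1 s + (radius_deriv I f 1 s)^3 - (radius I f s)\<^sup>2 * radius_deriv I f 3 s \<noteq> 0"
    unfolding nd using b0 by simp
qed

section \<open>Evolutoids and the image of the parameterization\<close>

lemma to_complex_evolutoid:
  assumes t: "t \<in> curved"
  shows "to_complex (evolutoid I f \<alpha> t) = F 0 t + of_real (sin \<alpha>) * cis \<alpha> * (F 1 t / of_real (b 0 t))"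
proof -
  have "complex_of_real (v t) \<noteq> 0" using v_pos[OF curvedD(1)[OF t]] by simp
  then have "complex_of_real (v t / b 0 t) * (F 1 t / complex_of_real (v t)) = F 1 t / of_real (b 0 t)"
    by simp
  moreover have "to_complex (evolutoid I f \<alpha> t) = F 0 t + of_real (sin \<alpha>) * (of_real (cos \<alpha>) + \<i> * of_real (sin \<alpha>)) *
      (complex_of_real (v t / b 0 t) * (F 1 t / complex_of_real (v t)))"
    unfolding evolutoid_def to_complex_add to_complex_scaleR to_complex_normal
      to_complex_tangent[OF curvedD(1)[OF t]] radius_eq[OF curvedD(1)[OF t]]
    by (simp add: F_def scaleR_conv_of_real algebra_simps power2_eq_square)
  moreover have "of_real (cos \<alpha>) + \<i> * of_real (sin \<alpha>) = cis \<alpha>" by (simp add: complex_eq_iff)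
  ultimately show ?thesis by simp
qed

text \<open>With w = sin \<alpha> e^(i \<alpha>) the evolutoid is f + w f' / b, and its derivative
  is f' (b^2 - w E) / b^2. Since E = - b^2 (rho' + i), the condition amounts to cot \<alpha> = -
  rho'.\<close>

lemma evolutoid_singular_iff:
  assumes t: "t \<in> curved"
  shows "(evolutoid I f \<alpha> has_vector_derivative 0) (at t within I) \<longleftrightarrow>
      of_real (sin \<alpha>) * cis \<alpha> * E t = of_real ((b 0 t)\<^sup>2)"
proof -
  note t' = curvedD[OF t]
  obtain U where U: "open U" "curved = I \<inter> U" using curved_open by blast
  define w where "w = of_real (sin \<alpha>) * cis \<alpha>"
  have F: "(F 0 has_vector_derivative F 1 t) (at t within I)" "(F 1 has_vector_derivative Z 0 t * F 1 t) (at t within I)"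
    using F_deriv[OF t'(3), of 0] F_deriv[OF t'(3), of 1] F_2[OF t'(1)] by (simp_all add: numeral_2_eq_2)
  have "((\<lambda>t. F 0 t + w * (F 1 t / of_real (b 0 t))) has_vector_derivative
      F 1 t + w * ((Z 0 t * F 1 t * of_real (b 0 t) - F 1 t * of_real (b 1 t)) / (of_real (b 0 t))\<^sup>2)) (at t within I)"
    using t' by (intro has_vector_derivative_add has_vector_derivative_mult_right has_vector_derivative_divide'
        has_vector_derivative_of_real F ab_derivs) auto
  moreover have "F 1 t + w * ((Z 0 t * F 1 t * of_real (b 0 t) - F 1 t * of_real (b 1 t)) / (of_real (b 0 t))\<^sup>2)
      = F 1 t * (of_real ((b 0 t)\<^sup>2) - w * E t) / (of_real (b 0 t))\<^sup>2"
  proof -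
    have "x + w * ((z * x * y - x * y') / y\<^sup>2) = x * (y\<^sup>2 - w * (y' - y * z)) / y\<^sup>2"
      if "y \<noteq> 0" for x y y' z :: complex
      using that by (simp add: field_simps power2_eq_square)
    from this[of "of_real (b 0 t)" "F 1 t" "Z 0 t" "of_real (b 1 t)"] t'(2) show ?thesis
      unfolding E_def of_real_power by (simp only: of_real_eq_0_iff not_False_eq_True simp_thms)
  qed
  ultimately have d0: "((\<lambda>t. F 0 t + w * (F 1 t / of_real (b 0 t))) has_vector_derivative
     F 1 t * (of_real ((b 0 t)\<^sup>2) - w * E t) / (of_real (b 0 t))\<^sup>2) (at t within I)"
    by (simp only:)
  have d: "((\<lambda>t. to_complex (evolutoid I f \<alpha> t)) has_vector_derivative
     F 1 t * (of_real ((b 0 t)\<^sup>2) - w * E t) / (of_real (b 0 t))\<^sup>2) (at t within I)"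
  proof (rule has_vector_derivative_cong_near[OF d0 U(1)])
    show "t \<in> U" "t \<in> I" using t U by auto
    show "to_complex (evolutoid I f \<alpha> x) = F 0 x + w * (F 1 x / of_real (b 0 x))" if "x \<in> I \<inter> U" for x
      using to_complex_evolutoid[of x \<alpha>] that unfolding w_def U(2) by blast
  qed
  have "(evolutoid I f \<alpha> has_vector_derivative 0) (at t within I) \<longleftrightarrow>
     F 1 t * (of_real ((b 0 t)\<^sup>2) - w * E t) / (of_real (b 0 t))\<^sup>2 = 0"
  proof
    assume "(evolutoid I f \<alpha> has_vector_derivative 0) (at t within I)"
    from bounded_linear.has_vector_derivative[OF bounded_linear_to_complex this]
    have "((\<lambda>t. to_complex (evolutoid I f \<alpha> t)) has_vector_derivative 0) (at t within I)"
      by (simp add: to_complex_zero)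
    then show "F 1 t * (of_real ((b 0 t)\<^sup>2) - w * E t) / (of_real (b 0 t))\<^sup>2 = 0"
      using vector_derivative_unique_perfect[OF perfect t'(3)] d by metis
  next
    assume "F 1 t * (of_real ((b 0 t)\<^sup>2) - w * E t) / (of_real (b 0 t))\<^sup>2 = 0"
    with d have "((\<lambda>t. to_complex (evolutoid I f \<alpha> t)) has_vector_derivative 0) (at t within I)" by (simp only:)
    from bounded_linear.has_vector_derivative[OF bounded_linear_of_complex this]
    show "(evolutoid I f \<alpha> has_vector_derivative 0) (at t within I)"
      using linear_0[OF bounded_linear.linear[OF bounded_linear_of_complex]] by (simp add: of_to_complex)
  qed
  also have "\<dots> \<longleftrightarrow> w * E t = of_real ((b 0 t)\<^sup>2)"
    using t' regD by auto
  finally show ?thesis unfolding w_def .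
qed

text \<open>The divisor in the curvature is 0, so curvature and radius are 0 by the convention on
  division.\<close>

lemma evolutoid_at_cusp: "singular_pt I f t \<Longrightarrow> evolutoid I f \<alpha> t = f t"
  unfolding singular_pt_def evolutoid_def radius_def curvature_def by simp

text \<open>At a curved point w E = b^2 is solvable for \<alpha>, and every solution gives w / b = b
  / E, so the evolutoid point is \<gamma>(s). At a cusp all evolutoids pass through f(s) =
  \<gamma>(s), and the curve itself, the case \<alpha> = 0, is singular there.\<close>

lemma ses_image: "ses_param I f ` {s \<in> I. \<not> flat_pt I f s} = singular_evolutoids_set I f"
proof (intro equalityI subsetI)
  fix y assume "y \<in> ses_param I f ` {s \<in> I. \<not> flat_pt I f s}"
  then obtain s where s: "s \<in> I" "\<not> flat_pt I f s" "y = ses_param I f s" by blast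
  show "y \<in> singular_evolutoids_set I f"
  proof (cases "cusp I f s")
    case True
    then have sing: "singular_pt I f s" by (simp add: cusp_def)
    have "evolutoid I f 0 = f" by (simp add: evolutoid_def fun_eq_iff)
    moreover have "(f has_vector_derivative 0) (at s within I)"
      using smooth_on_has_vector_derivative_0[OF smooth s(1)] sing unfolding singular_pt_def by simp
    ultimately show ?thesis
      unfolding singular_evolutoids_set_def using s ses_at_cusp[OF s(1) True]
      by (intro CollectI exI[of _ 0] exI[of _ s]) simp
  next
    case False
    then have c: "s \<in> curved" using not_cusp_reg s by (simp add: flat_pt_iff curved_def)
    note b0 = curvedD(2)[OF c]
    \<comment> \<open>The angle in (0, pi) with cot \<alpha> = - rho'.\<close>
    define \<alpha> where "\<alpha> = pi / 2 + arctan (P s)"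
    have \<alpha>: "\<alpha> \<in> {0..pi}" using arctan_bounded[of "P s"] by (simp add: \<alpha>_def)
    have sin: "sin \<alpha> = 1 / sqrt (1 + (P s)\<^sup>2)" and cos: "cos \<alpha> = - P s / sqrt (1 + (P s)\<^sup>2)"
      by (simp_all add: \<alpha>_def sin_add cos_add cos_arctan sin_arctan)
    have E: "E s = of_real ((b 0 s)\<^sup>2) * (- of_real (P s) - \<i>)"
      using b0 by (simp add: E_ab P_def complex_eq_iff)
    have w: "of_real (sin \<alpha>) * cis \<alpha> * (- of_real (P s) - \<i>) = 1"
      unfolding complex_eq_iff using sum_power2_gt_zero_iff[of 1 "P s"]
      by (simp add: sin cos power2_eq_square) (simp add: field_simps)
    then have wE: "of_real (sin \<alpha>) * cis \<alpha> * E s = of_real ((b 0 s)\<^sup>2)"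
      unfolding E by (metis mult.left_commute mult.right_neutral)
    have Enz: "E s \<noteq> 0" using E_nonzero b0 by blast
    have "F 1 s * of_real (b 0 s) / E s = of_real (sin \<alpha>) * cis \<alpha> * (F 1 s / of_real (b 0 s))"
      using wE Enz b0 by (simp add: field_simps power2_eq_square)
    then have "to_complex (evolutoid I f \<alpha> s) = to_complex (ses_param I f s)"
      using ses_param_curved[OF c] to_complex_evolutoid[OF c] by simp
    then show ?thesis
      unfolding singular_evolutoids_set_def using s evolutoid_singular_iff[OF c] wE \<alpha> to_complex_eq_iff
      by (intro CollectI exI[of _ \<alpha>] exI[of _ s]) auto
  qed
next
  fix y assume "y \<in> singular_evolutoids_set I f"
  then obtain \<alpha> s where s: "s \<in> I" "\<not> flat_pt I f s" and y: "y = evolutoid I f \<alpha> s"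
    and d: "(evolutoid I f \<alpha> has_vector_derivative 0) (at s within I)"
    unfolding singular_evolutoids_set_def by blast
  have "y = ses_param I f s"
  proof (cases "cusp I f s")
    case True
    then show ?thesis using ses_at_cusp[OF s(1)] y evolutoid_at_cusp by (simp add: cusp_def)
  next
    case False
    then have c: "s \<in> curved" using not_cusp_reg s by (simp add: flat_pt_iff curved_def)
    note b0 = curvedD(2)[OF c]
    have wE: "of_real (sin \<alpha>) * cis \<alpha> * E s = of_real ((b 0 s)\<^sup>2)"
      using evolutoid_singular_iff[OF c] d by blast
    have Enz: "E s \<noteq> 0" using E_nonzero b0 by blast
    have "F 1 s * of_real (b 0 s) / E s = of_real (sin \<alpha>) * cis \<alpha> * (F 1 s / of_real (b 0 s))"
      using wE Enz b0 by (simp add: field_simps power2_eq_square)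
    then have "to_complex (evolutoid I f \<alpha> s) = to_complex (ses_param I f s)"
      using ses_param_curved[OF c] to_complex_evolutoid[OF c] by simp
    then show ?thesis using y to_complex_eq_iff by blast
  qed
  then show "y \<in> ses_param I f ` {s \<in> I. \<not> flat_pt I f s}" using s by blast
qed

text \<open>A flat point has a punctured neighbourhood of curved points, so its image is a limit of
  singular points of evolutoids.\<close>

lemma ses_closure: "ses_param I f ` I \<subseteq> closure (singular_evolutoids_set I f)"
proof
  fix y assume "y \<in> ses_param I f ` I"
  then obtain s where s: "s \<in> I" "y = ses_param I f s" by blast
  show "y \<in> closure (singular_evolutoids_set I f)"
  proof (cases "flat_pt I f s")
    case False
    then show ?thesis using s closure_subset unfolding ses_image[symmetric] by fastforce
  next
    case True
    then have "s \<notin> curved" using s by (simp add: flat_pt_iff curved_def)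
    from ses_param_near_special[OF s(1) this] obtain U where U: "open U" "s \<in> U" "\<forall>t\<in>I \<inter> U. t \<noteq> s \<longrightarrow> t \<in> curved"
      by blast
    have ev: "\<forall>\<^sub>F t in at s within I. ses_param I f t \<in> closure (singular_evolutoids_set I f)"
      unfolding eventually_at_topological
    proof (intro exI[of _ U] conjI ballI impI)
      fix x assume "x \<in> U" "x \<noteq> s" "x \<in> I"
      then have "x \<in> {s \<in> I. \<not> flat_pt I f s}" using U curved_iff by blast
      then show "ses_param I f x \<in> closure (singular_evolutoids_set I f)"
        using ses_image closure_subset by blast
    qed (use U in auto)
    have "(ses_param I f \<longlongrightarrow> ses_param I f s) (at s within I)"
      using smooth_on_continuous_on[OF smooth_ses_param, of 0] s(1) by (auto simp: continuous_on_def)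
    moreover have "at s within I \<noteq> bot" using perfect s by (simp add: perfect_on_def)
    ultimately show ?thesis using Lim_in_closed_set[OF closed_closure ev] s(2) by blast
  qed
qed

end

section \<open>Generic curves\<close>

context plane_curve
begin

lemma F_Suc_reg:
  assumes t: "t \<in> reg" and F: "\<And>x. x \<in> reg \<Longrightarrow> F j x = F 1 x * p x"
    and p: "(p has_vector_derivative p') (at t within I)"
  shows "F (Suc j) t = F 1 t * (Z 0 t * p t + p')"
proof -
  obtain U where U: "open U" "reg = I \<inter> U" using reg_open by blast
  have "((\<lambda>t. F 1 t * p t) has_vector_derivative (F 1 t * p' + F 2 t * p t)) (at t within I)"
    using F_deriv[of t 1] regD[OF t] by (intro has_vector_derivative_mult p) (simp add: numeral_2_eq_2)
  then have "(F j has_vector_derivative (F 1 t * p' + F 2 t * p t)) (at t within I)"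
    by (rule has_vector_derivative_cong_near[OF _ U(1)]) (use t F U in auto)
  then have "F (Suc j) t = F 1 t * p' + F 2 t * p t"
    using vector_derivative_unique_perfect[OF perfect] F_deriv regD(1)[OF t] by metis
  then show ?thesis unfolding F_2[OF t] by (simp add: algebra_simps)
qed

text \<open>Complete Bell polynomials in z and its derivatives, as f' is locally the exponential of
  a primitive of z; if a derivative of f is f' p, the next one is f' (z p + p'). They translate
  conditions on b and its derivatives into conditions on the first five derivatives of f.\<close>

lemma F_jet:
  assumes t: "t \<in> reg"
  shows "F 2 t = F 1 t * Z 0 t"
    and "F 3 t = F 1 t * (Z 1 t + (Z 0 t)\<^sup>2)"
    and "F 4 t = F 1 t * (Z 2 t + 3 * Z 0 t * Z 1 t + (Z 0 t)^3)"
    and "F 5 t = F 1 t * (Z 3 t + 4 * Z 0 t * Z 2 t + 3 * (Z 1 t)\<^sup>2 + 6 * (Z 0 t)\<^sup>2 * Z 1 t + (Z 0 t)^4)"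
proof -
  have Z: "(Z 0 has_vector_derivative Z 1 t) (at t within I)" "(Z 1 has_vector_derivative Z 2 t) (at t within I)"
    "(Z 2 has_vector_derivative Z 3 t) (at t within I)" if "t \<in> reg" for t
    using Z_deriv[OF that, of 0] Z_deriv[OF that, of 1] Z_deriv[OF that, of 2]
    by (simp_all add: numeral_2_eq_2 numeral_3_eq_3)
  have 2: "F 2 t = F 1 t * Z 0 t" if "t \<in> reg" for t
    using F_2[OF that] by simp
  have 3: "F 3 t = F 1 t * (Z 1 t + (Z 0 t)\<^sup>2)" if t: "t \<in> reg" for t
    using F_Suc_reg[OF t 2 Z(1)[OF t]] by (simp add: numeral_2_eq_2 numeral_3_eq_3 algebra_simps)
  have "((\<lambda>t. Z 1 t + Z 0 t * Z 0 t) has_vector_derivative Z 2 t + (Z 0 t * Z 1 t + Z 1 t * Z 0 t)) (at t within I)"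
    if "t \<in> reg" for t by (intro has_vector_derivative_add has_vector_derivative_mult Z that)
  from F_Suc_reg[OF _ _ this, of _ 3] 3
  have "F (Suc 3) t = F 1 t * (Z 0 t * (Z 1 t + Z 0 t * Z 0 t) + (Z 2 t + (Z 0 t * Z 1 t + Z 1 t * Z 0 t)))"
    if "t \<in> reg" for t using that by (simp add: power2_eq_square)
  then have 4: "F 4 t = F 1 t * (Z 2 t + 3 * Z 0 t * Z 1 t + (Z 0 t)^3)" if t: "t \<in> reg" for t
    using that by (simp add: algebra_simps power3_eq_cube)
  have "((\<lambda>t. Z 2 t + 3 * (Z 0 t * Z 1 t) + Z 0 t * (Z 0 t * Z 0 t)) has_vector_derivative 
      Z 3 t + 3 * (Z 0 t * Z 2 t + Z 1 t * Z 1 t) + (Z 0 t * (Z 0 t * Z 1 t + Z 1 t * Z 0 t) + Z 1 t * (Z 0 t * Z 0 t))) (at t within I)"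
    by (intro has_vector_derivative_add has_vector_derivative_mult has_vector_derivative_mult_right Z t)
  from F_Suc_reg[OF t _ this, of 4] 4
  have "F (Suc 4) t = F 1 t * (Z 0 t * (Z 2 t + 3 * (Z 0 t * Z 1 t) + Z 0 t * (Z 0 t * Z 0 t)) +
     (Z 3 t + 3 * (Z 0 t * Z 2 t + Z 1 t * Z 1 t) + (Z 0 t * (Z 0 t * Z 1 t + Z 1 t * Z 0 t) + Z 1 t * (Z 0 t * Z 0 t))))"
    by (simp add: power3_eq_cube mult.assoc)
  then show "F 5 t = F 1 t * (Z 3 t + 4 * Z 0 t * Z 2 t + 3 * (Z 1 t)\<^sup>2 + 6 * (Z 0 t)\<^sup>2 * Z 1 t + (Z 0 t)^4)"
    by (simp add: algebra_simps power2_eq_square power4_eq_xxxx)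
  show "F 2 t = F 1 t * Z 0 t" "F 3 t = F 1 t * (Z 1 t + (Z 0 t)\<^sup>2)"
    "F 4 t = F 1 t * (Z 2 t + 3 * Z 0 t * Z 1 t + (Z 0 t)^3)"
    by (rule 2[OF t] 3[OF t] 4[OF t])+
qed

end

text \<open>At a simple zero u has the sign of d on the right and the opposite sign on the left;
  division by a positive function keeps this.\<close>

lemma changes_sign_deriv:
  fixes u w :: "real \<Rightarrow> real"
  assumes d: "(u has_real_derivative d) (at s)" "d \<noteq> 0" "u s = 0"
    and w: "\<forall>\<^sub>F x in at s. w x > 0"
  shows "changes_sign UNIV (\<lambda>x. u x / w x) s"
proof -
  obtain e0 where e0: "e0 > 0" "\<And>x. x \<noteq> s \<Longrightarrow> dist x s < e0 \<Longrightarrow> w x > 0"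
    using w unfolding eventually_at by blast
  obtain e1 where e1: "e1 > 0" "\<And>h. 0 < h \<Longrightarrow> h < e1 \<Longrightarrow> u (s - h) * u (s + h) < 0 \<and> (d * u (s + h) > 0 \<and> d * u (s - h) < 0)"
  proof (cases "d > 0")
    case True
    obtain d1 d2 where "d1 > 0" "\<forall>h>0. h < d1 \<longrightarrow> u s < u (s + h)" "d2 > 0" "\<forall>h>0. h < d2 \<longrightarrow> u (s - h) < u s"
      using DERIV_pos_inc_right[OF d(1) True] DERIV_pos_inc_left[OF d(1) True] by blast
    then show ?thesis using d(3) True by (intro that[of "min d1 d2"]) (auto intro: mult_neg_pos mult_pos_neg mult_pos_pos)
  next
    case False
    then have False: "d < 0" using d(2) by simp
    obtain d1 d2 where "d1 > 0" "\<forall>h>0. h < d1 \<longrightarrow> u s > u (s + h)" "d2 > 0" "\<forall>h>0. h < d2 \<longrightarrow> u (s - h) > u s"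
      using DERIV_neg_dec_right[OF d(1) False] DERIV_neg_dec_left[OF d(1) False] by blast
    then show ?thesis using d(3) False by (intro that[of "min d1 d2"]) (auto intro: mult_neg_pos mult_pos_neg mult_neg_neg)
  qed
  define e where "e = min e0 e1"
  have "u x / w x * (u y / w y) < 0" if "x \<in> {s - e<..<s}" "y \<in> {s<..<s + e}" for x y
  proof -
    have "d * u x < 0" "d * u y > 0"
      using e1(2)[of "s - x"] e1(2)[of "y - s"] that by (auto simp: e_def)
    then have "u x * u y < 0" by (auto simp: mult_less_0_iff zero_less_mult_iff)
    moreover have "w x > 0" "w y > 0" using that by (auto intro!: e0(2) simp: e_def dist_real_def)
    ultimately show ?thesis by (simp add: divide_neg_pos mult_pos_pos)
  qed
  then show ?thesis unfolding changes_sign_def using e0 e1 by (intro exI[of _ e]) (auto simp: e_def)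
qed

lemma perfect_on_UNIV: "perfect_on UNIV"
  by (simp add: perfect_on_def)

lemma proper_interval_UNIV: "proper_interval UNIV"
  by (simp add: proper_interval_def)

lemma (in plane_curve) changes_sign_curvature:
  assumes I: "I = UNIV" and t: "F 1 t \<noteq> 0" and det: "Im (cnj (F 1 t) * F 2 t) = 0" "Im (cnj (F 1 t) * F 3 t) \<noteq> 0"
  shows "changes_sign UNIV (curvature I f) t"
proof -
  have "curvature I f = (\<lambda>x. Im (cnj (F 1 x) * F 2 x) / (cmod (F 1 x))^3)"
    by (simp only: fun_eq_iff curvature_def det2_to_complex v_nderiv v_def F_def simp_thms)
  moreover have "changes_sign UNIV (\<lambda>x. Im (cnj (F 1 x) * F 2 x) / (cmod (F 1 x))^3) t"
  proof (rule changes_sign_deriv)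
    show "((\<lambda>x. Im (cnj (F 1 x) * F 2 x)) has_real_derivative Im (cnj (F 1 t) * F 3 t)) (at t)"
      using det_F_deriv[of t] I by simp
    have "F 1 \<midarrow>t\<rightarrow> F 1 t"
      using F_continuous[of 1] I by (simp add: continuous_on_def)
    then have "\<forall>\<^sub>F x in at t. F 1 x \<noteq> 0" using t by (rule tendsto_imp_eventually_ne)
    then show "\<forall>\<^sub>F x in at t. 0 < cmod (F 1 x) ^ 3" by (rule eventually_mono) simp
  qed (use det in auto)
  ultimately show ?thesis by simp
qed

text \<open>Each condition forbids two real equations at one parameter: f' = 0, or a common zero of
  b, N2 or M with its derivative. Cusps of the curve itself are thereby excluded, and every
  parameter lies in \<open>simple\<close>.\<close>

locale generic_curve = plane_curve UNIV f for f +
  assumes regular: "F 1 t \<noteq> 0"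
    and simple_flat: "b 0 t = 0 \<Longrightarrow> b 1 t \<noteq> 0"
    and simple_N2: "b 0 t \<noteq> 0 \<Longrightarrow> N2 t = 0 \<Longrightarrow> N3 t \<noteq> 0"
    and simple_M: "b 0 t \<noteq> 0 \<Longrightarrow> M t = 0 \<Longrightarrow> M1 t \<noteq> 0"
begin

lemma reg: "t \<in> reg" and simple: "t \<in> simple"
  using regular simple_flat by (auto simp: reg_def simple_def)

lemma generic_cusps: "at_most_cusps UNIV f"
  using regular by (simp add: at_most_cusps_def singular_pt_F)

text \<open>Three derivatives decide: if f', f'' and f''' are all parallel to u, then z and z' are
  real by \<open>F_jet\<close>, so b = b' = 0.\<close>

lemma generic_finite_order: "not_locally_line UNIV f"
  unfolding not_locally_line_def
proof (intro ballI allI impI, rule ccontr)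
  fix s and u :: "real^2" assume u: "u \<noteq> 0" and *: "\<not> (\<exists>k\<ge>1. det2 u (nderiv UNIV k f s) \<noteq> 0)"
  define w where "w = cnj (to_complex u) * F 1 s"
  have w: "Im (cnj (to_complex u) * F k s) = 0" if "k \<ge> 1" for k
    using * that unfolding det2_to_complex F_def by blast
  have w1: "Im w = 0" using w[of 1] by (simp add: w_def)
  have "w \<noteq> 0" using u regular[of s] by (simp add: w_def to_complex_eq_0_iff)
  then have wnz: "Re w \<noteq> 0" using w1 by (simp add: complex_eq_iff)
  have "Im (w * Z 0 s) = 0" using w[of 2] unfolding F_jet(1)[OF reg] by (simp add: w_def mult.assoc)
  then have b0: "b 0 s = 0" using w1 wnz by (simp add: b_def)
  have "Im (w * (Z 1 s + (Z 0 s)\<^sup>2)) = 0" using w[of 3] unfolding F_jet(2)[OF reg] by (simp add: w_def mult.assoc)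
  then have "b 1 s = 0" using w1 wnz b0 by (simp add: b_def power2_eq_square)
  then show False using simple_flat[OF b0] by simp
qed

sublocale cusp_curve UNIV f
  by unfold_locales (rule proper_interval_UNIV generic_cusps generic_finite_order)+

lemma generic_ses_cusps: "at_most_cusps UNIV (ses_param UNIV f)"
  unfolding at_most_cusps_def
proof (intro ballI impI)
  fix t assume "singular_pt UNIV (ses_param UNIV f) t"
  then have N2: "N2 t = 0" using ses_singular[OF simple] by blast
  have "b 0 t \<noteq> 0" using N2 simple_flat[of t] by (auto simp: N2_def)
  then show "cusp UNIV (ses_param UNIV f) t" using ses_cusp[OF simple N2] simple_N2 N2 by blast
qed

text \<open>A flex is a zero of b M, and it remains to see that the zero is simple. If b = 0, then M
  = 5 b'^2, so b' M is nonzero; otherwise M = 0 and b M1 is nonzero. A simple zero changes sign,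
  which excludes undulation points.\<close>

lemma generic_flex:
  assumes "inflexion_pt UNIV (ses_param UNIV f) t \<or> undulation_pt UNIV (ses_param UNIV f) t"
  shows "nondegenerate UNIV (ses_param UNIV f) t" "\<not> undulation_pt UNIV (ses_param UNIV f) t"
proof -
  have *: "ses.F 1 t \<noteq> 0" "Im (cnj (ses.F 1 t) * ses.F 2 t) = 0"
    using assms ses.flex_iff[of t] by auto
  have N2: "N2 t \<noteq> 0" using *(1) unfolding ses_F_1[OF simple] by auto
  have bM: "b 0 t * M t = 0" using *(2) N2 wt_pos[OF simple, of t] unfolding ses_det[OF simple] by simp
  have "b 1 t * M t + b 0 t * M1 t \<noteq> 0"
  proof (cases "b 0 t = 0")
    case True
    have "M t = 5 * (b 1 t)\<^sup>2" by (simp add: M_def N2_def True)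
    then show ?thesis using True simple_flat[OF True] by simp
  next
    case False
    then show ?thesis using bM simple_M[of t] by simp
  qed
  then have det: "Im (cnj (ses.F 1 t) * ses.F 3 t) \<noteq> 0"
    unfolding ses_nondegenerate[OF simple bM] using N2 wt_pos[OF simple, of t] by simp
  then show "nondegenerate UNIV (ses_param UNIV f) t" unfolding ses.nondegenerate_F .
  show "\<not> undulation_pt UNIV (ses_param UNIV f) t"
    using ses.changes_sign_curvature[OF refl * det] by (simp add: undulation_pt_def)
qed

end

section \<open>Trigonometric perturbations and null sets of coefficients\<close>

definition trig :: "(nat \<Rightarrow> complex) \<Rightarrow> nat \<Rightarrow> real \<Rightarrow> complex" where
  "trig l j t = (\<Sum>k=1..5. (\<i> * of_nat k) ^ j * (l k * cis (real k * t)))"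

lemma trig_deriv: "(trig l j has_vector_derivative trig l (Suc j) t) (at t)"
  unfolding trig_def[abs_def]
proof (rule has_vector_derivative_sum)
  fix k :: nat
  have "((\<lambda>t. cis (real k * t)) has_vector_derivative (\<i> * of_nat k * cis (real k * t))) (at t)"
    unfolding has_vector_derivative_def
    by (auto intro!: derivative_eq_intros simp: fun_eq_iff scaleR_conv_of_real)
  then show "((\<lambda>t. (\<i> * of_nat k) ^ j * (l k * cis (real k * t))) has_vector_derivative
      (\<i> * of_nat k) ^ Suc j * (l k * cis (real k * t))) (at t)"
    by (intro has_vector_derivative_eq_rhs[OF has_vector_derivative_mult_right[OF has_vector_derivative_mult_right]])
      (auto simp: algebra_simps)
qed

lemma trig_periodic: "trig l j (t + 2 * pi) = trig l j t"
proof -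
  have "cis (real k * (t + 2 * pi)) = cis (real k * t)" for k
  proof -
    have "cis (real k * (t + 2 * pi)) = cis (real k * t) * cis (2 * pi * real k)"
      by (simp add: cis_mult algebra_simps)
    then show ?thesis by simp
  qed
  then show ?thesis by (simp add: trig_def)
qed

text \<open>Five terms of frequency at most 5 each, so j derivatives cost at most a factor 5^j,
  uniformly in t.\<close>

lemma trig_bound:
  assumes "\<And>k. k \<in> {1..5} \<Longrightarrow> norm (l k) \<le> r" "r \<ge> 0"
  shows "norm (trig l j t) \<le> 5 ^ Suc j * r"
proof -
  have "norm (trig l j t) \<le> (\<Sum>k=(1::nat)..5. 5 ^ j * r)"
    unfolding trig_def
  proof (rule sum_norm_le)
    fix k :: nat assume k: "k \<in> {1..5}"
    have "norm ((\<i> * of_nat k) ^ j * (l k * cis (real k * t))) = real k ^ j * norm (l k)"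
      by (simp add: norm_mult norm_power)
    also have "\<dots> \<le> 5 ^ j * r" using assms(1)[OF k] k by (intro mult_mono power_mono) auto
    finally show "norm ((\<i> * of_nat k) ^ j * (l k * cis (real k * t))) \<le> 5 ^ j * r" .
  qed
  then show ?thesis by simp
qed

type_synonym complex5 = "complex \<times> complex \<times> complex \<times> complex \<times> complex"

text \<open>The product type is a Euclidean space of real dimension 10, in which null sets make
  sense. The coefficient of frequency k sits at index k - 1.\<close>

definition coeffs5 :: "complex5 \<Rightarrow> nat \<Rightarrow> complex" where
  "coeffs5 l k = (case l of (l1, l2, l3, l4, l5) \<Rightarrow> [l1, l2, l3, l4, l5] ! (k - 1))"

text \<open>
  Inverse of the Vandermonde system at the nodes \<open>1, \<dots>, 5\<close>; the rows are the coefficients of the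
  Lagrange basis polynomials.
\<close>

definition trig_coeffs :: "real \<Rightarrow> complex \<Rightarrow> complex \<Rightarrow> complex \<Rightarrow> complex \<Rightarrow> complex \<Rightarrow> complex5" where
  "trig_coeffs t y1 y2 y3 y4 y5 =
    (cis (- t) * (y5 - 14 * (\<i> * y4) + 71 * (- y3) - 154 * (- \<i> * y2) + 120 * y1) / 24,
     cis (- (2 * t)) * - (y5 - 13 * (\<i> * y4) + 59 * (- y3) - 107 * (- \<i> * y2) + 60 * y1) / 6,
     cis (- (3 * t)) * (y5 - 12 * (\<i> * y4) + 49 * (- y3) - 78 * (- \<i> * y2) + 40 * y1) / 4,
     cis (- (4 * t)) * - (y5 - 11 * (\<i> * y4) + 41 * (- y3) - 61 * (- \<i> * y2) + 30 * y1) / 6,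
     cis (- (5 * t)) * (y5 - 10 * (\<i> * y4) + 35 * (- y3) - 50 * (- \<i> * y2) + 24 * y1) / 24)"

text \<open>After e^(i k t) is absorbed into the coefficients, the j-th derivative is i^j times a
  weighted power sum with nodes 1, ..., 5. A left inverse suffices: it exhibits the coefficients as
  a differentiable function of the parameter and the derivative values.\<close>

lemma trig_coeffs_trig:
  "trig_coeffs t (trig (coeffs5 l) 0 t) (trig (coeffs5 l) 1 t) (trig (coeffs5 l) 2 t)
     (trig (coeffs5 l) 3 t) (trig (coeffs5 l) 4 t) = l"
proof -
  obtain l1 l2 l3 l4 l5 where l: "l = (l1, l2, l3, l4, l5)" by (cases l) auto
  define u1 u2 u3 u4 u5 where u: "u1 = l1 * cis t" "u2 = l2 * cis (2 * t)" "u3 = l3 * cis (3 * t)"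
    "u4 = l4 * cis (4 * t)" "u5 = l5 * cis (5 * t)"
  have sum5: "(\<Sum>k=1..5. p k) = p 1 + p 2 + p 3 + p 4 + p 5" for p :: "nat \<Rightarrow> complex"
    by (simp add: eval_nat_numeral)
  have trig: "trig (coeffs5 l) j t = \<i> ^ j * (u1 + 2 ^ j * u2 + 3 ^ j * u3 + 4 ^ j * u4 + 5 ^ j * u5)" for j
    unfolding trig_def sum5 by (simp add: coeffs5_def l u power_mult_distrib distrib_left mult.assoc)
  have i: "\<i> ^ 0 = 1" "\<i> ^ 1 = \<i>" "\<i> ^ 2 = - 1" "\<i> ^ 3 = - \<i>" "\<i> ^ 4 = 1"
    by (simp_all add: eval_nat_numeral)
  have c: "cis (- x) * (y * cis x) = y" for x y
    by (simp add: cis_mult mult.left_commute[of _ y])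
  have "trig_coeffs t (trig (coeffs5 l) 0 t) (trig (coeffs5 l) 1 t) (trig (coeffs5 l) 2 t)
     (trig (coeffs5 l) 3 t) (trig (coeffs5 l) 4 t) =
     (cis (- t) * u1, cis (- (2 * t)) * u2, cis (- (3 * t)) * u3, cis (- (4 * t)) * u4, cis (- (5 * t)) * u5)"
    unfolding trig_coeffs_def trig i by (simp add: algebra_simps)
  then show ?thesis unfolding u c l .
qed

lemma trig_coeffs_differentiable:
  fixes T :: "'m::real_normed_vector \<Rightarrow> real"
  assumes "T differentiable (at x within S)" "y1 differentiable (at x within S)" "y2 differentiable (at x within S)" "y3 differentiable (at x within S)"
    "y4 differentiable (at x within S)" "y5 differentiable (at x within S)"
  shows "(\<lambda>d. trig_coeffs (T d) (y1 d) (y2 d) (y3 d) (y4 d) (y5 d)) differentiable (at x within S)"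
proof -
  have "(\<lambda>d. cis (- (c * T d))) differentiable (at x within S)" for c
  proof -
    have "(\<lambda>d. - (c * T d)) differentiable (at x within S)" using assms(1) by simp
    then show ?thesis unfolding differentiable_def using has_derivative_cis by blast
  qed
  from this[of 1] this[of 2] this[of 3] this[of 4] this[of 5] show ?thesis
    unfolding trig_coeffs_def using assms by simp
qed

text \<open>\<open>T\<close> is the parameter, the \<open>X\<close> are prescribed derivatives of
  the perturbed curve and the \<open>Y\<close> are those of the original one. At most nine real
  variables enter a space of dimension 10, and a differentiable image of a lower-dimensional set is
  null.\<close>

lemma negligible_trig_coeffs:
  fixes T :: "'m::euclidean_space \<Rightarrow> real"
  assumes dim: "DIM('m) < 10" and Y: "\<And>j t. Y j differentiable (at t)"
    and X: "\<And>d. d \<in> S \<Longrightarrow> T differentiable (at d)" "\<And>d. d \<in> S \<Longrightarrow> X1 differentiable (at d)"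
     "\<And>d. d \<in> S \<Longrightarrow> X2 differentiable (at d)" "\<And>d. d \<in> S \<Longrightarrow> X3 differentiable (at d)"
     "\<And>d. d \<in> S \<Longrightarrow> X4 differentiable (at d)" "\<And>d. d \<in> S \<Longrightarrow> X5 differentiable (at d)"
  shows "negligible ((\<lambda>d. trig_coeffs (T d) (X1 d - Y 1 (T d)) (X2 d - Y 2 (T d)) (X3 d - Y (3::nat) (T d))
    (X4 d - Y 4 (T d)) (X5 d - Y 5 (T d))) ` S)"
proof (rule negligible_differentiable_image_lowdim)
  show "DIM('m) < DIM(complex5)" using dim by simp
  have "(\<lambda>d. Y j (T d)) differentiable (at d)" if "d \<in> S" for j d
    using differentiable_chain_at[OF X(1)[OF that] Y] by (simp add: o_def)
  then show "(\<lambda>d. trig_coeffs (T d) (X1 d - Y 1 (T d)) (X2 d - Y 2 (T d)) (X3 d - Y 3 (T d))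
    (X4 d - Y 4 (T d)) (X5 d - Y 5 (T d))) differentiable_on S"
    by (intro differentiable_at_imp_differentiable_on trig_coeffs_differentiable X differentiable_diff)
qed

section \<open>Density in the Whitney topology\<close>

lemma differentiable_fst': "g differentiable (at x within S) \<Longrightarrow> (\<lambda>x. fst (g x)) differentiable (at x within S)"
  unfolding differentiable_def using has_derivative_fst by blast

lemma differentiable_snd': "g differentiable (at x within S) \<Longrightarrow> (\<lambda>x. snd (g x)) differentiable (at x within S)"
  unfolding differentiable_def using has_derivative_snd by blast

lemma differentiable_of_real':
  "g differentiable (at x within S) \<Longrightarrow> (\<lambda>x. of_real (g x) :: 'a::real_normed_algebra_1) differentiable (at x within S)"
  unfolding differentiable_def using has_derivative_of_real by blast

text \<open>Dividing the k-th coefficient by i k integrates the polynomial, so f' is perturbed with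
  the coefficients l themselves. Frequencies start at 1 because a constant term in f' would destroy
  periodicity.\<close>

definition perturb :: "(real \<Rightarrow> real^2) \<Rightarrow> complex5 \<Rightarrow> real \<Rightarrow> real^2" where
  "perturb f l t = f t + of_complex (trig (\<lambda>k. coeffs5 l k / (\<i> * of_nat k)) 0 t)"

lemma trig_Suc: "trig (\<lambda>k. l k / (\<i> * of_nat k)) (Suc j) t = trig l j t"
  unfolding trig_def by (intro sum.cong) auto

lemma
  assumes f: "smooth_on UNIV f"
  shows nderiv_perturb: "nderiv UNIV j (perturb f l) t =
      nderiv UNIV j f t + of_complex (trig (\<lambda>k. coeffs5 l k / (\<i> * of_nat k)) j t)"
    and smooth_perturb: "smooth_on UNIV (perturb f l)"
proof -
  define G where "G j t = nderiv UNIV j f t + of_complex (trig (\<lambda>k. coeffs5 l k / (\<i> * of_nat k)) j t)" for j t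
  have G: "(G j has_vector_derivative G (Suc j) t) (at t within UNIV)" for j t
    unfolding G_def
    by (rule has_vector_derivative_add[OF smooth_on_has_vector_derivative[OF f UNIV_I]
          bounded_linear.has_vector_derivative[OF bounded_linear_of_complex trig_deriv]])
  have G0: "perturb f l = G 0" by (simp add: fun_eq_iff G_def perturb_def)
  show "smooth_on UNIV (perturb f l)"
    unfolding G0 by (rule smooth_on_tower[of UNIV G, OF perfect_on_UNIV G])
  show "nderiv UNIV j (perturb f l) t = nderiv UNIV j f t + of_complex (trig (\<lambda>k. coeffs5 l k / (\<i> * of_nat k)) j t)"
    unfolding G0 using nderiv_tower[of UNIV G, OF perfect_on_UNIV G UNIV_I] by (simp add: G_def)
qed

lemma perturb_closed:
  assumes "f \<in> closed_curves"
  shows "perturb f l \<in> closed_curves"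
proof -
  have f: "smooth_on UNIV f" "\<And>t. f (t + 2 * pi) = f t" using assms by (auto simp: closed_curves_def)
  have "perturb f l (t + 2 * pi) = perturb f l t" for t
    unfolding perturb_def trig_periodic f(2) ..
  then show ?thesis using smooth_perturb[OF f(1)] unfolding closed_curves_def by blast
qed

lemma norm_coeffs5:
  assumes "k \<in> {1..5}"
  shows "norm (coeffs5 l k) \<le> norm l"
proof -
  obtain l1 l2 l3 l4 l5 where l: "l = (l1, l2, l3, l4, l5)" by (cases l) auto
  have le: "norm x \<le> norm (x, y)" "norm y \<le> norm (x, y)" for x :: complex and y :: "'b::real_normed_vector"
    by (simp_all add: norm_Pair real_le_rsqrt)
  have k: "k = 1 \<or> k = 2 \<or> k = 3 \<or> k = 4 \<or> k = 5" using assms by auto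
  have "norm l1 \<le> norm l" unfolding l by (rule le)
  moreover have "norm l2 \<le> norm l" unfolding l by (rule order_trans[OF le(1) le(2)])
  moreover have "norm l3 \<le> norm l" unfolding l by (rule order_trans[OF order_trans[OF le(1) le(2)] le(2)])
  moreover have "norm l4 \<le> norm l" unfolding l
    by (rule order_trans[OF order_trans[OF order_trans[OF le(1) le(2)] le(2)] le(2)])
  moreover have "norm l5 \<le> norm l" unfolding l
    by (rule order_trans[OF order_trans[OF order_trans[OF le(2) le(2)] le(2)] le(2)])
  ultimately show ?thesis using k by (auto simp: coeffs5_def l)
qed

lemma norm_of_complex: "norm (of_complex w) = norm w"
  using norm_to_complex[of "of_complex w"] by (simp add: to_of_complex)

lemma perturb_close:
  assumes f: "smooth_on UNIV f"
  shows "norm (nderiv UNIV j (perturb f l) t - nderiv UNIV j f t) \<le> 5 ^ Suc j * norm l"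
proof -
  have "norm (trig (\<lambda>k. coeffs5 l k / (\<i> * of_nat k)) j t) \<le> 5 ^ Suc j * norm l"
  proof (rule trig_bound)
    fix k :: nat assume k: "k \<in> {1..5}"
    have "norm (coeffs5 l k / (\<i> * of_nat k)) = norm (coeffs5 l k) / real k"
      by (simp add: norm_divide norm_mult)
    also have "\<dots> \<le> norm (coeffs5 l k) / 1" using k by (intro divide_left_mono) auto
    also have "\<dots> \<le> norm l" using norm_coeffs5[OF k] by simp
    finally show "norm (coeffs5 l k / (\<i> * of_nat k)) \<le> norm l" .
  qed simp
  then show ?thesis unfolding nderiv_perturb[OF f] by (simp add: norm_of_complex)
qed

text \<open>
  For \<open>e = 0\<close> the values of \<open>b''\<close> and \<open>b'''\<close> forced by \<open>N2 = N3 = 0\<close>, for \<open>e = 1\<close> those forced by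
  \<open>M = M1 = 0\<close>.
\<close>

definition forced2 :: "real \<Rightarrow> real \<Rightarrow> real \<Rightarrow> real \<Rightarrow> real \<Rightarrow> real" where
  "forced2 e a0 b0 a1 b1 =
    (2 * b1\<^sup>2 - a0 * b0 * b1 + a1 * b0\<^sup>2 + e * ((b0^4 + (a0 * b0 - b1)\<^sup>2) / 2)) / b0"

definition forced3 :: "real \<Rightarrow> real \<Rightarrow> real \<Rightarrow> real \<Rightarrow> real \<Rightarrow> real \<Rightarrow> real \<Rightarrow> real" where
  "forced3 e a0 b0 a1 b1 a2 b2 =
    (3 * b1 * b2 + a1 * b0 * b1 - a0 * b1\<^sup>2 - a0 * b0 * b2 + a2 * b0\<^sup>2
      + e * (2 * b0^3 * b1 + (a0 * b0 - b1) * (a1 * b0 + a0 * b1 - b2))) / b0"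

lemma (in plane_curve) forced:
  assumes "b 0 t \<noteq> 0"
  shows "N2 t = 0 \<Longrightarrow> b 2 t = forced2 0 (a 0 t) (b 0 t) (a 1 t) (b 1 t)"
    and "N3 t = 0 \<Longrightarrow> b 3 t = forced3 0 (a 0 t) (b 0 t) (a 1 t) (b 1 t) (a 2 t) (b 2 t)"
    and "M t = 0 \<Longrightarrow> b 2 t = forced2 1 (a 0 t) (b 0 t) (a 1 t) (b 1 t)"
    and "M1 t = 0 \<Longrightarrow> b 3 t = forced3 1 (a 0 t) (b 0 t) (a 1 t) (b 1 t) (a 2 t) (b 2 t)"
  using assms by (auto simp: N2_def N3_def M_def M1_def forced2_def forced3_def field_simps)

definition trig_gap :: "(nat \<Rightarrow> real \<Rightarrow> complex) \<Rightarrow> ('m \<Rightarrow> real) \<Rightarrow> ('m \<Rightarrow> complex) \<Rightarrow> ('m \<Rightarrow> complex) \<Rightarrow>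
    ('m \<Rightarrow> complex) \<Rightarrow> ('m \<Rightarrow> complex) \<Rightarrow> ('m \<Rightarrow> complex) \<Rightarrow> 'm \<Rightarrow> complex5" where
  "trig_gap Y T X1 X2 X3 X4 X5 = (\<lambda>d. trig_coeffs (T d) (X1 d - Y 1 (T d)) (X2 d - Y 2 (T d))
      (X3 d - Y 3 (T d)) (X4 d - Y 4 (T d)) (X5 d - Y 5 (T d)))"

lemma exists_generic_perturb:
  assumes f: "f \<in> closed_curves" and "r > 0"
  shows "\<exists>l. norm l < r \<and> generic_curve (perturb f l)"
proof -
  have smf: "smooth_on UNIV f" using f by (simp add: closed_curves_def)
  interpret f: plane_curve UNIV f by unfold_locales (rule perfect_on_UNIV smf)+
  have F: "f.F j differentiable (at t)" for j t
    using f.F_deriv[of t j] by (auto intro: differentiableI_vector)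
  note diff = differentiable_const differentiable_add differentiable_power differentiable_mult differentiable_fst' differentiable_snd' differentiable_of_real'
  \<comment> \<open>The parameter and four free derivatives, with f' = 0: 1 + 8 = 9 real
    dimensions.\<close>
  define bad1 where "bad1 = range (trig_gap f.F fst (\<lambda>_. 0) (\<lambda>d. fst (snd d)) (\<lambda>d. fst (snd (snd d)))
      (\<lambda>d. fst (snd (snd (snd d)))) (\<lambda>d :: real \<times> complex \<times> complex \<times> complex \<times> complex. snd (snd (snd (snd d)))))"
  have "negligible bad1"
    unfolding bad1_def trig_gap_def by (rule negligible_trig_coeffs) (auto intro!: F diff)
  \<comment> \<open>If b = b' = 0, then z and z' are real, so f'' and f''' are real multiples of f'.
    The parameter, three free derivatives and two real factors make 1 + 6 + 2 = 9
    dimensions.\<close>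
  define bad2 where "bad2 = range (trig_gap f.F fst (\<lambda>d. fst (snd d))
      (\<lambda>d. fst (snd d) * of_real (fst (snd (snd (snd (snd d))))))
      (\<lambda>d. fst (snd d) * of_real (snd (snd (snd (snd (snd d))))))
      (\<lambda>d. fst (snd (snd d)))
      (\<lambda>d :: real \<times> complex \<times> complex \<times> complex \<times> real \<times> real. fst (snd (snd (snd d)))))"
  have "negligible bad2"
    unfolding bad2_def trig_gap_def by (rule negligible_trig_coeffs) (auto intro!: F diff)
  \<comment> \<open>Coordinates of a regular jet: the parameter, f', and a, b with derivatives up to
    order three, except that b'' and b''' are forced by the degeneracy. This leaves 1 + 2 + 6 = 9
    dimensions.\<close>
  define x1 where "x1 d = fst (snd d)" for d :: "real \<times> complex \<times> real \<times> real \<times> real \<times> real \<times> real \<times> real"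
  define a0 where "a0 d = fst (snd (snd d))" for d :: "real \<times> complex \<times> real \<times> real \<times> real \<times> real \<times> real \<times> real"
  define b0 where "b0 d = fst (snd (snd (snd d)))" for d :: "real \<times> complex \<times> real \<times> real \<times> real \<times> real \<times> real \<times> real"
  define a1 where "a1 d = fst (snd (snd (snd (snd d))))" for d :: "real \<times> complex \<times> real \<times> real \<times> real \<times> real \<times> real \<times> real"
  define b1 where "b1 d = fst (snd (snd (snd (snd (snd d)))))" for d :: "real \<times> complex \<times> real \<times> real \<times> real \<times> real \<times> real \<times> real"
  define a2 where "a2 d = fst (snd (snd (snd (snd (snd (snd d))))))" for d :: "real \<times> complex \<times> real \<times> real \<times> real \<times> real \<times> real \<times> real"
  define a3 where "a3 d = snd (snd (snd (snd (snd (snd (snd d))))))" for d :: "real \<times> complex \<times> real \<times> real \<times> real \<times> real \<times> real \<times> real"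
  define b2 where "b2 e d = forced2 e (a0 d) (b0 d) (a1 d) (b1 d)" for e d
  define b3 where "b3 e d = forced3 e (a0 d) (b0 d) (a1 d) (b1 d) (a2 d) (b2 e d)" for e d
  define z0 where "z0 d = of_real (a0 d) + \<i> * of_real (b0 d)" for d
  define z1 where "z1 d = of_real (a1 d) + \<i> * of_real (b1 d)" for d
  define z2 where "z2 e d = of_real (a2 d) + \<i> * of_real (b2 e d)" for e d
  define z3 where "z3 e d = of_real (a3 d) + \<i> * of_real (b3 e d)" for e d
  have coord: "x1 differentiable (at d)" "a0 differentiable (at d)" "b0 differentiable (at d)" "a1 differentiable (at d)"
    "b1 differentiable (at d)" "a2 differentiable (at d)" "a3 differentiable (at d)" for d
    unfolding x1_def a0_def b0_def a1_def b1_def a2_def a3_def by (auto intro!: diff)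
  have db2: "b2 e differentiable (at d)" if "b0 d \<noteq> 0" for e d
    unfolding b2_def forced2_def using that coord by simp
  have db3: "b3 e differentiable (at d)" if "b0 d \<noteq> 0" for e d
    unfolding b3_def forced3_def using that coord db2[OF that] by simp
  have z: "z0 differentiable (at d)" "z1 differentiable (at d)" "z2 e differentiable (at d)" "z3 e differentiable (at d)"
    if "b0 d \<noteq> 0" for e d
    unfolding z0_def z1_def z2_def z3_def
    by (intro diff coord db2[OF that] db3[OF that])+
  \<comment> \<open>Restricted to nonzero b, where the quotients \<open>forced2\<close> and
    \<open>forced3\<close> are differentiable. If b = 0, then N2 = 0 or M = 0 forces b' = 0, a case
    covered by \<open>bad2\<close>.\<close>
  define bad3 where "bad3 e = (trig_gap f.F fst x1 (\<lambda>d. x1 d * z0 d) (\<lambda>d. x1 d * (z1 d + (z0 d)\<^sup>2))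
      (\<lambda>d. x1 d * (z2 e d + 3 * z0 d * z1 d + (z0 d)^3))
      (\<lambda>d. x1 d * (z3 e d + 4 * z0 d * z2 e d + 3 * (z1 d)\<^sup>2 + 6 * (z0 d)\<^sup>2 * z1 d + (z0 d)^4))) ` {d. b0 d \<noteq> 0}" for e
  have "negligible (bad3 e)" for e
    unfolding bad3_def trig_gap_def
  proof (rule negligible_trig_coeffs)
    fix d assume "d \<in> {d. b0 d \<noteq> 0}"
    then have "b0 d \<noteq> 0" by simp
    note z = z[OF this]
    show "(\<lambda>d. x1 d * z0 d) differentiable (at d)" "(\<lambda>d. x1 d * (z1 d + (z0 d)\<^sup>2)) differentiable (at d)"
      "(\<lambda>d. x1 d * (z2 e d + 3 * z0 d * z1 d + (z0 d)^3)) differentiable (at d)"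
      "(\<lambda>d. x1 d * (z3 e d + 4 * z0 d * z2 e d + 3 * (z1 d)\<^sup>2 + 6 * (z0 d)\<^sup>2 * z1 d + (z0 d)^4)) differentiable (at d)"
      "x1 differentiable (at d)" "fst differentiable (at d)"
      by (intro diff z coord differentiable_fst'[OF differentiable_ident])+
  qed (auto intro: F)
  then have "negligible (bad1 \<union> bad2 \<union> bad3 0 \<union> bad3 1)"
    using \<open>negligible bad1\<close> \<open>negligible bad2\<close> by (intro negligible_Un)
  moreover have "\<not> negligible (ball (0::complex5) r)"
    using \<open>r > 0\<close> by (intro open_not_negligible) auto
  ultimately have "\<not> ball 0 r \<subseteq> bad1 \<union> bad2 \<union> bad3 0 \<union> bad3 1"
    using negligible_subset by blast
  then obtain l where l: "norm l < r" "l \<notin> bad1" "l \<notin> bad2" "l \<notin> bad3 0" "l \<notin> bad3 1"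
    unfolding subset_iff mem_ball_0 Un_iff by blast
  interpret h: plane_curve UNIV "perturb f l"
    by unfold_locales (rule perfect_on_UNIV smooth_perturb smf)+
  have hF: "h.F (Suc j) t - f.F (Suc j) t = trig (coeffs5 l) j t" for j t
    unfolding h.F_def f.F_def nderiv_perturb[OF smf] to_complex_add to_of_complex trig_Suc by simp
  \<comment> \<open>The derivatives of the perturbed curve at any single t recover \<open>l\<close>,
    so a degeneracy at any parameter puts \<open>l\<close> into one of the bad sets.\<close>
  have rec: "trig_coeffs t (h.F 1 t - f.F 1 t) (h.F 2 t - f.F 2 t) (h.F 3 t - f.F 3 t)
      (h.F 4 t - f.F 4 t) (h.F 5 t - f.F 5 t) = l" for t
    using trig_coeffs_trig[of t l] hF[of 0 t] hF[of 1 t] hF[of 2 t] hF[of 3 t] hF[of 4 t]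
    by (simp add: eval_nat_numeral)
  have reg: "h.F 1 t \<noteq> 0" for t
  proof
    assume "h.F 1 t = 0"
    then have "l \<in> bad1"
      unfolding bad1_def
      using rec[of t] by (intro image_eqI[of _ _ "(t, h.F 2 t, h.F 3 t, h.F 4 t, h.F 5 t)"]) (simp_all add: trig_gap_def)
    then show False using l by simp
  qed
  then have t: "t \<in> h.reg" for t by (simp add: h.reg_def)
  have flat: "h.b 1 t \<noteq> 0" if b: "h.b 0 t = 0" for t
  proof
    assume b1: "h.b 1 t = 0"
    have Z: "h.Z 0 t = of_real (h.a 0 t)" "h.Z 1 t = of_real (h.a 1 t)"
      using b b1 by (simp_all add: h.a_def h.b_def complex_eq_iff)
    have "l \<in> bad2"
      unfolding bad2_def
      using rec[of t] unfolding h.F_jet(1)[OF t] h.F_jet(2)[OF t] Z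
      by (intro image_eqI[of _ _ "(t, h.F 1 t, h.F 4 t, h.F 5 t, h.a 0 t, h.a 1 t + (h.a 0 t)\<^sup>2)"])
        (simp_all add: trig_gap_def)
    then show False using l by simp
  qed
  have curved: "l \<in> bad3 e" if b0: "h.b 0 t \<noteq> 0" and b2: "h.b 2 t = forced2 e (h.a 0 t) (h.b 0 t) (h.a 1 t) (h.b 1 t)"
    and b3: "h.b 3 t = forced3 e (h.a 0 t) (h.b 0 t) (h.a 1 t) (h.b 1 t) (h.a 2 t) (h.b 2 t)" for e t
  proof -
    define d where "d = (t, h.F 1 t, h.a 0 t, h.b 0 t, h.a 1 t, h.b 1 t, h.a 2 t, h.a 3 t)"
    have d: "x1 d = h.F 1 t" "a0 d = h.a 0 t" "b0 d = h.b 0 t" "a1 d = h.a 1 t" "b1 d = h.b 1 t" "a2 d = h.a 2 t"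
      "a3 d = h.a 3 t" "fst d = t"
      by (simp_all add: d_def x1_def a0_def b0_def a1_def b1_def a2_def a3_def)
    have d': "b2 e d = h.b 2 t" "b3 e d = h.b 3 t" unfolding b2_def b3_def d using b2 b3 by auto
    have Z: "z0 d = h.Z 0 t" "z1 d = h.Z 1 t" "z2 e d = h.Z 2 t" "z3 e d = h.Z 3 t"
      unfolding z0_def z1_def z2_def z3_def d d' by (simp_all add: h.a_def h.b_def complex_eq_iff)
    show ?thesis
      unfolding bad3_def
    proof (rule image_eqI[of _ _ d])
      show "d \<in> {d. b0 d \<noteq> 0}" using b0 by (simp add: d)
      show "l = trig_gap f.F fst x1 (\<lambda>d. x1 d * z0 d) (\<lambda>d. x1 d * (z1 d + (z0 d)\<^sup>2))
          (\<lambda>d. x1 d * (z2 e d + 3 * z0 d * z1 d + (z0 d)^3))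
          (\<lambda>d. x1 d * (z3 e d + 4 * z0 d * z2 e d + 3 * (z1 d)\<^sup>2 + 6 * (z0 d)\<^sup>2 * z1 d + (z0 d)^4)) d"
        using rec[of t, symmetric] unfolding trig_gap_def d Z h.F_jet[OF t] .
    qed
  qed
  have "generic_curve (perturb f l)"
  proof unfold_locales
    show "h.F 1 t \<noteq> 0" for t by (rule reg)
    show "h.b 1 t \<noteq> 0" if "h.b 0 t = 0" for t by (rule flat[OF that])
    show "h.N3 t \<noteq> 0" if "h.b 0 t \<noteq> 0" "h.N2 t = 0" for t
      using curved[of t 0] h.forced(1,2)[OF that(1)] that l by blast
    show "h.M1 t \<noteq> 0" if "h.b 0 t \<noteq> 0" "h.M t = 0" for t
      using curved[of t 1] h.forced(3,4)[OF that(1)] that l by blast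
  qed
  then show ?thesis using l by blast
qed

section \<open>Neighbourhoods in the Whitney topology\<close>

lemma nderiv_periodic:
  assumes "f \<in> closed_curves"
  shows "nderiv UNIV k f (t + 2 * pi) = nderiv UNIV k f t"
proof -
  have sm: "smooth_on UNIV f" and per: "\<And>t. f (t + 2 * pi) = f t"
    using assms by (auto simp: closed_curves_def)
  define G where "G k t = nderiv UNIV k f (t + 2 * pi)" for k t
  have "(G k has_vector_derivative G (Suc k) t) (at t within UNIV)" for k t
  proof -
    have "((\<lambda>t. t + 2 * pi) has_vector_derivative 1) (at t within UNIV)"
      by (auto intro!: derivative_eq_intros)
    moreover have "(nderiv UNIV k f has_vector_derivative nderiv UNIV (Suc k) f (t + 2 * pi))
        (at (t + 2 * pi) within range (\<lambda>t. t + 2 * pi))"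
      using smooth_on_has_vector_derivative[OF sm UNIV_I] by (rule has_vector_derivative_within_subset) simp
    ultimately show ?thesis
      using vector_diff_chain_within[of "\<lambda>t. t + 2 * pi" 1 t UNIV "nderiv UNIV k f" "nderiv UNIV (Suc k) f (t + 2 * pi)"]
      unfolding G_def[abs_def] o_def scaleR_one by blast
  qed
  then have "nderiv UNIV k (G 0) t = G k t"
    by (intro nderiv_tower[of UNIV G] perfect_on_UNIV) auto
  moreover have "G 0 = f" by (simp add: G_def fun_eq_iff per)
  ultimately show ?thesis by (simp add: G_def)
qed

lemma jet_reduce:
  assumes "f \<in> closed_curves"
  shows "\<exists>t'\<in>{0..2 * pi}. jet k f t = jet k f t'"
proof -
  interpret periodic_fun_simple "jet k f" "2 * pi"
  proof
    fix x
    have "cis (x + 2 * pi) = cis x" using cis_mult[of x "2 * pi"] by simp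
    then show "jet k f (x + 2 * pi) = jet k f x"
      by (simp add: jet_def nderiv_periodic[OF assms] fun_eq_iff)
  qed
  define n where "n = \<lfloor>t / (2 * pi)\<rfloor>"
  have "of_int n \<le> t / (2 * pi)" "t / (2 * pi) < of_int n + 1" by (simp_all add: n_def)
  then have "of_int n * (2 * pi) \<le> t" "t < (of_int n + 1) * (2 * pi)"
    by (simp_all add: field_simps)
  then have "t - of_int n * (2 * pi) \<in> {0..2 * pi}" by (simp add: algebra_simps)
  moreover have "jet k f t = jet k f (t - of_int n * (2 * pi))"
    using minus_of_int[of t n] by simp
  ultimately show ?thesis by blast
qed

lemma jet_continuous:
  assumes "f \<in> closed_curves"
  shows "continuous_on S (jet k f)"
proof -
  have "continuous_on UNIV (nderiv UNIV i f)" for i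
    using assms smooth_on_continuous_on by (auto simp: closed_curves_def)
  then have "continuous_on UNIV (\<lambda>t. if i \<le> k then nderiv UNIV i f t else 0)" for i
    by (cases "i \<le> k") simp_all
  then have "continuous_on UNIV (jet k f)"
    unfolding jet_def[abs_def]
    by (intro continuous_intros continuous_on_coordinatewise_then_product) auto
  then show ?thesis using continuous_on_subset by blast
qed

lemma jet_dist:
  assumes "e > 0"
  shows "\<exists>\<delta>>0. \<forall>f h t. (\<forall>i\<le>k. norm (nderiv UNIV i h t - nderiv UNIV i f t) < \<delta>) \<longrightarrow>
      dist (jet k f t) (jet k h t) < e"
proof -
  obtain N where N: "(1/2::real) ^ N < e / 2" using real_arch_pow_inv[of "e/2" "1/2"] assms by auto
  \<comment> \<open>The product metric is at most twice the largest of finitely many coordinate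
    distances plus the tail (1/2)^N. With the tail below e / 2, the bound e / 4 suffices; the base
    points \<open>cis t\<close> agree.\<close>
  have "dist (jet k f t) (jet k h t) < e"
    if *: "\<forall>i\<le>k. norm (nderiv UNIV i h t - nderiv UNIV i f t) < e / 4" for f h t
  proof -
    have "dist (snd (jet k f t)) (snd (jet k h t)) \<le>
       2 * Max {dist (snd (jet k f t) (from_nat n)) (snd (jet k h t) (from_nat n)) |n. n \<le> N} + (1/2)^N"
      by (rule dist_fun_le_dist_first_terms)
    also have "Max {dist (snd (jet k f t) (from_nat n)) (snd (jet k h t) (from_nat n)) |n. n \<le> N} \<le> e / 4"
    proof (rule Max.boundedI)
      have "{dist (snd (jet k f t) (from_nat n)) (snd (jet k h t) (from_nat n)) |n. n \<le> N}
         = (\<lambda>n. dist (snd (jet k f t) (from_nat n)) (snd (jet k h t) (from_nat n))) ` {..N}" by auto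
      then show "finite {dist (snd (jet k f t) (from_nat n)) (snd (jet k h t) (from_nat n)) |n. n \<le> N}" by simp
    next
      fix x assume "x \<in> {dist (snd (jet k f t) (from_nat n)) (snd (jet k h t) (from_nat n)) |n. n \<le> N}"
      then obtain n where "x = dist (snd (jet k f t) (from_nat n)) (snd (jet k h t) (from_nat n))" by blast
      then show "x \<le> e / 4" using * assms by (auto simp: jet_def dist_norm norm_minus_commute intro: less_imp_le)
    qed auto
    finally have "dist (snd (jet k f t)) (snd (jet k h t)) < e" using N by simp
    then show ?thesis by (simp add: jet_def dist_Pair_Pair)
  qed
  then show ?thesis using assms by (intro exI[of _ "e / 4"]) auto
qed

text \<open>Every Whitney open set around f contains a C^K ball, which is what density requires.
  Intersections take the larger order and the smaller radius; for a basic set, the jets of f over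
  one period form a compact set and keep a uniform distance from the complement of U.\<close>

lemma whitney_neighbourhood:
  assumes "openin whitney_topology T" "f \<in> T" "f \<in> closed_curves"
  shows "\<exists>K \<delta>. \<delta> > 0 \<and> (\<forall>h\<in>closed_curves.
     (\<forall>i\<le>K. \<forall>t. norm (nderiv UNIV i h t - nderiv UNIV i f t) < \<delta>) \<longrightarrow> h \<in> T)"
proof -
  define close where "close K d h \<longleftrightarrow> (\<forall>i\<le>K. \<forall>t. norm (nderiv UNIV i h t - nderiv UNIV i f t) < d)"
    for K d h
  have close_mono: "close K d h" if "close K' d' h" "K \<le> K'" "d' \<le> d" for K K' d d' h
    unfolding close_def
  proof (intro allI impI)
    fix i t assume "i \<le> K"
    then have "norm (nderiv UNIV i h t - nderiv UNIV i f t) < d'"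
      using that(1,2) order_trans unfolding close_def by blast
    then show "norm (nderiv UNIV i h t - nderiv UNIV i f t) < d" using that(3) by (rule less_le_trans)
  qed
  have "generate_topology_on {{f \<in> closed_curves. \<forall>t. jet k f t \<in> U} | k U. open U} T"
    using assms(1) unfolding whitney_topology_def openin_topology_generated_by_iff .
  then have "\<exists>K d. d > 0 \<and> (\<forall>h\<in>closed_curves. close K d h \<longrightarrow> h \<in> T)" using assms(2)
  proof induction
    case Empty
    then show ?case by simp
  next
    case (Int S T)
    then obtain K1 d1 K2 d2 where *: "d1 > 0" "\<forall>h\<in>closed_curves. close K1 d1 h \<longrightarrow> h \<in> S"
      "d2 > 0" "\<forall>h\<in>closed_curves. close K2 d2 h \<longrightarrow> h \<in> T"
      by blast
    have "h \<in> S \<inter> T" if "h \<in> closed_curves" "close (max K1 K2) (min d1 d2) h" for h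
      using close_mono[OF that(2), of K1 d1] close_mono[OF that(2), of K2 d2] * that(1) by auto
    then show ?case using *(1,3) by (intro exI[of _ "max K1 K2"] exI[of _ "min d1 d2"]) simp
  next
    case (UN \<K>)
    then obtain S where "S \<in> \<K>" "f \<in> S" by blast
    with UN obtain K d where "d > 0" "\<forall>h\<in>closed_curves. close K d h \<longrightarrow> h \<in> S" by blast
    then show ?case using \<open>S \<in> \<K>\<close> by blast
  next
    case (Basis S)
    then obtain k U where S: "S = {f \<in> closed_curves. \<forall>t. jet k f t \<in> U}" and U: "open U" by blast
    have "compact (jet k f ` {0..2 * pi})"
      by (intro compact_continuous_image jet_continuous assms) simp
    moreover have "jet k f ` {0..2 * pi} \<subseteq> U" using Basis(2) S by auto
    ultimately obtain e where e: "e > 0" "(\<Union>x\<in>jet k f ` {0..2 * pi}. ball x e) \<subseteq> U"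
      using compact_subset_open_imp_ball_epsilon_subset U by metis
    obtain \<delta> where \<delta>: "\<delta> > 0" "\<And>h t. (\<forall>i\<le>k. norm (nderiv UNIV i h t - nderiv UNIV i f t) < \<delta>) \<Longrightarrow>
      dist (jet k f t) (jet k h t) < e" using jet_dist[OF e(1), of k] by blast
    have "h \<in> S" if h: "h \<in> closed_curves" "close k \<delta> h" for h
    proof -
      have "jet k h t \<in> U" for t
      proof -
        obtain t' where "t' \<in> {0..2 * pi}" "jet k f t = jet k f t'" using jet_reduce[OF assms(3)] by blast
        moreover have "jet k h t \<in> ball (jet k f t) e" using \<delta>(2) h(2) unfolding close_def mem_ball by blast
        ultimately show ?thesis using e(2) by fastforce
      qed
      then show ?thesis using h S by simp
    qed
    then show ?case using \<delta>(1) by blast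
  qed
  then show ?thesis unfolding close_def .
qed

lemma generic_dense:
  "whitney_topology closure_of
        {h \<in> closed_curves. at_most_cusps UNIV h \<and> not_locally_line UNIV h \<and>
           at_most_cusps UNIV (ses_param UNIV h) \<and>
           (\<forall>s. \<not> undulation_pt UNIV (ses_param UNIV h) s) \<and>
           (\<forall>s. inflexion_pt UNIV (ses_param UNIV h) s \<longrightarrow>
                  nondegenerate UNIV (ses_param UNIV h) s)}
      = closed_curves" (is "_ closure_of ?good = _")
proof -
  \<comment> \<open>The basic set with U = \<open>UNIV\<close> is all of
    \<open>closed_curves\<close>.\<close>
  have top: "topspace whitney_topology = closed_curves"
    unfolding whitney_topology_def topology_generated_by_topspace by (auto intro: open_UNIV)
  have "f \<in> whitney_topology closure_of ?good" if f: "f \<in> closed_curves" for f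
    unfolding in_closure_of top
  proof (intro conjI allI impI)
    show "f \<in> closed_curves" by (rule f)
    fix T assume "f \<in> T \<and> openin whitney_topology T"
    then obtain K \<delta> where K: "\<delta> > 0" "\<forall>h\<in>closed_curves.
     (\<forall>i\<le>K. \<forall>t. norm (nderiv UNIV i h t - nderiv UNIV i f t) < \<delta>) \<longrightarrow> h \<in> T"
      using whitney_neighbourhood[OF _ _ f] by blast
    have sm: "smooth_on UNIV f" using f by (simp add: closed_curves_def)
    \<comment> \<open>By \<open>perturb_close\<close> this radius keeps all differences of
      derivatives up to order K below \<delta>.\<close>
    obtain l where l: "norm l < \<delta> / 5 ^ Suc K" and gen: "generic_curve (perturb f l)"
      using exists_generic_perturb[OF f, of "\<delta> / 5 ^ Suc K"] K(1) by auto
    have "norm (nderiv UNIV i (perturb f l) t - nderiv UNIV i f t) < \<delta>" if "i \<le> K" for i t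
    proof -
      have "norm (nderiv UNIV i (perturb f l) t - nderiv UNIV i f t) \<le> 5 ^ Suc i * norm l"
        by (rule perturb_close[OF sm])
      also have "\<dots> \<le> 5 ^ Suc K * norm l" using that by (intro mult_right_mono power_increasing) auto
      also have "\<dots> < \<delta>" using l by (simp add: field_simps)
      finally show ?thesis .
    qed
    then have "perturb f l \<in> T" using K(2) perturb_closed[OF f] by blast
    moreover have "perturb f l \<in> ?good"
    proof -
      interpret generic_curve "perturb f l" by (rule gen)
      show ?thesis using perturb_closed[OF f] generic_cusps generic_finite_order generic_ses_cusps generic_flex
        by blast
    qed
    ultimately show "\<exists>y. y \<in> ?good \<and> y \<in> T" by blast
  qed
  then show ?thesis using closure_of_subset_topspace[of whitney_topology ?good] top by blast
qed

theorem theorem3p2: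
  fixes I :: "real set" and f :: "real \<Rightarrow> real^2"
  assumes "proper_interval I"
    and "smooth_on I f"
    and "at_most_cusps I f"
    and "not_locally_line I f"
  shows "let \<gamma> = ses_param I f; \<rho> = radius I f;
             \<rho>1 = radius_deriv I f 1; \<rho>2 = radius_deriv I f 2; \<rho>3 = radius_deriv I f 3
    in
      (smooth_on I \<gamma> \<and>
       \<gamma> ` {s\<in>I. \<not> flat_pt I f s} = singular_evolutoids_set I f \<and>
       \<gamma> ` I \<subseteq> closure (singular_evolutoids_set I f))
    \<and> (\<forall>s\<in>I. \<not> cusp I f s \<longrightarrow>
         (singular_pt I \<gamma> s \<longleftrightarrow> \<not> flat_pt I f s \<and> \<rho>2 s = 0) \<and>
         (singular_pt I \<gamma> s \<longrightarrow> (cusp I \<gamma> s \<longleftrightarrow> \<rho>3 s \<noteq> 0)))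
    \<and> (\<forall>s\<in>I. cusp I f s \<longrightarrow> \<gamma> s = f s \<and> cusp I \<gamma> s)
    \<and> (\<forall>s\<in>I. \<not> flat_pt I f s \<longrightarrow>
         (inflexion_pt I \<gamma> s \<or> undulation_pt I \<gamma> s \<longleftrightarrow>
            \<not> cusp I f s \<and> 1 + (\<rho>1 s)\<^sup>2 + 2 * \<rho> s * \<rho>2 s = 0) \<and>
         (inflexion_pt I \<gamma> s \<longrightarrow>
            (nondegenerate I \<gamma> s \<longleftrightarrow> \<rho>1 s + (\<rho>1 s)^3 - (\<rho> s)\<^sup>2 * \<rho>3 s \<noteq> 0)))
    \<and> whitney_topology closure_of
        {h \<in> closed_curves. at_most_cusps UNIV h \<and> not_locally_line UNIV h \<and>
           at_most_cusps UNIV (ses_param UNIV h) \<and>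
           (\<forall>s. \<not> undulation_pt UNIV (ses_param UNIV h) s) \<and>
           (\<forall>s. inflexion_pt UNIV (ses_param UNIV h) s \<longrightarrow>
                  nondegenerate UNIV (ses_param UNIV h) s)}
      = closed_curves"
proof -
  interpret cusp_curve I f
    by unfold_locales (use assms proper_interval_perfect in auto)
  show ?thesis
    unfolding Let_def
    by (intro conjI ballI impI smooth_ses_param ses_image ses_closure ses_singular_iff ses_flex_iff generic_dense
        ses_at_cusp[THEN conjunct1] ses_at_cusp[THEN conjunct2])
qed

end
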